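(* Let $X$ be a Peano continuum that is one-dimensional, or an absolute neighborhood retract, or, more generally, such that $\mathrm{LC}(X)$ is dense in $\mathrm{C}(X)$. Then (1) the set of exact Devaney chaotic maps is dense in $\mathrm{CT}(X)$; (2) a generic map $f\in \mathrm{CT}(X)$ is mixing, i.e. the set of mixing maps is comeager in the (complete) space $\mathrm{CT}(X)$; (3) a generic map $f\in \mathrm{C}(X)$ has shadowing, i.e. the set of maps with the shadowing property is comeager in $\mathrm{C}(X)$.
   Context: A continuum is a compact connected metrizable space; a Peano continuum is a locally connected continuum. Dimension is topological (covering) dimension. An absolute neighborhood retract is a compact space homeomorphic to a neighborhood retract of the Hilbert cube (a subset $A$ of the Hilbert cube $Q$ for which there are a neighborhood $U$ of $A$ in $Q$ and a retraction $U\to A$). Fix a compatible metric $d$ on $X$. $\mathrm{C}(X)$ is the space of all continuous maps $X\to X$ with the supremum metric. $\mathrm{LC}(X)$ is the set of $f\in \mathrm{C}(X)$ for which there is a dense set $D\subseteq X$ such that every $x\in D$ has a neighborhood $U$ with $f|_U$ constant. For $\delta>0$, a $\delta$-chain of $f$ from $x_0$ to $x_n$ is a finite sequence $x_0,\dots,x_n\in X$ with $d(f(x_i),x_{i+1})<\delta$ for $0\le i\le n-1$. A map $f$ is chain transitive if for all $x,y\in X$ and $\delta>0$ there is a $\delta$-chain from $x$ to $y$; $\mathrm{CT}(X)$ is the set of all chain transitive $f\in \mathrm{C}(X)$ (a closed subset of $\mathrm{C}(X)$), with the subspace topology. A map $f\in \mathrm{C}(X)$ is: transitive if for all nonempty open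 $U,V\subseteq X$ there is a natural number $n$ with $f^n(U)\cap V\ne\emptyset$; exact if for every nonempty open $U\subseteq X$ there is $n\in\mathbb{N}$ with $f^n(U)=X$; Devaney chaotic if it is transitive and its set of periodic points is dense in $X$; exact Devaney chaotic if it is exact and Devaney chaotic; mixing if for all nonempty open $U,V\subseteq X$ there is $N$ such that $f^n(U)\cap V\neq\emptyset$ for all $n\ge N$. A map $f$ has shadowing if for every $\varepsilon>0$ there is $\delta>0$ such that for every sequence $(x_i)_{i\ge0}$ in $X$ with $d(f(x_i),x_{i+1})<\delta$ for all $i$, there is $x\in X$ with $d(x_i,f^i(x))<\varepsilon$ for all $i\ge 0$. *)

theory Defs
  imports "HOL-Analysis.Analysis"
begin

section \<open>Spaces\<close>

text \<open>
  The space \<open>X\<close> with its fixed compatible metric is a type \<open>'a\<close> of class \<open>metric_space\<close>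
  whose \<open>UNIV\<close> is a Peano continuum.
\<close>

definition peano_continuum :: "'a::metric_space set \<Rightarrow> bool" where
  "peano_continuum S \<longleftrightarrow> S \<noteq> {} \<and> compact S \<and> connected S \<and> locally connected S"

text \<open>
  Covering dimension at most \<open>n\<close>: each finite open cover has a finite open refinement of
  order at most \<open>n\<close>, that is, no point lies in more than \<open>n + 1\<close> of its members.
\<close>

definition covering_dim_le :: "'a topology \<Rightarrow> nat \<Rightarrow> bool" where
  "covering_dim_le X n \<longleftrightarrow>
     (\<forall>\<U>. finite \<U> \<and> (\<forall>U\<in>\<U>. openin X U) \<and> \<Union>\<U> = topspace X \<longrightarrow>
        (\<exists>\<V>. finite \<V> \<and> (\<forall>V\<in>\<V>. openin X V) \<and> \<Union>\<V> = topspace X \<and>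
             (\<forall>V\<in>\<V>. \<exists>U\<in>\<U>. V \<subseteq> U) \<and>
             (\<forall>x\<in>topspace X. card {V \<in> \<V>. x \<in> V} \<le> n + 1)))"

text \<open>
  The value is \<open>\<infinity>\<close> if no bound exists. The empty space gets \<open>0\<close> instead of the usual \<open>-1\<close>.
\<close>

definition covering_dim :: "'a topology \<Rightarrow> enat" where
  "covering_dim X = Inf {enat n |n. covering_dim_le X n}"

text \<open>The type \<open>nat \<Rightarrow> real\<close> carries the product topology.\<close>

definition hilbert_cube :: "(nat \<Rightarrow> real) set" where
  "hilbert_cube = {x. \<forall>i. 0 \<le> x i \<and> x i \<le> 1}"

text \<open>
  The library's \<open>ANR\<close> quantifies over closed embeddings into the single type
  \<open>'a \<times> real\<close>, which is adequate only for Euclidean \<open>'a\<close>. Shrinking a neighbourhood to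
  an open one preserves the existence of a retraction, so \<open>U\<close> is taken open in the cube.
\<close>

definition compact_ANR :: "'a::topological_space set \<Rightarrow> bool" where
  "compact_ANR S \<longleftrightarrow> compact S \<and>
     (\<exists>A U. A \<subseteq> U \<and> openin (top_of_set hilbert_cube) U \<and>
            A retract_of U \<and> S homeomorphic A)"


section \<open>Density and category\<close>

definition dense_in :: "'a topology \<Rightarrow> 'a set \<Rightarrow> bool" where
  "dense_in T S \<longleftrightarrow> S \<subseteq> topspace T \<and> T closure_of S = topspace T"

definition nowhere_dense_in :: "'a topology \<Rightarrow> 'a set \<Rightarrow> bool" where
  "nowhere_dense_in T S \<longleftrightarrow> S \<subseteq> topspace T \<and> T interior_of (T closure_of S) = {}"

definition meager_in :: "'a topology \<Rightarrow> 'a set \<Rightarrow> bool" where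
  "meager_in T S \<longleftrightarrow> (\<exists>\<N>. countable \<N> \<and> (\<forall>N\<in>\<N>. nowhere_dense_in T N) \<and> S = \<Union>\<N>)"

definition comeager_in :: "'a topology \<Rightarrow> 'a set \<Rightarrow> bool" where
  "comeager_in T S \<longleftrightarrow> S \<subseteq> topspace T \<and> meager_in T (topspace T - S)"


section \<open>Dynamical properties of a self-map\<close>

definition delta_chain :: "('a::metric_space \<Rightarrow> 'a) \<Rightarrow> real \<Rightarrow> (nat \<Rightarrow> 'a) \<Rightarrow> nat \<Rightarrow> bool" where
  "delta_chain f \<delta> x n \<longleftrightarrow> (\<forall>i<n. dist (f (x i)) (x (Suc i)) < \<delta>)"

definition chain_transitive :: "('a::metric_space \<Rightarrow> 'a) \<Rightarrow> bool" where
  "chain_transitive f \<longleftrightarrow>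
     (\<forall>a b. \<forall>\<delta>>0. \<exists>x n. x 0 = a \<and> x n = b \<and> delta_chain f \<delta> x n)"

definition transitive_map :: "('a::topological_space \<Rightarrow> 'a) \<Rightarrow> bool" where
  "transitive_map f \<longleftrightarrow>
     (\<forall>U V. open U \<and> U \<noteq> {} \<and> open V \<and> V \<noteq> {} \<longrightarrow> (\<exists>n\<ge>1. (f ^^ n) ` U \<inter> V \<noteq> {}))"

definition exact_map :: "('a::topological_space \<Rightarrow> 'a) \<Rightarrow> bool" where
  "exact_map f \<longleftrightarrow> (\<forall>U. open U \<and> U \<noteq> {} \<longrightarrow> (\<exists>n\<ge>1. (f ^^ n) ` U = UNIV))"

definition mixing_map :: "('a::topological_space \<Rightarrow> 'a) \<Rightarrow> bool" where
  "mixing_map f \<longleftrightarrow>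
     (\<forall>U V. open U \<and> U \<noteq> {} \<and> open V \<and> V \<noteq> {} \<longrightarrow>
        (\<exists>N. \<forall>n\<ge>N. (f ^^ n) ` U \<inter> V \<noteq> {}))"

definition periodic_points :: "('a \<Rightarrow> 'a) \<Rightarrow> 'a set" where
  "periodic_points f = {x. \<exists>n\<ge>1. (f ^^ n) x = x}"

definition devaney_chaotic :: "('a::topological_space \<Rightarrow> 'a) \<Rightarrow> bool" where
  "devaney_chaotic f \<longleftrightarrow> transitive_map f \<and> closure (periodic_points f) = UNIV"

definition exact_devaney_chaotic :: "('a::topological_space \<Rightarrow> 'a) \<Rightarrow> bool" where
  "exact_devaney_chaotic f \<longleftrightarrow> exact_map f \<and> devaney_chaotic f"

definition shadowing :: "('a::metric_space \<Rightarrow> 'a) \<Rightarrow> bool" where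
  "shadowing f \<longleftrightarrow>
     (\<forall>\<epsilon>>0. \<exists>\<delta>>0. \<forall>x :: nat \<Rightarrow> 'a.
        (\<forall>i. dist (f (x i)) (x (Suc i)) < \<delta>) \<longrightarrow>
        (\<exists>z. \<forall>i. dist (x i) ((f ^^ i) z) < \<epsilon>))"


section \<open>Spaces of maps\<close>

text \<open>
  For compact \<open>X\<close>, the space \<open>C(X)\<close> with the supremum metric is the type \<open>'a \<Rightarrow>\<^sub>C 'a\<close> of
  bounded continuous maps, because boundedness is then automatic:
\<close>

lemma continuous_imp_bcontfun:
  fixes f :: "'a::metric_space \<Rightarrow> 'a"
  assumes "compact (UNIV :: 'a set)" "continuous_on UNIV f"
  shows "f \<in> bcontfun"
  using assms by (simp add: bcontfun_def compact_continuous_image compact_imp_bounded)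

definition LC_maps :: "('a::metric_space \<Rightarrow>\<^sub>C 'a) set" where
  "LC_maps = {f. \<exists>D. closure D = UNIV \<and> (\<forall>x\<in>D. \<exists>U. open U \<and> x \<in> U \<and> apply_bcontfun f constant_on U)}"

definition CT_maps :: "('a::metric_space \<Rightarrow>\<^sub>C 'a) set" where
  "CT_maps = {f. chain_transitive (apply_bcontfun f)}"

end

theory Submission
  imports Defs
begin

text \<open>
  Under the ANR or one-dimensionality assumption, a map factors approximately through finitely many real
  coordinates. Composing these with Cantor-type functions gives a map that is locally constant on a dense set.
  On an open set where a map is constant, it can be replaced by a small bump: a real function followed by a
  path that fills a neighbourhood of the constant value (a local Hahn-Mazurkiewicz theorem).

  For (1), bumps are inserted at finer and finer scales. The amplitude at each scale suffices to cover balls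
  of the previous scale, so small balls grow until chain mixing (chain transitivity on a connected space)
  takes over. Only a nowhere dense set is frozen at each stage, so the next stage still finds open sets of
  constancy everywhere.

  For (2) and (3), a path through a bump region is mapped by every nearby map to a path crossing the regions
  which the bump path traverses. Hence all itineraries through the regions are realised robustly; this gives
  shadowing, and mixing between two given open sets, for an open set of maps.
\<close>

text \<open>Two demands conflict. Exactness asks that small sets have large images, and what is
  achieved must survive all later perturbations; but a frozen set with interior would block later
  stages. The way out is that a Cantor-type function takes all its values already on a closed set
  without interior, so a nowhere dense set can be mapped onto a whole ball, and freezing it costs
  nothing. Robust statements cannot rest on coverings of balls, since on a general Peano continuum a
  map near a surjection need not be surjective. What is stable is one-dimensional: a real coordinate
  that runs from 0 to 1 along a path still runs from at most 1/4 to at least 3/4 after a small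
  perturbation, and the intermediate value theorem applies. For mixing the two collide: the crossing
  region has interior and must not be changed, so exactness cannot be planted there. In it the map
  follows a function of slopes 4 and -4 along arcs, whereby a dense set of parameters on the arcs
  leaves it. This yields chain transitivity only at a given small scale, which is why exact maps are
  found near all maps that are chain transitive at a scale depending only on the distance
  wanted.\<close>

lemma power_half_small:
  fixes e :: real
  assumes "0 < r"
  shows "\<exists>N. \<forall>n\<ge>N. e / 2 ^ n < r"
proof -
  have "(\<lambda>n. e * (1 / 2) ^ n) \<longlonglongrightarrow> e * 0"
    by (intro tendsto_mult tendsto_const LIMSEQ_realpow_zero) auto
  then have "\<forall>\<^sub>F n in sequentially. e * (1 / 2) ^ n < r"
    using assms by (simp add: order_tendstoD(2))
  then show ?thesis
    by (simp add: eventually_sequentially power_one_over)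
qed

section \<open>Nets, limits and uniform local connectedness\<close>

text \<open>The one-point space is excluded because bumps need nonconstant tent functions; the
  theorem treats it separately. The parameter of type \<open>itself\<close> only ties the locale to
  the type variable.\<close>

locale peano_space =
  fixes type_of_points :: "'a::metric_space itself"
  assumes compact_space: "compact (UNIV :: 'a set)"
    and connected_space: "connected (UNIV :: 'a set)"
    and locally_connected_space: "locally connected (UNIV :: 'a set)"
    and two_points: "\<exists>a b :: 'a. a \<noteq> b"
begin

lemma complete_space: "complete (UNIV :: 'a set)"
  by (simp add: compact_space compact_imp_complete)

lemma finite_net:
  fixes S :: "'a set"
  assumes "0 < r"
  shows "\<exists>A. finite A \<and> A \<subseteq> S \<and> S \<subseteq> (\<Union>a\<in>A. ball a r)"
proof -
  obtain K :: "'a set" where K: "finite K" "UNIV \<subseteq> (\<Union>x\<in>K. ball x (r / 2))"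
    using compact_space assms unfolding compact_eq_totally_bounded by (meson half_gt_zero)
  define c where "c x = (SOME a. a \<in> S \<inter> ball x (r / 2))" for x
  have c: "c x \<in> S \<inter> ball x (r / 2)" if "S \<inter> ball x (r / 2) \<noteq> {}" for x
    unfolding c_def using that by (metis all_not_in_conv someI)
  show ?thesis
  proof (intro exI conjI)
    show "finite (c ` {x \<in> K. S \<inter> ball x (r / 2) \<noteq> {}})"
      using K(1) by simp
    show "c ` {x \<in> K. S \<inter> ball x (r / 2) \<noteq> {}} \<subseteq> S"
      using c by auto
    show "S \<subseteq> (\<Union>a\<in>c ` {x \<in> K. S \<inter> ball x (r / 2) \<noteq> {}}. ball a r)"
    proof
      fix y
      assume "y \<in> S"
      obtain x where x: "x \<in> K" "y \<in> ball x (r / 2)"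
        using K(2) by blast
      then have "S \<inter> ball x (r / 2) \<noteq> {}"
        using \<open>y \<in> S\<close> by auto
      then have "dist x (c x) < r / 2"
        using c by auto
      then have "y \<in> ball (c x) r"
        using x(2) dist_triangle3[of "c x" y x] by (simp add: dist_commute)
      then show "y \<in> (\<Union>a\<in>c ` {x \<in> K. S \<inter> ball x (r / 2) \<noteq> {}}. ball a r)"
        using x \<open>S \<inter> ball x (r / 2) \<noteq> {}\<close> by blast
    qed
  qed
qed

lemma geometric_limit:
  fixes s :: "nat \<Rightarrow> 'a"
  assumes step: "\<And>n. dist (s n) (s (Suc n)) \<le> e / 2 ^ n"
  shows "\<exists>l. \<forall>n. dist (s n) l \<le> 2 * e / 2 ^ n"
proof -
  have "0 \<le> dist (s 0) (s 1)"
    by simp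
  then have e: "0 \<le> e"
    using step[of 0] by (metis div_by_1 order_trans power_0 One_nat_def)
  \<comment> \<open>The right-hand side is the exact value of the geometric sum from
    \<open>n\<close> to \<open>n + k - 1\<close>; a bound without the subtracted tail would not be
    inductive.\<close>
  have partial: "dist (s n) (s (n + k)) \<le> 2 * e / 2 ^ n - 2 * e / 2 ^ (n + k)" for n k
  proof (induction k)
    case (Suc k)
    have "dist (s n) (s (n + Suc k)) \<le> dist (s n) (s (n + k)) + dist (s (n + k)) (s (Suc (n + k)))"
      by (metis add_Suc_right dist_triangle)
    also have "\<dots> \<le> 2 * e / 2 ^ n - 2 * e / 2 ^ (n + k) + e / 2 ^ (n + k)"
      using Suc step[of "n + k"] by linarith
    also have "\<dots> = 2 * e / 2 ^ n - 2 * e / 2 ^ (n + Suc k)"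
      by (simp add: field_simps)
    finally show ?case .
  qed auto
  have bound: "dist (s n) (s (n + k)) \<le> 2 * e / 2 ^ n" for n k
    using partial[of n k] e by (smt (verit) divide_nonneg_nonneg zero_le_power)
  have "Cauchy s"
  proof (rule metric_CauchyI)
    fix r :: real
    assume "0 < r"
    then obtain N where N: "4 * e / 2 ^ N < r"
      using power_half_small by blast
    have "dist (s m) (s n) < r" if "N \<le> m" "N \<le> n" for m n
    proof -
      have "dist (s m) (s n) \<le> dist (s N) (s m) + dist (s N) (s n)"
        by (metis dist_commute dist_triangle)
      also have "\<dots> \<le> 2 * e / 2 ^ N + 2 * e / 2 ^ N"
        using bound[of N "m - N"] bound[of N "n - N"] that by (intro add_mono) auto
      also have "\<dots> = 4 * e / 2 ^ N"
        by (simp add: field_simps)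
      finally show ?thesis
        using N by linarith
    qed
    then show "\<exists>M. \<forall>m\<ge>M. \<forall>n\<ge>M. dist (s m) (s n) < r"
      by blast
  qed
  then obtain l where l: "s \<longlonglongrightarrow> l"
    using complete_space unfolding complete_def by blast
  have "dist (s n) l \<le> 2 * e / 2 ^ n" for n
  proof (rule Lim_dist_ubound[OF _ l])
    show "\<forall>\<^sub>F k in sequentially. dist (s n) (s k) \<le> 2 * e / 2 ^ n"
      unfolding eventually_sequentially using bound by (metis le_iff_add)
  qed simp
  then show ?thesis
    by blast
qed

text \<open>Local connectedness becomes uniform through a Lebesgue number of a cover by connected
  open sets inside balls of radius \<open>e / 2\<close>; the half lets such a set lie in the
  \<open>e\<close>-ball around any of its points.\<close>

lemma uniformly_connected_nbhds:
  assumes "e > 0"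
  shows "\<exists>d>0. d \<le> e \<and> (\<forall>u :: 'a. \<exists>C. connected C \<and> ball u d \<subseteq> C \<and> C \<subseteq> ball u e)"
proof -
  have "\<exists>C. open C \<and> connected C \<and> x \<in> C \<and> C \<subseteq> ball x (e / 2)" for x :: 'a
    using locally_connected_space[unfolded locally_connected, rule_format, of "ball x (e / 2)" x] assms
    by auto
  then obtain C where C: "\<And>x :: 'a. open (C x)" "\<And>x :: 'a. connected (C x)"
    "\<And>x. x \<in> C x" "\<And>x. C x \<subseteq> ball x (e / 2)"
    by metis
  obtain \<delta> where \<delta>: "0 < \<delta>" "\<And>u :: 'a. \<exists>B \<in> range C. ball u \<delta> \<subseteq> B"
  proof (rule Heine_Borel_lemma[OF compact_space, of "range C"])
    show "UNIV \<subseteq> \<Union> (range C)"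
      using C(3) by auto
  qed (use C(1) in auto)
  define d where "d = min e \<delta>"
  have "\<exists>D. connected D \<and> ball u d \<subseteq> D \<and> D \<subseteq> ball u e" for u :: 'a
  proof -
    obtain x where "ball u \<delta> \<subseteq> C x"
      using \<delta>(2) by blast
    then have x: "ball u d \<subseteq> C x"
      by (auto simp: d_def)
    have "u \<in> C x"
      using x assms \<delta>(1) by (auto simp: d_def)
    then have "dist x u < e / 2"
      using C(4)[of x] by auto
    have "C x \<subseteq> ball u e"
    proof
      fix y
      assume "y \<in> C x"
      then have "dist x y < e / 2"
        using C(4)[of x] by auto
      then show "y \<in> ball u e"
        using \<open>dist x u < e / 2\<close> dist_triangle3[of u y x] by (simp add: dist_commute)
    qed
    then show ?thesis
      using x C(2) by blast
  qed
  then show ?thesis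
    using assms \<delta>(1) by (intro exI[of _ d]) (auto simp: d_def)
qed

end

section \<open>Chains of points in connected sets\<close>

definition dchain :: "real \<Rightarrow> 'a::metric_space set \<Rightarrow> 'a list \<Rightarrow> bool" where
  "dchain d C xs \<longleftrightarrow> xs \<noteq> [] \<and> set xs \<subseteq> C \<and> successively (\<lambda>x y. dist x y < d) xs"

text \<open>Being joined by a chain is an equivalence relation on \<open>C\<close> with relatively
  open classes. Concatenation repeats the middle point, a step of length zero, which
  \<open>0 < d\<close> allows.\<close>

lemma connected_dchain:
  assumes "connected C" "a \<in> C" "b \<in> C" "0 < d"
  shows "\<exists>xs. dchain d C xs \<and> hd xs = a \<and> last xs = b"
proof (rule connected_equivalence_relation[OF assms(1-3), of "\<lambda>a b. \<exists>xs. dchain d C xs \<and> hd xs = a \<and> last xs = b"])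
  show "\<exists>xs. dchain d C xs \<and> hd xs = y \<and> last xs = x"
    if "\<exists>xs. dchain d C xs \<and> hd xs = x \<and> last xs = y" for x y
  proof -
    obtain xs where xs: "dchain d C xs" "hd xs = x" "last xs = y"
      using \<open>\<exists>xs. dchain d C xs \<and> hd xs = x \<and> last xs = y\<close> by blast
    then show ?thesis
      by (intro exI[of _ "rev xs"]) (auto simp: dchain_def hd_rev last_rev dist_commute)
  qed
  show "\<exists>xs. dchain d C xs \<and> hd xs = x \<and> last xs = z"
    if "\<exists>xs. dchain d C xs \<and> hd xs = x \<and> last xs = y"
      "\<exists>xs. dchain d C xs \<and> hd xs = y \<and> last xs = z" for x y z
  proof -
    from that obtain xs ys where "dchain d C xs \<and> hd xs = x \<and> last xs = y"
      "dchain d C ys \<and> hd ys = y \<and> last ys = z"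
      by blast
    then show ?thesis
      using \<open>0 < d\<close> by (intro exI[of _ "xs @ ys"]) (auto simp: dchain_def successively_append_iff)
  qed
  show "\<exists>T. openin (top_of_set C) T \<and> x \<in> T \<and>
      (\<forall>y\<in>T. \<exists>xs. dchain d C xs \<and> hd xs = x \<and> last xs = y)" if "x \<in> C" for x
  proof (rule exI[of _ "C \<inter> ball x d"], intro conjI ballI)
    show "openin (top_of_set C) (C \<inter> ball x d)"
      by auto
    show "x \<in> C \<inter> ball x d"
      using that \<open>0 < d\<close> by auto
    show "\<exists>xs. dchain d C xs \<and> hd xs = x \<and> last xs = y" if "y \<in> C \<inter> ball x d" for y
      using \<open>x \<in> C\<close> that by (intro exI[of _ "[x, y]"]) (auto simp: dchain_def)
  qed
qed

lemma connected_dchain_through: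
  assumes "connected C" "a \<in> C" "b \<in> C" "0 < d" "finite A" "A \<subseteq> C"
  shows "\<exists>xs. dchain d C xs \<and> hd xs = a \<and> last xs = b \<and> A \<subseteq> set xs"
  using assms(5,6,2)
proof (induction A arbitrary: a rule: finite_induct)
  case empty
  then show ?case
    using connected_dchain assms by fastforce
next
  case (insert z A)
  obtain xs where xs: "dchain d C xs" "hd xs = a" "last xs = z"
    using connected_dchain[OF assms(1) \<open>a \<in> C\<close>, of z d] insert.prems assms(4) by auto
  obtain ys where ys: "dchain d C ys" "hd ys = z" "last ys = b" "A \<subseteq> set ys"
    using insert by (metis insert_subset)
  have "z \<in> set xs"
    using xs by (metis dchain_def last_in_set)
  then show ?case
    using xs ys \<open>0 < d\<close>
    by (intro exI[of _ "xs @ ys"]) (auto simp: dchain_def successively_append_iff)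
qed

text \<open>Repeating the last entry forever lets chains of different lengths be cut at one common
  length, as \<open>refine_chain\<close> does.\<close>

lemma dchain_function:
  assumes "dchain d C xs" "0 < d"
  shows "\<exists>c L. c 0 = hd xs \<and> (\<forall>j\<ge>L. c j = last xs) \<and> range c \<subseteq> C \<and>
    (\<forall>j. dist (c j) (c (Suc j)) < d) \<and> (\<forall>x\<in>set xs. \<exists>j\<le>L. c j = x)"
proof -
  let ?L = "length xs - 1"
  let ?c = "\<lambda>j. xs ! min j ?L"
  have xs: "xs \<noteq> []" "set xs \<subseteq> C" "successively (\<lambda>x y. dist x y < d) xs"
    using assms(1) by (auto simp: dchain_def)
  have c0: "?c 0 = hd xs"
    using xs(1) by (simp add: hd_conv_nth)
  have cL: "?c j = last xs" if "?L \<le> j" for j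
    using xs(1) that by (simp add: last_conv_nth min_absorb2)
  have cC: "range ?c \<subseteq> C"
  proof -
    have "min j ?L < length xs" for j
      using xs(1) by (simp add: min.strict_coboundedI2)
    then show ?thesis
      using xs(2) nth_mem by blast
  qed
  have cd: "dist (?c j) (?c (Suc j)) < d" for j
  proof (cases "Suc j < length xs")
    case True
    then show ?thesis
      using xs(3) by (simp add: successively_conv_nth min_absorb1)
  next
    case False
    then show ?thesis
      using \<open>0 < d\<close> by (simp add: min_absorb2)
  qed
  have cx: "\<exists>j\<le>?L. ?c j = x" if "x \<in> set xs" for x
  proof -
    from that obtain i where "i < length xs" "xs ! i = x"
      by (meson in_set_conv_nth)
    then show ?thesis
      by (intro exI[of _ i]) (auto simp: min_absorb1)
  qed
  show ?thesis
    by (rule exI[of _ ?c], rule exI[of _ ?L]) (use c0 cL cC cd cx in blast)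
qed

context peano_space
begin

text \<open>All blocks get the same length \<open>k\<close>, so that index \<open>i * k + j\<close>
  of the new chain refines index \<open>i\<close> of the old one. Chains of consecutive stages, read
  as step functions on the unit interval, are then uniformly close.\<close>

lemma refine_chain:
  fixes x :: "nat \<Rightarrow> 'a"
  assumes nbhds: "\<And>u :: 'a. \<exists>C. connected C \<and> ball u d \<subseteq> C \<and> C \<subseteq> ball u e"
    and "0 < d" "0 < d'"
    and steps: "\<And>i. dist (x i) (x (Suc i)) < d"
    and const: "\<forall>i\<ge>m. x i = x m"
  shows "\<exists>y k. 0 < k \<and> (\<forall>i j. j < k \<longrightarrow> dist (x i) (y (i * k + j)) < e) \<and> y 0 = x 0 \<and>
    (\<forall>i. dist (y i) (y (Suc i)) < d') \<and> (\<forall>i\<ge>m * k. y i = y (m * k)) \<and>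
    (\<forall>i<m. \<forall>z\<in>ball (x i) d. \<exists>j<k. dist z (y (i * k + j)) < d')"
proof -
  have chains: "\<exists>c L. c 0 = x i \<and> (\<forall>j\<ge>L. c j = x (Suc i)) \<and> range c \<subseteq> ball (x i) e \<and>
      (\<forall>j. dist (c j) (c (Suc j)) < d') \<and>
      (\<forall>z\<in>ball (x i) d. \<exists>j\<le>L. dist z (c j) < d')" for i
  proof -
    obtain C where C: "connected C" "ball (x i) d \<subseteq> C" "C \<subseteq> ball (x i) e"
      using nbhds by blast
    obtain A where A: "finite A" "A \<subseteq> ball (x i) d" "ball (x i) d \<subseteq> (\<Union>a\<in>A. ball a d')"
      using finite_net[OF \<open>0 < d'\<close>, of "ball (x i) d"] by (elim exE conjE)
    obtain xs where xs: "dchain d' C xs" "hd xs = x i" "last xs = x (Suc i)" "A \<subseteq> set xs"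
    proof -
      have "x i \<in> C" "x (Suc i) \<in> C" "A \<subseteq> C"
        using C A \<open>0 < d\<close> steps[of i] by auto
      then show ?thesis
        using connected_dchain_through[OF C(1) _ _ \<open>0 < d'\<close> A(1), of "x i" "x (Suc i)"] that by blast
    qed
    obtain c L where c: "c 0 = x i" "\<forall>j\<ge>L. c j = x (Suc i)" "range c \<subseteq> C"
      "\<forall>j. dist (c j) (c (Suc j)) < d'" "\<forall>x\<in>set xs. \<exists>j\<le>L. c j = x"
      using dchain_function[OF xs(1) \<open>0 < d'\<close>] xs(2,3) by metis
    have "\<exists>j\<le>L. dist z (c j) < d'" if "z \<in> ball (x i) d" for z
    proof -
      from that obtain a where "a \<in> A" "dist a z < d'"
        using A(3) by auto
      then show ?thesis
        using c(5) xs(4) by (metis dist_commute subsetD)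
    qed
    then show ?thesis
      using c C(3) by (intro exI[of _ c] exI[of _ L]) auto
  qed
  obtain c L where c: "\<And>i. c i 0 = x i" "\<And>i j. L i \<le> j \<Longrightarrow> c i j = x (Suc i)"
    "\<And>i j. c i j \<in> ball (x i) e" "\<And>i j. dist (c i j) (c i (Suc j)) < d'"
    "\<And>i z. z \<in> ball (x i) d \<Longrightarrow> \<exists>j\<le>L i. dist z (c i j) < d'"
  proof -
    define Q where "Q i c L \<longleftrightarrow> c 0 = x i \<and> (\<forall>j\<ge>L. c j = x (Suc i)) \<and> range c \<subseteq> ball (x i) e \<and>
      (\<forall>j. dist (c j) (c (Suc j)) < d') \<and>
      (\<forall>z\<in>ball (x i) d. \<exists>j\<le>L. dist z (c j) < d')" for i c and L :: nat
    have "\<forall>i. \<exists>c L. Q i c L"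
      using chains unfolding Q_def by blast
    then obtain c L where "\<And>i. Q i (c i) (L i)"
      by metis
    then show ?thesis
      unfolding Q_def by (intro that[of c L]) blast+
  qed
  \<comment> \<open>A block must contain all indices up to \<open>L i\<close>, hence the successor.
    The set \<open>{..m}\<close> rather than \<open>{..<m}\<close> keeps the maximum defined for
    \<open>m = 0\<close>.\<close>
  define k where "k = Suc (Max (L ` {..m}))"
  have L: "L i < k" if "i < m" for i
    unfolding k_def using that by (simp add: less_Suc_eq_le)
  have "0 < k"
    by (simp add: k_def)
  have e: "0 < e"
    using c(3)[of 0 0] by (metis ball_eq_empty empty_iff linorder_not_le)
  define y where "y l = (if l div k < m then c (l div k) (l mod k) else x m)" for l
  have y: "y (i * k + j) = (if i < m then c i j else x m)" if "j < k" for i j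
    using that by (simp add: y_def)
  show ?thesis
  proof (rule exI[of _ y], rule exI[of _ k], intro conjI allI impI ballI)
    show "0 < k"
      by fact
    show "dist (x i) (y (i * k + j)) < e" if "j < k" for i j
    proof (cases "i < m")
      case True
      then show ?thesis
        using c(3)[of i j] y[OF that] by simp
    next
      case False
      then show ?thesis
        using const[rule_format, of i] y[OF that] e by simp
    qed
    show "y 0 = x 0"
      using y[of 0 0] \<open>0 < k\<close> c(1)[of 0] by simp
    show "dist (y l) (y (Suc l)) < d'" for l
    proof -
      define i j where "i = l div k" and "j = l mod k"
      have l: "l = i * k + j" "j < k"
        using \<open>0 < k\<close> by (auto simp: i_def j_def)
      show ?thesis
      proof (cases "i < m")
        case False
        then have "\<not> l div k < m" "\<not> Suc l div k < m"
          unfolding i_def by (meson div_le_mono le_SucI le_trans linorder_not_le order_refl)+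
        then show ?thesis
          using \<open>0 < d'\<close> by (simp add: y_def)
      next
        case True
        show ?thesis
        proof (cases "Suc j < k")
          case True
          then have "y (Suc l) = c i (Suc j)"
            using y[of "Suc j" i] \<open>i < m\<close> l by simp
          then show ?thesis
            using y[of j i] l \<open>i < m\<close> c(4) by simp
        next
          case False
          then have "Suc l = Suc i * k + 0" and "Suc j = k"
            using l by auto
          then have "y (Suc l) = x (Suc i)"
            using y[of 0 "Suc i"] \<open>0 < k\<close> c(1)[of "Suc i"] const[rule_format, of "Suc i"] by (simp add: not_less split: if_splits)
          also have "\<dots> = c i (Suc j)"
            using c(2) L[OF \<open>i < m\<close>] \<open>Suc j = k\<close> by simp
          finally show ?thesis
            using y[of j i] l \<open>i < m\<close> c(4) by simp
        qed
      qed
    qed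
    show "y i = y (m * k)" if "m * k \<le> i" for i
    proof -
      have "\<not> i div k < m"
        using that \<open>0 < k\<close> by (simp add: div_less_iff_less_mult)
      then show ?thesis
        using \<open>0 < k\<close> by (simp add: y_def)
    qed
    show "\<exists>j<k. dist z (y (i * k + j)) < d'" if "i < m" "z \<in> ball (x i) d" for i z
      using c(5)[OF that(2)] L[OF that(1)] y that(1) by (metis le_less_trans)
  qed
qed

text \<open>A local Hahn-Mazurkiewicz theorem: the path is the limit of step functions whose values are
  successively refined chains, each refinement visiting everything near the previous chain.\<close>

lemma local_covering_path:
  assumes "e > 0"
  shows "\<exists>R>0. \<forall>p :: 'a. \<exists>\<gamma>. path \<gamma> \<and> \<gamma> 0 = p \<and> ball p R \<subseteq> path_image \<gamma> \<and> path_image \<gamma> \<subseteq> ball p e"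
proof -
  \<comment> \<open>These errors add up to \<open>e / 2\<close>, which keeps the limit path in the
    ball of radius \<open>e\<close>.\<close>
  define E where "E n = e / 4 / 2 ^ n" for n :: nat
  have E: "0 < E n" for n
    using assms by (simp add: E_def)
  have "\<exists>D. \<forall>n. 0 < D n \<and> D n \<le> E n \<and>
      (\<forall>u :: 'a. \<exists>C. connected C \<and> ball u (D n) \<subseteq> C \<and> C \<subseteq> ball u (E n))"
    using uniformly_connected_nbhds[OF E] by (intro choice) blast
  then obtain D where D: "\<And>n. 0 < D n" "\<And>n. D n \<le> E n"
    "\<And>n (u :: 'a). \<exists>C. connected C \<and> ball u (D n) \<subseteq> C \<and> C \<subseteq> ball u (E n)"
    by blast
  have "\<exists>\<gamma>. path \<gamma> \<and> \<gamma> 0 = p \<and> ball p (D 0) \<subseteq> path_image \<gamma> \<and> path_image \<gamma> \<subseteq> ball p e" for p :: 'a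
  proof -
    \<comment> \<open>The last clause is the covering property: it holds for the constant chain at
      stage 0, is kept by every refinement, and turns into surjectivity onto the ball in the
      limit.\<close>
    define P where "P n z \<longleftrightarrow> (case z of (x, m) \<Rightarrow> 0 < m \<and> (\<forall>i. dist (x i) (x (Suc i)) < D n) \<and>
      (\<forall>i\<ge>m. x i = x m) \<and> x 0 = p \<and> (n = 0 \<longrightarrow> (\<forall>i. x i = p)) \<and> (\<forall>y\<in>ball p (D 0). \<exists>i<m. dist (x i) y < D n))"
      for n and z :: "(nat \<Rightarrow> 'a) \<times> nat"
    define Q where "Q n z z' \<longleftrightarrow> (\<exists>k>0. snd z' = snd z * k \<and>
      (\<forall>i j. j < k \<longrightarrow> dist (fst z i) (fst z' (i * k + j)) < E n))"
      for n and z z' :: "(nat \<Rightarrow> 'a) \<times> nat"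
    have "\<exists>f. \<forall>n. P n (f n) \<and> Q n (f n) (f (Suc n))"
    proof (rule dependent_nat_choice)
      show "\<exists>z. P 0 z"
        by (intro exI[of _ "(\<lambda>_. p, 1)"]) (use D(1) in \<open>auto simp: P_def\<close>)
    next
      fix z n
      assume "P n z"
      obtain x m where z: "z = (x, m)"
        by force
      have x: "0 < m" "\<And>i. dist (x i) (x (Suc i)) < D n" "\<forall>i\<ge>m. x i = x m" "x 0 = p"
        "\<And>y. y \<in> ball p (D 0) \<Longrightarrow> \<exists>i<m. dist (x i) y < D n"
        using \<open>P n z\<close> unfolding P_def z split by (blast, blast, blast, blast, blast)
      obtain y k where y0: "0 < k" "\<forall>i j. j < k \<longrightarrow> dist (x i) (y (i * k + j)) < E n" "y 0 = x 0"
        "\<forall>i. dist (y i) (y (Suc i)) < D (Suc n)" "\<forall>i\<ge>m * k. y i = y (m * k)"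
        "\<forall>i<m. \<forall>z\<in>ball (x i) (D n). \<exists>j<k. dist z (y (i * k + j)) < D (Suc n)"
        using refine_chain[OF D(3)[where n = n] D(1)[of n] D(1)[of "Suc n"] x(2) x(3)]
        by (elim exE conjE) (rule that)
      note y = y0(1) y0(2)[rule_format] y0(3) y0(4)[rule_format] y0(5)[rule_format] y0(6)[rule_format]
      have "P (Suc n) (y, m * k)"
        unfolding P_def split
      proof (intro conjI ballI)
        show "\<exists>i<m * k. dist (y i) v < D (Suc n)" if "v \<in> ball p (D 0)" for v
        proof -
          from x(5)[OF that] obtain i where i: "i < m" "dist (x i) v < D n"
            by blast
          then obtain j where j: "j < k" "dist v (y (i * k + j)) < D (Suc n)"
            using y(6)[of i v] by auto
          have "i * k + j < Suc i * k"
            using j(1) by simp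
          also have "\<dots> \<le> m * k"
            using i(1) by (intro mult_right_mono) auto
          finally show ?thesis
            using j(2) by (metis dist_commute)
        qed
        show "0 < m * k"
          using x(1) y(1) by simp
        show "\<forall>i. dist (y i) (y (Suc i)) < D (Suc n)" "\<forall>i\<ge>m * k. y i = y (m * k)"
          by fact+
        show "y 0 = p" "Suc n = 0 \<longrightarrow> (\<forall>i. y i = p)"
          using x(4) y(3) by simp_all
      qed
      moreover have "Q n z (y, m * k)"
        using y(1,2) by (auto simp: Q_def z)
      ultimately show "\<exists>z'. P (Suc n) z' \<and> Q n z z'"
        by blast
    qed
    then obtain f where f: "\<And>n. P n (f n)" "\<And>n. Q n (f n) (f (Suc n))"
      by blast
    define x m where "x n = fst (f n)" and "m n = snd (f n)" for n
    have x: "0 < m n" "dist (x n i) (x n (Suc i)) < D n" "x n 0 = p" "n = 0 \<Longrightarrow> x n i = p"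
      "y \<in> ball p (D 0) \<Longrightarrow> \<exists>i<m n. dist (x n i) y < D n" for n i y
      using f(1)[of n] unfolding P_def x_def m_def case_prod_beta by (blast, blast, blast, blast, blast)
    \<comment> \<open>The chain of stage \<open>n\<close> as a step function with \<open>m n\<close>
      steps. Rounding down is compatible with refinement because \<open>m (Suc n)\<close> is a
      multiple of \<open>m n\<close>.\<close>
    define s where "s t n = x n (nat \<lfloor>t * m n\<rfloor>)" for t :: real and n
    have close: "dist (s t n) (s t (Suc n)) \<le> (e / 4) / 2 ^ n" if "0 \<le> t" for t n
    proof -
      obtain k where k: "0 < k" "m (Suc n) = m n * k"
        "\<And>i j. j < k \<Longrightarrow> dist (x n i) (x (Suc n) (i * k + j)) < E n"
        using f(2)[of n] unfolding Q_def x_def m_def by blast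
      define i where "i = nat \<lfloor>t * m n\<rfloor>"
      define l where "l = nat \<lfloor>t * m (Suc n)\<rfloor>"
      have i: "real i \<le> t * m n" "t * m n < real i + 1"
        using that unfolding i_def by (auto simp: of_nat_nat le_floor_iff)
      have l: "real l \<le> t * m (Suc n)" "t * m (Suc n) < real l + 1"
        using that unfolding l_def by (auto simp: of_nat_nat le_floor_iff)
      have "real (i * k) \<le> t * m (Suc n)"
        using mult_right_mono[OF i(1), of "real k"] by (simp add: k(2) mult.assoc)
      then have "real (i * k) < real l + 1"
        using l(2) by linarith
      then have "i * k < l + 1"
        by linarith
      have "t * m (Suc n) < (real i + 1) * k"
        using mult_strict_right_mono[OF i(2), of "real k"] k(1) by (simp add: k(2) mult.assoc)
      then have "real l < (real i + 1) * k"
        using l(1) by linarith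
      then have "real l < real ((i + 1) * k)"
        by (simp add: algebra_simps)
      then have "l < (i + 1) * k"
        by (simp only: of_nat_less_iff)
      then have "dist (x n i) (x (Suc n) (i * k + (l - i * k))) < E n"
        using \<open>i * k < l + 1\<close> by (intro k(3)) auto
      then show ?thesis
        using \<open>i * k < l + 1\<close> by (simp add: s_def i_def l_def E_def)
    qed
    have "\<exists>l. \<forall>n. dist (s t n) l \<le> 2 * (e / 4) / 2 ^ n" if "0 \<le> t" for t
      by (rule geometric_limit) (rule close[OF that])
    then obtain g where g: "\<And>t n. 0 \<le> t \<Longrightarrow> dist (s t n) (g t) \<le> 2 * (e / 4) / 2 ^ n"
      by metis
    \<comment> \<open>With \<open>(e / 4) / 2 ^ n\<close> as the unit, 5 = 2 + 1 + 2: from a limit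
      point to its step, between neighbouring steps, and back to the other limit point.\<close>
    have small: "\<exists>n. 5 * (e / 4) / 2 ^ n < r" if "0 < r" for r :: real
      using power_half_small[OF that, of "5 * (e / 4)"] by blast
    have "path g"
      unfolding path_def continuous_on_iff
    proof (intro ballI allI impI)
      fix t r :: real
      assume t: "t \<in> {0..1}" and "0 < r"
      obtain n where n: "5 * (e / 4) / 2 ^ n < r"
        using small \<open>0 < r\<close> by blast
      have "dist (g u) (g t) < r" if u: "u \<in> {0..1}" "dist u t < 1 / m n" for u
      proof -
        have "\<bar>u * m n - t * m n\<bar> < 1"
        proof -
          have "\<bar>u * m n - t * m n\<bar> = \<bar>u - t\<bar> * m n"
            by (simp add: abs_mult left_diff_distrib[symmetric])
          also have "\<dots> < (1 / m n) * m n"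
            using u(2) x(1)[of n] by (intro mult_strict_right_mono) (auto simp: dist_real_def)
          finally show ?thesis
            using x(1)[of n] by simp
        qed
        then have *: "\<lfloor>u * m n\<rfloor> = \<lfloor>t * m n\<rfloor> \<or> \<lfloor>u * m n\<rfloor> = \<lfloor>t * m n\<rfloor> + 1 \<or> \<lfloor>t * m n\<rfloor> = \<lfloor>u * m n\<rfloor> + 1"
          by linarith
        have "0 \<le> \<lfloor>u * m n\<rfloor>" "0 \<le> \<lfloor>t * m n\<rfloor>"
          using u(1) t by auto
        then have "nat \<lfloor>u * m n\<rfloor> = nat \<lfloor>t * m n\<rfloor> \<or> nat \<lfloor>u * m n\<rfloor> = Suc (nat \<lfloor>t * m n\<rfloor>) \<or>
            nat \<lfloor>t * m n\<rfloor> = Suc (nat \<lfloor>u * m n\<rfloor>)"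
          using * by linarith
        then have "dist (s u n) (s t n) < D n"
          unfolding s_def using x(2)[of n] D(1)[of n] by (metis dist_commute dist_self)
        then have "dist (s u n) (s t n) < (e / 4) / 2 ^ n"
          using D(2)[of n] by (simp add: E_def)
        moreover have "dist (s u n) (g u) \<le> 2 * (e / 4) / 2 ^ n" "dist (s t n) (g t) \<le> 2 * (e / 4) / 2 ^ n"
          using g u(1) t by auto
        moreover have "dist (g u) (g t) \<le> dist (s u n) (g u) + dist (s u n) (s t n) + dist (s t n) (g t)"
          using dist_triangle3[of "g u" "g t" "s u n"] dist_triangle[of "s u n" "g t" "s t n"] by linarith
        moreover have "2 * (e / 4) / 2 ^ n + (e / 4) / 2 ^ n + 2 * (e / 4) / 2 ^ n = 5 * (e / 4) / 2 ^ n"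
          by (simp add: field_simps)
        ultimately show ?thesis
          using n by linarith
      qed
      then show "\<exists>d>0. \<forall>u\<in>{0..1}. dist u t < d \<longrightarrow> dist (g u) (g t) < r"
        using x(1)[of n] by (intro exI[of _ "1 / m n"]) auto
    qed
    moreover have "g 0 = p"
    proof (rule ccontr)
      assume "g 0 \<noteq> p"
      then obtain n where n: "5 * (e / 4) / 2 ^ n < dist p (g 0)"
        using small[of "dist p (g 0)"] by auto
      have "dist p (g 0) \<le> 2 * (e / 4) / 2 ^ n"
        using g[of 0 n] x(3)[of n] by (simp add: s_def)
      also have "\<dots> \<le> 5 * (e / 4) / 2 ^ n"
        using assms by (intro divide_right_mono) auto
      finally show False
        using n by linarith
    qed
    moreover have "ball p (D 0) \<subseteq> path_image g"
    proof
      fix y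
      assume y: "y \<in> ball p (D 0)"
      have "compact (path_image g)"
        using \<open>path g\<close> by (rule compact_path_image)
      then have "closed (path_image g)"
        by (rule compact_imp_closed)
      moreover have "\<exists>z\<in>path_image g. dist z y < r" if r: "0 < r" for r
      proof -
        obtain n where n: "5 * (e / 4) / 2 ^ n < r"
          using small r by blast
        obtain i where i: "i < m n" "dist (x n i) y < D n"
          using x(5)[OF y] by blast
        define t where "t = real i / real (m n)"
        have t: "t \<in> {0..1}"
          using i(1) by (simp add: t_def)
        have "s t n = x n i"
          using x(1)[of n] by (simp add: s_def t_def)
        then have "dist (g t) y \<le> dist (s t n) (g t) + dist (x n i) y"
          by (metis dist_commute dist_triangle2)
        moreover have "dist (s t n) (g t) \<le> 2 * (e / 4) / 2 ^ n"
          using g t by simp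
        moreover have "dist (x n i) y \<le> (e / 4) / 2 ^ n"
          using i(2) D(2)[of n] by (simp add: E_def)
        moreover have "2 * (e / 4) / 2 ^ n + (e / 4) / 2 ^ n \<le> 5 * (e / 4) / 2 ^ n"
          unfolding add_divide_distrib[symmetric] using assms by (intro divide_right_mono) auto
        ultimately have "dist (g t) y < r"
          using n by linarith
        then show ?thesis
          using t unfolding path_image_def by blast
      qed
      ultimately show "y \<in> path_image g"
        by (metis closure_approachable closure_closed)
    qed
    moreover have "path_image g \<subseteq> ball p e"
    proof
      fix y
      assume "y \<in> path_image g"
      then obtain t where t: "t \<in> {0..1}" "y = g t"
        by (auto simp: path_image_def)
      have "dist p y \<le> 2 * (e / 4) / 2 ^ 0"
        using g[of t 0] t x(4) by (simp add: s_def)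
      then show "y \<in> ball p e"
        using assms by simp
    qed
    ultimately show ?thesis
      by blast
  qed
  then show ?thesis
    using D(1) by blast
qed

section \<open>Path connectedness and arcs\<close>

text \<open>A covering path from \<open>p\<close> meets every \<open>q\<close> in the ball, at some
  time \<open>s\<close>. Running it to the end and then back to time \<open>s\<close> prescribes the
  end point without changing the image.\<close>

lemma local_covering_path_to:
  assumes "e > 0"
  shows "\<exists>R>0. R \<le> e \<and> (\<forall>p q :: 'a. dist p q < R \<longrightarrow> (\<exists>\<gamma>. path \<gamma> \<and> pathstart \<gamma> = p \<and> pathfinish \<gamma> = q \<and>
    ball p R \<subseteq> path_image \<gamma> \<and> path_image \<gamma> \<subseteq> ball p e))"
proof -
  obtain R where R: "0 < R" "\<And>p :: 'a. \<exists>\<gamma>. path \<gamma> \<and> \<gamma> 0 = p \<and> ball p R \<subseteq> path_image \<gamma> \<and> path_image \<gamma> \<subseteq> ball p e"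
    using local_covering_path[OF assms] by blast
  have "\<exists>\<gamma>. path \<gamma> \<and> pathstart \<gamma> = p \<and> pathfinish \<gamma> = q \<and>
    ball p (min R e) \<subseteq> path_image \<gamma> \<and> path_image \<gamma> \<subseteq> ball p e" if "dist p q < min R e" for p q :: 'a
  proof -
    obtain g where g: "path g" "g 0 = p" "ball p R \<subseteq> path_image g" "path_image g \<subseteq> ball p e"
      using R(2) by blast
    have "q \<in> path_image g"
      using g(3) that by auto
    then obtain s where s: "s \<in> {0..1}" "q = g s"
      by (auto simp: path_image_def)
    define h where "h t = g (1 - t * (1 - s))" for t
    have range: "1 - t * (1 - s) \<in> {0..1}" if "t \<in> {0..1}" for t
    proof -
      have "0 \<le> t * (1 - s)" "t * (1 - s) \<le> 1 * 1"
        using s(1) that mult_mono[of t 1 "1 - s" 1] by auto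
      then show ?thesis
        by simp
    qed
    have h: "path h" "pathstart h = pathfinish g" "pathfinish h = q"
    proof -
      show "path h"
        unfolding path_def h_def
        by (rule continuous_on_compose2[OF g(1)[unfolded path_def]])
          (use range in \<open>auto intro!: continuous_intros\<close>)
      show "pathstart h = pathfinish g" "pathfinish h = q"
        using s(2) by (auto simp: h_def pathstart_def pathfinish_def)
    qed
    have "path_image h \<subseteq> path_image g"
      using range by (auto simp: path_image_def h_def)
    then have "path_image (g +++ h) = path_image g"
      using h(2) by (auto simp: path_image_join)
    then show ?thesis
      using g h by (intro exI[of _ "g +++ h"]) (auto simp: pathstart_def[of g] dest: subsetD[OF g(3)])
  qed
  then show ?thesis
    using R(1) assms by (intro exI[of _ "min R e"]) auto
qed

text \<open>Short covering paths make the path components of \<open>W\<close> open.\<close>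

lemma open_connected_path_component:
  fixes W :: "'a set"
  assumes "open W" "connected W" "a \<in> W" "b \<in> W"
  shows "path_component W a b"
proof (rule connected_equivalence_relation[OF assms(2-4), of "path_component W"])
  show "\<exists>T. openin (top_of_set W) T \<and> x \<in> T \<and> (\<forall>y\<in>T. path_component W x y)" if "x \<in> W" for x
  proof -
    obtain e where e: "0 < e" "ball x e \<subseteq> W"
      using assms(1) \<open>x \<in> W\<close> openE by blast
    obtain R where R: "0 < R" "R \<le> e" "\<forall>p q :: 'a. dist p q < R \<longrightarrow> (\<exists>\<gamma>. path \<gamma> \<and> pathstart \<gamma> = p \<and>
        pathfinish \<gamma> = q \<and> ball p R \<subseteq> path_image \<gamma> \<and> path_image \<gamma> \<subseteq> ball p e)"
      using local_covering_path_to[OF e(1)] by blast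
    have "path_component W x y" if "y \<in> ball x R" for y
    proof -
      have "dist x y < R"
        using that by simp
      then obtain \<gamma> where "path \<gamma>" "pathstart \<gamma> = x" "pathfinish \<gamma> = y" "path_image \<gamma> \<subseteq> ball x e"
        using R(3) by blast
      then show ?thesis
        unfolding path_component_def using e(2) by blast
    qed
    moreover have "openin (top_of_set W) (ball x R)"
      using e(2) R(2) by (intro open_subset) auto
    ultimately show ?thesis
      using R(1) by (intro exI[of _ "ball x R"]) auto
  qed
qed (auto intro: path_component_sym path_component_trans)

lemma path_through:
  fixes W :: "'a set"
  assumes "open W" "connected W" "finite A" "A \<subseteq> W" "p \<in> W"
  shows "\<exists>\<gamma>. path \<gamma> \<and> pathstart \<gamma> = p \<and> A \<subseteq> path_image \<gamma> \<and> path_image \<gamma> \<subseteq> W"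
  using assms(3-5)
proof (induction A arbitrary: p rule: finite_induct)
  case empty
  then have "path_component W p p"
    by (simp add: path_component_refl)
  then show ?case
    unfolding path_component_def by blast
next
  case (insert z A)
  obtain g where g: "path g" "path_image g \<subseteq> W" "pathstart g = p" "pathfinish g = z"
    using open_connected_path_component[OF assms(1,2), of p z] insert.prems
    unfolding path_component_def by auto
  obtain h where h: "path h" "pathstart h = z" "A \<subseteq> path_image h" "path_image h \<subseteq> W"
    using insert.IH[of z] insert.prems by auto
  have "path_image (g +++ h) = path_image g \<union> path_image h"
    using g h by (simp add: path_image_join)
  then show ?case
    using g h pathstart_in_path_image[of h] by (intro exI[of _ "g +++ h"]) auto
qed

lemma islimpt_space: "(x :: 'a) islimpt UNIV"
proof (rule connected_imp_perfect[OF connected_space UNIV_I])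
  show "UNIV \<noteq> {y}" for y :: 'a
    using two_points by (metis UNIV_I singletonD)
qed

lemma open_infinite:
  assumes "open (W :: 'a set)" "W \<noteq> {}"
  shows "infinite W"
proof -
  obtain x where "x \<in> W"
    using assms(2) by blast
  then show ?thesis
    using islimpt_space[of x] assms(1) by (metis Int_UNIV_right islimpt_eq_acc_point)
qed

text \<open>Arcs exist in normed spaces, and \<open>x \<mapsto> dist x\<close> embeds the space into a space of functions.\<close>

lemma path_contains_arc_in_space:
  fixes p :: "real \<Rightarrow> 'a"
  assumes "path p" "pathstart p \<noteq> pathfinish p"
  shows "\<exists>q. arc q \<and> path_image q \<subseteq> path_image p"
proof -
  define K where "K x = Bcontfun (\<lambda>z. dist x z)" for x :: 'a
  have app: "apply_bcontfun (K x) z = dist x z" for x z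
  proof -
    have "(\<lambda>z. dist x z) \<in> bcontfun"
    proof -
      have "continuous_on UNIV (\<lambda>z. dist x z)"
        by (intro continuous_intros)
      then show ?thesis
        using compact_space by (simp add: bcontfun_def compact_continuous_image compact_imp_bounded)
    qed
    then show ?thesis
      by (simp add: K_def Bcontfun_inverse)
  qed
  have inj: "inj K"
    by (rule injI) (metis app dist_eq_0_iff)
  have cont: "continuous_on UNIV K"
  proof -
    have "dist (K x) (K y) \<le> dist x y" for x y
    proof (rule dist_bound)
      show "dist (apply_bcontfun (K x) z) (apply_bcontfun (K y) z) \<le> dist x y" for z
        unfolding app dist_real_def using dist_triangle[of x z y] dist_triangle[of y z x]
        by (simp add: dist_commute abs_le_iff)
    qed
    then show ?thesis
      unfolding continuous_on_iff by (metis order_le_less_trans)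
  qed
  have contp: "path (K \<circ> p)"
    using assms(1) cont unfolding path_def
    by (intro continuous_on_compose) (auto intro: continuous_on_subset)
  have "K (pathstart p) \<noteq> K (pathfinish p)"
    using assms(2) inj by (simp add: inj_eq)
  then obtain q where q: "arc q" "path_image q \<subseteq> path_image (K \<circ> p)"
    using path_contains_arc[OF contp refl refl] by (metis pathfinish_compose pathstart_compose)
  have inv: "continuous_on (range K) (inv K)"
    using continuous_on_inv[OF cont compact_space] inj by simp
  have "path_image q \<subseteq> range K"
    using q(2) by (auto simp: path_image_def)
  then have "arc (inv K \<circ> q)"
  proof -
    assume *: "path_image q \<subseteq> range K"
    have "path (inv K \<circ> q)"
      using q(1) inv * unfolding arc_def path_def path_image_def
      by (intro continuous_on_compose) (auto intro: continuous_on_subset)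
    moreover have "inj_on (inv K \<circ> q) {0..1}"
    proof (rule comp_inj_on)
      show "inj_on q {0..1}"
        using q(1) by (simp add: arc_def)
      show "inj_on (inv K) (q ` {0..1})"
        using * by (metis inj_on_inv_into path_image_def)
    qed
    ultimately show ?thesis
      by (simp add: arc_def)
  qed
  moreover have "path_image (inv K \<circ> q) \<subseteq> path_image p"
  proof -
    have "inv K ` path_image (K \<circ> p) = path_image p"
      using inj by (auto simp: path_image_def image_comp)
    then show ?thesis
      using q(2) by (metis image_mono path_image_compose)
  qed
  ultimately show ?thesis
    by blast
qed

lemma small_arc:
  assumes "open (W :: 'a set)" "W \<noteq> {}"
  shows "\<exists>q. arc q \<and> path_image q \<subseteq> W"
proof -
  obtain y e where e: "0 < e" "ball y e \<subseteq> W"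
    using assms openE by blast
  obtain R where R: "0 < R" "R \<le> e" "\<forall>p q :: 'a. dist p q < R \<longrightarrow> (\<exists>\<gamma>. path \<gamma> \<and> pathstart \<gamma> = p \<and>
      pathfinish \<gamma> = q \<and> ball p R \<subseteq> path_image \<gamma> \<and> path_image \<gamma> \<subseteq> ball p e)"
    using local_covering_path_to[OF e(1)] by blast
  obtain z where z: "z \<noteq> y" "dist z y < R"
    using islimpt_space[of y] R(1) unfolding islimpt_approachable by blast
  then obtain \<gamma> where \<gamma>: "path \<gamma>" "pathstart \<gamma> = y" "pathfinish \<gamma> = z" "path_image \<gamma> \<subseteq> ball y e"
    using R(3) by (metis dist_commute)
  then show ?thesis
    using path_contains_arc_in_space[of \<gamma>] z(1) e(2) by (metis order_trans)
qed

end

subsection \<open>Staircase functions and locally constant maps\<close>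

text \<open>A devil's staircase: \<open>E\<close> contains all points of growth, and by the last
  clause every value is taken on \<open>E\<close> itself. So a set without interior is mapped onto
  the unit interval.\<close>

definition staircase :: "(real \<Rightarrow> real) \<Rightarrow> real set \<Rightarrow> bool" where
  "staircase c E \<longleftrightarrow> continuous_on UNIV c \<and> (\<forall>x\<le>0. c x = 0) \<and> (\<forall>x\<ge>1. c x = 1) \<and> (\<forall>x. 0 \<le> c x \<and> c x \<le> 1) \<and>
    closed E \<and> interior E = {} \<and> (\<forall>x. x \<notin> E \<longrightarrow> (\<exists>e>0. \<forall>y. dist y x < e \<longrightarrow> c y = c x)) \<and>
    (\<forall>t\<in>{0..1}. \<exists>e\<in>E \<inter> {0..1}. c e = t)"

text \<open>A staircase integrates the indicator of a closed set without interior whose measure is almost 1.\<close>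

lemma staircase_exists:
  assumes "0 < \<eta>"
  shows "\<exists>c E. staircase c E \<and> (\<forall>x\<in>{0..1}. \<bar>c x - x\<bar> \<le> \<eta>)"
proof -
  define \<delta> where "\<delta> = min \<eta> (1 / 2)"
  have \<delta>: "0 < \<delta>" "\<delta> \<le> \<eta>" "\<delta> < 1"
    using assms by (auto simp: \<delta>_def)
  have "(\<rat> :: real set) \<in> sets borel"
    by (rule sets.countable) (auto simp: countable_rat)
  \<comment> \<open>Outer regularity gives an open set of measure at most \<delta> around the
    rationals. Removing it leaves no interval, yet nearly full measure.\<close>
  then obtain G :: "real set" where G: "open G" "\<rat> \<subseteq> G" "emeasure lborel (G - \<rat>) < ennreal \<delta>"
    using outer_regular_lborel[of "\<rat>" \<delta>] \<delta>(1) by blast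
  have "emeasure lborel (\<rat> :: real set) = 0"
    by (simp add: countable_rat emeasure_lborel_countable)
  then have G\<delta>: "emeasure lborel G \<le> ennreal \<delta>"
  proof -
    have "emeasure lborel G \<le> emeasure lborel (\<rat> :: real set) + emeasure lborel (G - \<rat>)"
      using emeasure_subadditive[of "\<rat>" lborel "G - \<rat>"] G(1,2) \<open>\<rat> \<in> sets borel\<close>
      by (simp add: Un_absorb1)
    then show ?thesis
      using G(3) \<open>emeasure lborel (\<rat> :: real set) = 0\<close> by simp
  qed
  define E where "E = {0..1} - G"
  have E: "closed E" "E \<subseteq> {0..1}"
    using G(1) by (auto simp: E_def)
  have fm: "S \<in> fmeasurable lborel" if "S \<in> sets borel" "S \<subseteq> {0..1}" for S :: "real set"
  proof (rule fmeasurableI)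
    have "emeasure lborel S \<le> emeasure lborel {0..1::real}"
      using that by (intro emeasure_mono) auto
    also have "\<dots> < \<infinity>"
      by simp
    finally show "emeasure lborel S < \<infinity>" .
  qed (use that in simp)
  have "E \<in> sets borel"
    using E(1) by (rule borel_closed)
  have meas: "E \<inter> {..x} \<in> fmeasurable lborel" for x
    using E(2) \<open>E \<in> sets borel\<close> by (intro fm) auto
  define m where "m x = measure lborel (E \<inter> {..x})" for x
  have interior: "interior E = {}"
  proof (rule ccontr)
    assume "interior E \<noteq> {}"
    then obtain x e where "0 < e" "ball x e \<subseteq> E"
      by (meson ex_in_conv mem_interior)
    moreover obtain r where "r \<in> \<rat>" "x < r" "r < x + e"
      using Rats_dense_in_real[of x "x + e"] \<open>0 < e\<close> by auto
    ultimately show False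
      using G(2) by (auto simp: E_def dist_real_def subset_eq)
  qed
  have increment: "0 \<le> m y - m x \<and> m y - m x \<le> y - x" if "x \<le> y" for x y
  proof -
    have "E \<inter> {..y} = (E \<inter> {..x}) \<union> (E \<inter> {x<..y})"
      using that by auto
    moreover have "E \<inter> {x<..y} \<in> fmeasurable lborel"
      using E(2) \<open>E \<in> sets borel\<close> by (intro fm) auto
    moreover have "(E \<inter> {..x}) \<inter> (E \<inter> {x<..y}) = {}"
      by auto
    ultimately have "m y = m x + measure lborel (E \<inter> {x<..y})"
      unfolding m_def using meas[of x] by (metis measure_Un2 add.commute Diff_triv Un_commute inf_commute measure_Un3 measure_empty diff_zero)
    moreover have "measure lborel (E \<inter> {x<..y}) \<le> measure lborel {x<..y}"
    proof (rule measure_mono_fmeasurable)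
      show "{x<..y} \<in> fmeasurable lborel"
        by (rule fmeasurableI) (use that in simp_all)
    qed (use \<open>E \<in> sets borel\<close> in auto)
    ultimately show ?thesis
      using that by simp
  qed
  have m_neg: "m x = 0" if "x \<le> 0" for x
  proof -
    have "E \<inter> {..x} \<subseteq> {0}"
      using E(2) that by auto
    then have "E \<inter> {..x} = {} \<or> E \<inter> {..x} = {0}"
      by (rule subset_singletonD)
    then show ?thesis
    proof
      assume "E \<inter> {..x} = {}"
      show ?thesis
        unfolding m_def \<open>E \<inter> {..x} = {}\<close> by simp
    next
      assume "E \<inter> {..x} = {0}"
      show ?thesis
        unfolding m_def \<open>E \<inter> {..x} = {0}\<close> by simp
    qed
  qed
  have m_large: "m x = m 1" if "1 \<le> x" for x
  proof -
    have "E \<inter> {..x} = E \<inter> {..1}"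
      using that E(2) by auto
    then show ?thesis
      by (simp add: m_def)
  qed
  have m_lower: "x - \<delta> \<le> m x" if "x \<in> {0..1}" for x
  proof -
    have "{0..x} \<subseteq> (E \<inter> {..x}) \<union> G"
      using that by (auto simp: E_def)
    moreover have G': "G \<in> fmeasurable lborel"
      using G(1) G\<delta> by (auto simp: fmeasurable_def intro: order_le_less_trans)
    ultimately have "measure lborel {0..x} \<le> measure lborel ((E \<inter> {..x}) \<union> G)"
      using meas by (intro measure_mono_fmeasurable) (auto intro: fmeasurable.Un)
    also have "\<dots> \<le> m x + measure lborel G"
      unfolding m_def using \<open>E \<in> sets borel\<close> G(1) by (intro measure_Un_le) auto
    also have "measure lborel G \<le> \<delta>"
      using G\<delta> \<delta>(1) by (simp add: measure_def enn2real_leI)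
    finally show ?thesis
      using that by simp
  qed
  have m1: "1 - \<delta> \<le> m 1" "0 < m 1" "m 1 \<le> 1"
    using m_lower[of 1] \<delta>(3) increment[of 0 1] m_neg[of 0] by auto
  define c where "c x = m x / m 1" for x
  have m_range: "0 \<le> m x" "m x \<le> m 1" for x
  proof -
    show "0 \<le> m x"
      by (simp add: m_def)
    show "m x \<le> m 1"
      using increment[of x 1] m_large[of x] by (cases "x \<le> 1") auto
  qed
  have same: "m y = m x" if "E \<inter> {..y} = E \<inter> {..x}" for x y
    using that by (simp add: m_def)
  have "staircase c E"
    unfolding staircase_def
  proof (intro conjI allI impI ballI)
    show "continuous_on UNIV c"
    proof -
      have "\<bar>m x - m y\<bar> \<le> \<bar>x - y\<bar>" for x y
        using increment[of x y] increment[of y x] by (cases "x \<le> y") auto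
      then have "continuous_on UNIV m"
        unfolding continuous_on_iff dist_real_def by (metis order_le_less_trans)
      then show ?thesis
        unfolding c_def using m1 by (intro continuous_intros) auto
    qed
    show "c x = 0" if "x \<le> 0" for x
      using m_neg[OF that] by (simp add: c_def)
    show "c x = 1" if "1 \<le> x" for x
      using m_large[OF that] m1 by (simp add: c_def)
    show "0 \<le> c x" "c x \<le> 1" for x
      using m_range[of x] m1 by (auto simp: c_def)
    show "closed E" "interior E = {}"
      by fact+
    show "\<exists>e>0. \<forall>y. dist y x < e \<longrightarrow> c y = c x" if "x \<notin> E" for x
    proof -
      have "open (- E)"
        using E(1) by auto
      moreover have "x \<in> - E"
        using that by simp
      ultimately obtain e where e: "0 < e" "ball x e \<subseteq> - E"
        by (meson openE)
      have "c y = c x" if "dist y x < e" for y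
      proof -
        have "z \<notin> E" if "x < z \<and> z \<le> y \<or> y < z \<and> z \<le> x" for z
        proof -
          have "z \<in> ball x e"
            using that \<open>dist y x < e\<close> by (auto simp: dist_real_def)
          then show ?thesis
            using e(2) by blast
        qed
        then have "E \<inter> {..y} = E \<inter> {..x}"
          by (auto simp: not_le[symmetric])
        then have "m y = m x"
          by (rule same)
        then show ?thesis
          by (simp add: c_def)
      qed
      then show ?thesis
        using e(1) by blast
    qed
    \<comment> \<open>A value taken at \<open>x\<close> is also taken at the largest point of
      \<open>E\<close> below \<open>x\<close>, since \<open>m\<close> does not grow in between. If
      there is no such point, then \<open>t = 0\<close>, and the least point of \<open>E\<close>
      serves because points have measure zero.\<close>
    show "\<exists>e\<in>E \<inter> {0..1}. c e = t" if t: "t \<in> {0..1}" for t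
    proof -
      have "continuous_on {0..1} m"
      proof -
        have "\<bar>m x - m y\<bar> \<le> \<bar>x - y\<bar>" for x y
          using increment[of x y] increment[of y x] by (cases "x \<le> y") auto
        then show ?thesis
          unfolding continuous_on_iff dist_real_def by (metis order_le_less_trans)
      qed
      moreover have "m 0 \<le> t * m 1" "t * m 1 \<le> m 1"
        using t m1 m_neg[of 0] by (auto simp: mult_left_le_one_le)
      ultimately obtain x where x: "0 \<le> x" "x \<le> 1" "m x = t * m 1"
        using IVT'[of m 0 "t * m 1" 1] by auto
      have cE: "compact (E \<inter> {..y})" for y
        using E compact_Icc[of 0 "1::real"] by (metis closed_Int closed_atMost compact_Int_closed inf.absorb_iff2)
      show ?thesis
      proof (cases "E \<inter> {..x} = {}")
        case False
        then obtain e where e: "e \<in> E \<inter> {..x}" "\<forall>z\<in>E \<inter> {..x}. z \<le> e"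
          using compact_attains_sup[OF cE[of x]] by blast
        then have "E \<inter> {..e} = E \<inter> {..x}"
          by auto
        then have "m e = m x"
          by (rule same)
        then show ?thesis
          using x(3) m1 e(1) E(2) by (intro bexI[of _ e]) (auto simp: c_def)
      next
        case True
        then have "t = 0"
          using x(3) m1 by (simp add: m_def)
        have "E \<inter> {..1} \<noteq> {}"
          using m1 by (auto simp: m_def)
        then obtain e where e: "e \<in> E \<inter> {..1}" "\<forall>z\<in>E \<inter> {..1}. e \<le> z"
          using compact_attains_inf[OF cE[of 1]] by (metis (no_types))
        then have "E \<inter> {..e} = {e}"
          by force
        then have "m e = 0"
          unfolding m_def by (simp only:) simp
        then show ?thesis
          using \<open>t = 0\<close> e(1) E(2) by (intro bexI[of _ e]) (auto simp: c_def)
      qed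
    qed
  qed
  moreover have "\<bar>c x - x\<bar> \<le> \<eta>" if "x \<in> {0..1}" for x
  proof -
    have "m x \<le> c x"
      using m_range[of x] m1 by (simp add: c_def field_simps mult_left_le_one_le)
    moreover have "c x \<le> m x + \<delta>"
    proof -
      have "c x - m x = c x * (1 - m 1)"
        using m1 by (simp add: c_def field_simps)
      also have "\<dots> \<le> 1 * (1 - m 1)"
        using m_range[of x] m1 by (intro mult_right_mono) (auto simp: c_def)
      finally have "c x - m x \<le> 1 - m 1"
        by simp
      then show ?thesis
        using m1(1) by simp
    qed
    moreover have "m x \<le> x"
      using increment[of 0 x] that m_neg[of 0] by auto
    ultimately show ?thesis
      using m_lower[OF that] \<delta>(2) by linarith
  qed
  ultimately show ?thesis
    by blast
qed

definition lc_on :: "'a::topological_space set \<Rightarrow> ('a \<Rightarrow> 'b) \<Rightarrow> bool" where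
  "lc_on S h \<longleftrightarrow> (\<forall>V. open V \<and> V \<noteq> {} \<and> V \<subseteq> S \<longrightarrow> (\<exists>W. open W \<and> W \<noteq> {} \<and> W \<subseteq> V \<and> h constant_on W))"

lemma connected_real_no_interior:
  fixes E :: "real set"
  assumes "connected C" "C \<subseteq> E" "interior E = {}" "a \<in> C" "b \<in> C"
  shows "a = b"
proof -
  have "False" if "a \<in> C" "b \<in> C" "a < b" for a b
  proof -
    have "{a..b} \<subseteq> C"
      using assms(1) that connected_contains_Icc by blast
    then have "{a<..<b} \<subseteq> interior E"
      using assms(2) by (intro interior_maximal) (auto simp: subset_eq)
    then show False
      using assms(3) that(3) dense by (metis empty_iff greaterThanLessThan_iff subset_empty)
  qed
  then show ?thesis
    using assms by (meson linorder_neqE_linordered_idom)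
qed

context peano_space
begin

lemma connected_open_nbhd:
  assumes "open (V :: 'a set)" "x \<in> V"
  shows "\<exists>W. open W \<and> connected W \<and> x \<in> W \<and> W \<subseteq> V"
  using locally_connected_space[unfolded locally_connected, rule_format, of V x] assms by auto

text \<open>Local connectedness makes this work for any continuous \<open>\<phi>\<close>: on a
  connected open set either \<open>\<phi>\<close> stays in \<open>E\<close>, which contains no
  interval, so \<open>\<phi>\<close> itself is constant, or some value lies outside
  \<open>E\<close>, where \<open>c\<close> is locally constant.\<close>

lemma lc_on_staircase:
  fixes \<phi> :: "'a \<Rightarrow> real"
  assumes c: "staircase c E" and \<phi>: "continuous_on V \<phi>" and V: "open V" "V \<noteq> {}"
  shows "\<exists>W. open W \<and> W \<noteq> {} \<and> W \<subseteq> V \<and> (\<lambda>x. c (\<phi> x)) constant_on W"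
proof -
  obtain v where "v \<in> V"
    using V(2) by blast
  then obtain W where W: "open W" "connected W" "v \<in> W" "W \<subseteq> V"
    using connected_open_nbhd[OF V(1)] by blast
  show ?thesis
  proof (cases "\<phi> ` W \<subseteq> E")
    case True
    have "connected (\<phi> ` W)"
      using \<phi> W by (metis connected_continuous_image continuous_on_subset)
    then have "\<phi> x = \<phi> v" if "x \<in> W" for x
      using connected_real_no_interior[OF _ True] c W(3) that unfolding staircase_def by blast
    then show ?thesis
      using W unfolding constant_on_def by (intro exI[of _ W]) (metis empty_iff)
  next
    case False
    then obtain x where x: "x \<in> W" "\<phi> x \<notin> E"
      by blast
    then obtain e where e: "0 < e" "\<And>y. dist y (\<phi> x) < e \<Longrightarrow> c y = c (\<phi> x)"
      using c unfolding staircase_def by blast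
    define U where "U = W \<inter> \<phi> -` ball (\<phi> x) e"
    have "open U"
      unfolding U_def using \<phi> W by (intro continuous_open_preimage) (auto intro: continuous_on_subset)
    moreover have "x \<in> U"
      using x e(1) by (simp add: U_def)
    moreover have "c (\<phi> y) = c (\<phi> x)" if "y \<in> U" for y
      using that e(2) by (simp add: U_def dist_commute)
    ultimately show ?thesis
      using W(4) unfolding constant_on_def by (intro exI[of _ U]) (metis U_def empty_iff inf.coboundedI1)
  qed
qed

text \<open>The preimage of \<open>E\<close> may have interior, where \<open>\<phi>\<close> is
  locally constant. Its frontier has none and still takes every value \<open>t\<close> in
  \<open>E\<close> between 0 and 1: by connectedness of the space the level set of \<open>t\<close>
  is not open, and at a point not interior to it \<open>\<phi>\<close> is not locally
  constant.\<close>

lemma nowhere_dense_preimage: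
  fixes \<phi> :: "'a \<Rightarrow> real"
  assumes E: "closed E" "interior E = {}" and \<phi>: "continuous_on UNIV \<phi>"
    and vals: "\<phi> a \<le> 0" "1 \<le> \<phi> b"
  shows "\<exists>K. closed K \<and> interior K = {} \<and> K \<subseteq> {x. \<phi> x \<in> E} \<and> (\<forall>t\<in>E \<inter> {0..1}. \<exists>x\<in>K. \<phi> x = t)"
proof -
  define P where "P = \<phi> -` E"
  have "closed P"
    unfolding P_def using \<phi> E(1) by (simp add: closed_vimage continuous_on_eq_continuous_at)
  have "\<exists>x\<in>frontier P. \<phi> x = t" if t: "t \<in> E \<inter> {0..1}" for t
  proof -
    define Z where "Z = \<phi> -` {t}"
    have "closed Z"
      unfolding Z_def using \<phi> by (intro closed_vimage) (auto simp: continuous_on_eq_continuous_at)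
    have "Z \<noteq> {}"
    proof -
      have "connected (range \<phi>)"
        using \<phi> connected_space by (rule connected_continuous_image)
      then have "{\<phi> a..\<phi> b} \<subseteq> range \<phi>"
        by (intro connected_contains_Icc) auto
      then have "t \<in> range \<phi>"
        using t vals by auto
      then show ?thesis
        by (auto simp: Z_def)
    qed
    moreover have "Z \<noteq> UNIV"
      using vals unfolding Z_def by (metis UNIV_I linorder_not_le order_trans vimage_singleton_eq zero_less_one)
    ultimately have "\<not> open Z"
      using connected_space \<open>closed Z\<close> by (metis connected_clopen closed_closedin open_openin topspace_euclidean subtopology_UNIV)
    then obtain x where x: "x \<in> Z" "x \<notin> interior Z"
      by (metis interior_eq interior_subset subsetI subset_antisym)
    have "x \<notin> interior P"
    proof
      assume "x \<in> interior P"
      then obtain W where W: "open W" "connected W" "x \<in> W" "W \<subseteq> interior P"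
        using connected_open_nbhd[OF open_interior] by blast
      have "\<phi> ` W \<subseteq> E"
        using W(4) interior_subset by (auto simp: P_def)
      moreover have "connected (\<phi> ` W)"
        using \<phi> W by (metis connected_continuous_image continuous_on_subset subset_UNIV)
      ultimately have "\<phi> y = \<phi> x" if "y \<in> W" for y
        using connected_real_no_interior[of "\<phi> ` W" E] E(2) W(3) that by blast
      then have "W \<subseteq> Z"
        using x(1) by (auto simp: Z_def)
      then show False
        using x(2) W by (meson interior_maximal subsetD)
    qed
    moreover have "x \<in> P"
      using x(1) t by (auto simp: Z_def P_def)
    ultimately show ?thesis
      using x(1) closure_subset[of P] by (auto simp: frontier_def Z_def)
  qed
  moreover have "interior (frontier P) = {}"
  proof -
    have "interior (frontier P) \<subseteq> interior P"
      using \<open>closed P\<close> by (intro interior_mono frontier_subset_closed)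
    then show ?thesis
      using interior_subset[of "frontier P"] by (auto simp: frontier_def)
  qed
  moreover have "frontier P \<subseteq> {x. \<phi> x \<in> E}"
    using \<open>closed P\<close> frontier_subset_closed by (fastforce simp: P_def)
  ultimately show ?thesis
    by (intro exI[of _ "frontier P"]) auto
qed

end

subsection \<open>Modifying maps on small balls\<close>

text \<open>The choice is unique for disjoint sets \<open>U i\<close>. The factor
  \<open>\<psi> i\<close> reduces the source to one real coordinate, so that local constancy and
  crossings become questions about real functions.\<close>

definition bump :: "'i set \<Rightarrow> ('i \<Rightarrow> 'a set) \<Rightarrow> ('i \<Rightarrow> 'a \<Rightarrow> real) \<Rightarrow> ('i \<Rightarrow> real \<Rightarrow> 'b) \<Rightarrow> ('a \<Rightarrow> 'b) \<Rightarrow> 'a \<Rightarrow> 'b" where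
  "bump I U \<psi> \<gamma> h x = (if \<exists>i\<in>I. x \<in> U i then (let i = SOME i. i \<in> I \<and> x \<in> U i in \<gamma> i (\<psi> i x)) else h x)"

lemma bump_inside:
  assumes "disjoint_family_on U I" "i \<in> I" "x \<in> U i"
  shows "bump I U \<psi> \<gamma> h x = \<gamma> i (\<psi> i x)"
proof -
  have *: "j = i" if "j \<in> I \<and> x \<in> U j" for j
    using assms that unfolding disjoint_family_on_def by (metis IntI empty_iff)
  have "(SOME i. i \<in> I \<and> x \<in> U i) = i"
    using conjI[OF assms(2,3)] * by (rule some_equality)
  moreover have "\<exists>i\<in>I. x \<in> U i"
    using assms by blast
  ultimately show ?thesis
    unfolding bump_def Let_def by simp
qed

lemma bump_outside: "x \<notin> (\<Union>i\<in>I. U i) \<Longrightarrow> bump I U \<psi> \<gamma> h x = h x"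
  unfolding bump_def by auto

text \<open>The map is pasted from the closed sets \<open>closure (U i)\<close> and the complement
  of the bumps. On the frontier of \<open>U i\<close> the coordinate vanishes, so the path is at its
  start \<open>p i\<close>, which is also the value of \<open>h\<close> there by continuity.\<close>

lemma bump_continuous:
  fixes h :: "'a::topological_space \<Rightarrow> 'b::t1_space"
  assumes I: "finite I" and disj: "disjoint_family_on U I" and U: "\<And>i. i \<in> I \<Longrightarrow> open (U i)"
    and h: "continuous_on UNIV h" "\<And>i x. i \<in> I \<Longrightarrow> x \<in> U i \<Longrightarrow> h x = p i"
    and \<psi>: "\<And>i. i \<in> I \<Longrightarrow> continuous_on UNIV (\<psi> i)" "\<And>i x. i \<in> I \<Longrightarrow> \<psi> i x \<in> {0..1}"
      "\<And>i x. i \<in> I \<Longrightarrow> x \<notin> U i \<Longrightarrow> \<psi> i x = 0"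
    and \<gamma>: "\<And>i. i \<in> I \<Longrightarrow> path (\<gamma> i)" "\<And>i. i \<in> I \<Longrightarrow> \<gamma> i 0 = p i"
  shows "continuous_on UNIV (bump I U \<psi> \<gamma> h)"
proof -
  let ?g = "bump I U \<psi> \<gamma> h"
  have "continuous_on (- (\<Union>i\<in>I. U i)) ?g"
  proof (rule continuous_on_eq)
    show "continuous_on (- (\<Union>i\<in>I. U i)) h"
      using h(1) by (rule continuous_on_subset) simp
  qed (simp add: bump_outside)
  moreover have "continuous_on (\<Union>i\<in>I. closure (U i)) ?g"
  proof (rule continuous_on_closed_Union[OF I])
    fix i
    assume i: "i \<in> I"
    have "continuous_on (closure (U i)) (\<lambda>x. \<gamma> i (\<psi> i x))"
    proof (rule continuous_on_compose2[OF \<gamma>(1)[OF i, unfolded path_def]])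
      show "continuous_on (closure (U i)) (\<psi> i)"
        using \<psi>(1)[OF i] by (rule continuous_on_subset) simp
    qed (use \<psi>(2)[OF i] in blast)
    then show "continuous_on (closure (U i)) ?g"
    proof (rule continuous_on_eq)
      fix x
      assume x: "x \<in> closure (U i)"
      show "\<gamma> i (\<psi> i x) = ?g x"
      proof (cases "x \<in> U i")
        case True
        then show ?thesis
          using bump_inside[OF disj i] by metis
      next
        case False
        have "x \<notin> U j" if "j \<in> I" for j
        proof
          assume "x \<in> U j"
          then have "i \<noteq> j"
            using False by blast
          then have "U j \<inter> U i = {}"
            using disj i that unfolding disjoint_family_on_def by (metis inf_commute)
          then have "U j \<inter> closure (U i) = {}"
            using open_Int_closure_eq_empty[OF U[OF that]] by blast
          then show False
            using x \<open>x \<in> U j\<close> by blast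
        qed
        then have "?g x = h x"
          by (intro bump_outside) blast
        moreover have "h x = p i"
          using continuous_constant_on_closure[of "U i" h "p i"] h x i by (meson continuous_on_subset subset_UNIV)
        ultimately show ?thesis
          using \<gamma>(2) \<psi>(3) False i by simp
      qed
    qed
  qed auto
  ultimately have "continuous_on (- (\<Union>i\<in>I. U i) \<union> (\<Union>i\<in>I. closure (U i))) ?g"
  proof (rule continuous_on_closed_Un[rotated 2])
    show "closed (- (\<Union>i\<in>I. U i))"
      using U by (intro closed_Compl open_UN) blast
    show "closed (\<Union>i\<in>I. closure (U i))"
      using I by (intro closed_UN) auto
  qed
  moreover have "- (\<Union>i\<in>I. U i) \<union> (\<Union>i\<in>I. closure (U i)) = UNIV"
    using closure_subset by blast
  ultimately show ?thesis
    by simp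
qed

lemma lc_onE:
  assumes "lc_on S h" "open V" "V \<noteq> {}" "V \<subseteq> S"
  obtains W where "open W" "W \<noteq> {}" "W \<subseteq> V" "h constant_on W"
  using assms unfolding lc_on_def by blast

lemma constant_on_cong: "(\<And>x. x \<in> W \<Longrightarrow> f x = g x) \<Longrightarrow> f constant_on W \<longleftrightarrow> g constant_on W"
  unfolding constant_on_def by auto

lemma bump_lc_on:
  assumes disj: "disjoint_family_on U I" and U: "\<And>i. i \<in> I \<Longrightarrow> open (U i)"
    and h: "lc_on S h" and \<gamma>: "\<And>i. i \<in> I \<Longrightarrow> lc_on (U i \<inter> S) (\<lambda>x. \<gamma> i (\<psi> i x))"
  shows "lc_on S (bump I U \<psi> \<gamma> h)"
  unfolding lc_on_def
proof (intro allI impI, elim conjE)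
  fix V
  assume V: "open V" "V \<noteq> {}" "V \<subseteq> S"
  show "\<exists>W. open W \<and> W \<noteq> {} \<and> W \<subseteq> V \<and> bump I U \<psi> \<gamma> h constant_on W"
  proof (cases "V \<inter> (\<Union>i\<in>I. U i) = {}")
    case True
    obtain W where W: "open W" "W \<noteq> {}" "W \<subseteq> V" "h constant_on W"
      using lc_onE[OF h V] by blast
    have "bump I U \<psi> \<gamma> h constant_on W \<longleftrightarrow> h constant_on W"
      using W(3) True by (intro constant_on_cong bump_outside) blast
    then show ?thesis
      using W by blast
  next
    case False
    then obtain i where i: "i \<in> I" "V \<inter> U i \<noteq> {}"
      by blast
    have "open (V \<inter> U i)" "V \<inter> U i \<subseteq> U i \<inter> S"
      using V U[OF i(1)] by auto
    then obtain W where W: "open W" "W \<noteq> {}" "W \<subseteq> V \<inter> U i" "(\<lambda>x. \<gamma> i (\<psi> i x)) constant_on W"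
      using lc_onE[OF \<gamma>[OF i(1)] _ i(2)] by blast
    have "bump I U \<psi> \<gamma> h constant_on W \<longleftrightarrow> (\<lambda>x. \<gamma> i (\<psi> i x)) constant_on W"
      using W(3) by (intro constant_on_cong bump_inside[OF disj i(1)]) blast
    then show ?thesis
      using W by blast
  qed
qed

lemma distinct_points:
  assumes "finite I" "\<And>i. i \<in> I \<Longrightarrow> infinite (G i)"
  shows "\<exists>z. inj_on z I \<and> (\<forall>i\<in>I. z i \<in> G i)"
  using assms
proof (induction I rule: finite_induct)
  case (insert i I)
  obtain z where z: "inj_on z I" "\<forall>i\<in>I. z i \<in> G i"
    using insert by blast
  have "infinite (G i - z ` I)"
    using insert by (simp add: Diff_infinite_finite)
  then obtain y where y: "y \<in> G i" "y \<notin> z ` I"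
    by (metis DiffE ex_in_conv finite.emptyI)
  have "inj_on (z(i := y)) (insert i I)"
    using z(1) y(2) insert.hyps(2) by (auto simp: inj_on_def)
  moreover have "\<forall>j\<in>insert i I. (z(i := y)) j \<in> G j"
    using z(2) y(1) insert.hyps(2) by auto
  ultimately show ?case
    by blast
qed auto

lemma finite_positive_bound:
  fixes A :: "real set"
  assumes "finite A" "\<And>a. a \<in> A \<Longrightarrow> 0 < a"
  shows "\<exists>r>0. \<forall>a\<in>A. r \<le> a"
proof (intro exI conjI ballI)
  show "0 < Min (insert 1 A)"
    using assms by auto
  show "Min (insert 1 A) \<le> a" if "a \<in> A" for a
    using assms(1) that by simp
qed

text \<open>The factor 2 is a margin: around a bump of radius \<open>\<rho>\<close>, points of the
  bounding sphere and points slightly outside remain controlled.\<close>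

lemma separated_radius:
  fixes z :: "'i \<Rightarrow> 'a::metric_space"
  assumes I: "finite I" "inj_on z I" and N: "\<And>i. i \<in> I \<Longrightarrow> open (N i) \<and> z i \<in> N i" and "0 < B"
  shows "\<exists>\<rho>>0. \<rho> \<le> B \<and> (\<forall>i\<in>I. ball (z i) (2 * \<rho>) \<subseteq> N i) \<and> disjoint_family_on (\<lambda>i. ball (z i) (2 * \<rho>)) I"
proof -
  have "\<forall>i. \<exists>e>0. i \<in> I \<longrightarrow> ball (z i) e \<subseteq> N i"
    using N openE by (metis zero_less_one)
  then obtain e where e: "\<And>i. 0 < e i" "\<And>i. i \<in> I \<Longrightarrow> ball (z i) (e i) \<subseteq> N i"
    by metis
  define A where "A = {B} \<union> (\<lambda>i. e i / 2) ` I \<union> (\<lambda>(i, j). dist (z i) (z j) / 4) ` {(i, j) \<in> I \<times> I. i \<noteq> j}"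
  have "finite A"
    unfolding A_def using I(1) by (auto intro: finite_subset[of _ "I \<times> I"])
  have "0 < a" if "a \<in> A" for a
    using that \<open>0 < B\<close> e(1) I(2) by (auto simp: A_def inj_on_def)
  then have "\<exists>r>0. \<forall>a\<in>A. r \<le> a"
    by (rule finite_positive_bound[OF \<open>finite A\<close>])
  then obtain \<rho> where \<rho>: "0 < \<rho>" "\<And>a. a \<in> A \<Longrightarrow> \<rho> \<le> a"
    by auto
  have 1: "\<rho> \<le> B"
    by (rule \<rho>(2)) (simp add: A_def)
  have 2: "ball (z i) (2 * \<rho>) \<subseteq> N i" if "i \<in> I" for i
  proof -
    have "\<rho> \<le> e i / 2"
      using that by (intro \<rho>(2)) (auto simp: A_def)
    then have "ball (z i) (2 * \<rho>) \<subseteq> ball (z i) (e i)"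
      by (intro subset_ball) simp
    then show ?thesis
      using e(2)[OF that] by blast
  qed
  have 3: "ball (z i) (2 * \<rho>) \<inter> ball (z j) (2 * \<rho>) = {}" if "i \<in> I" "j \<in> I" "i \<noteq> j" for i j
  proof -
    have "\<rho> \<le> dist (z i) (z j) / 4"
      using that by (intro \<rho>(2)) (auto simp: A_def)
    then show ?thesis
      by (intro disjoint_ballI) simp
  qed
  show ?thesis
    unfolding disjoint_family_on_def
    by (rule exI[of _ \<rho>]) (intro conjI ballI impI \<rho>(1) 1 2 3)
qed

definition tent :: "'a::metric_space \<Rightarrow> real \<Rightarrow> 'a \<Rightarrow> real" where
  "tent z \<rho> x = max 0 (1 - dist x z / \<rho>)"

lemma tent:
  assumes "0 < \<rho>"
  shows "continuous_on S (tent z \<rho>)" "tent z \<rho> x \<in> {0..1}" "x \<notin> ball z \<rho> \<Longrightarrow> tent z \<rho> x = 0"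
    "tent z \<rho> z = 1" "0 < tent z \<rho> x \<Longrightarrow> x \<in> ball z \<rho>" "\<bar>tent z \<rho> x - tent z \<rho> y\<bar> \<le> dist x y / \<rho>"
proof -
  show "continuous_on S (tent z \<rho>)"
    unfolding tent_def using assms by (intro continuous_intros) auto
  show "tent z \<rho> x \<in> {0..1}" "x \<notin> ball z \<rho> \<Longrightarrow> tent z \<rho> x = 0"
    "tent z \<rho> z = 1" "0 < tent z \<rho> x \<Longrightarrow> x \<in> ball z \<rho>"
    using assms by (auto simp: tent_def dist_commute field_simps max_def split: if_splits)
  have "\<bar>dist x z - dist y z\<bar> \<le> dist x y"
    using dist_triangle[of x z y] dist_triangle[of y z x] by (simp add: dist_commute abs_le_iff)
  then have "\<bar>dist x z / \<rho> - dist y z / \<rho>\<bar> \<le> dist x y / \<rho>"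
    using assms by (simp add: field_simps abs_le_iff)
  then show "\<bar>tent z \<rho> x - tent z \<rho> y\<bar> \<le> dist x y / \<rho>"
    unfolding tent_def by linarith
qed

text \<open>Moving a map by less than \<open>e\<close> near a point is enough to cover a ball of
  radius \<open>R\<close>; this pair of numbers links one scale to the next. The type argument names
  the space, which the two numbers do not.\<close>

definition covering_radius :: "'a::metric_space itself \<Rightarrow> real \<Rightarrow> real \<Rightarrow> bool" where
  "covering_radius _ e R \<longleftrightarrow> 0 < R \<and> R \<le> e \<and> (\<forall>p q :: 'a. dist p q < R \<longrightarrow>
    (\<exists>\<gamma>. path \<gamma> \<and> pathstart \<gamma> = p \<and> pathfinish \<gamma> = q \<and> ball p R \<subseteq> path_image \<gamma> \<and> path_image \<gamma> \<subseteq> ball p e))"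

context peano_space
begin

lemma covering_radius_exists: "0 < e \<Longrightarrow> \<exists>R. covering_radius TYPE('a) e R"
  unfolding covering_radius_def using local_covering_path_to by metis

text \<open>Ensures that a ball of radius at most \<open>D\<close> is never the whole space, so that
  tent functions supported there really run from 0 to 1.\<close>

lemma far_point: "\<exists>D>0. \<forall>z :: 'a. \<exists>w. D \<le> dist w z"
proof -
  obtain a b :: 'a where "a \<noteq> b"
    using two_points by blast
  have "\<exists>w. dist a b / 2 \<le> dist w z" for z :: 'a
  proof -
    have "dist a b \<le> dist a z + dist b z"
      by (rule dist_triangle2)
    then have "dist a b / 2 \<le> dist a z \<or> dist a b / 2 \<le> dist b z"
      by linarith
    then show ?thesis
      by blast
  qed
  then show ?thesis
    using \<open>a \<noteq> b\<close> by (intro exI[of _ "dist a b / 2"]) auto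
qed

text \<open>The open sets of constancy are dense off \<open>T\<close> and every nonempty open set is
  infinite, so distinct centres exist even if the sets \<open>G i\<close> coincide. The
  neighbourhoods \<open>N\<close> are free for side conditions on the balls.\<close>

lemma plateau_points:
  fixes h :: "'a \<Rightarrow> 'b"
  assumes I: "finite I" and T: "closed T" "lc_on (- T) h"
    and G: "\<And>i. i \<in> I \<Longrightarrow> open (G i) \<and> \<not> G i \<subseteq> T"
    and N: "\<And>x. open (N x) \<and> x \<in> N x" and "0 < B"
  shows "\<exists>z \<rho>. 0 < \<rho> \<and> \<rho> \<le> B \<and> disjoint_family_on (\<lambda>i. ball (z i) (2 * \<rho>)) I \<and>
    (\<forall>i\<in>I. ball (z i) (2 * \<rho>) \<subseteq> G i - T \<and> ball (z i) (2 * \<rho>) \<subseteq> N (z i) \<and>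
      (\<forall>x\<in>ball (z i) (2 * \<rho>). h x = h (z i)))"
proof -
  define O' where "O' = \<Union>{W. open W \<and> h constant_on W}"
  have "infinite (O' \<inter> (G i - T))" if i: "i \<in> I" for i
  proof (rule open_infinite)
    have *: "open (G i - T)" "G i - T \<noteq> {}" "G i - T \<subseteq> - T"
      using G[OF i] T(1) by auto
    then show "open (O' \<inter> (G i - T))"
      by (auto simp: O'_def)
    show "O' \<inter> (G i - T) \<noteq> {}"
    proof -
      obtain W where W: "open W" "W \<noteq> {}" "W \<subseteq> G i - T" "h constant_on W"
        using lc_onE[OF T(2) *] by blast
      then have "W \<subseteq> O'"
        by (auto simp: O'_def)
      then show ?thesis
        using W(2,3) by blast
    qed
  qed
  then obtain z where z: "inj_on z I" "\<And>i. i \<in> I \<Longrightarrow> z i \<in> O' \<inter> (G i - T)"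
    using distinct_points[OF I, of "\<lambda>i. O' \<inter> (G i - T)"] by blast
  have "\<exists>W. open W \<and> z i \<in> W \<and> h constant_on W" if "i \<in> I" for i
    using z(2)[OF that] by (auto simp: O'_def)
  then obtain W where W: "\<And>i. i \<in> I \<Longrightarrow> open (W i) \<and> z i \<in> W i \<and> h constant_on W i"
    by metis
  have "open (W i \<inter> (G i - T) \<inter> N (z i)) \<and> z i \<in> W i \<inter> (G i - T) \<inter> N (z i)" if "i \<in> I" for i
    using W[OF that] G[OF that] T(1) z(2)[OF that] N[of "z i"] by auto
  then obtain \<rho> where \<rho>: "0 < \<rho>" "\<rho> \<le> B" "\<forall>i\<in>I. ball (z i) (2 * \<rho>) \<subseteq> W i \<inter> (G i - T) \<inter> N (z i)"
    "disjoint_family_on (\<lambda>i. ball (z i) (2 * \<rho>)) I"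
    using separated_radius[OF I z(1), of "\<lambda>i. W i \<inter> (G i - T) \<inter> N (z i)" B] \<open>0 < B\<close> by blast
  have "h x = h (z i)" if "i \<in> I" "x \<in> ball (z i) (2 * \<rho>)" for i x
  proof -
    have "x \<in> W i" "z i \<in> W i"
      using W[OF that(1)] \<rho>(3) that by blast+
    then show ?thesis
      using W[OF that(1)] unfolding constant_on_def by metis
  qed
  moreover have "ball (z i) (2 * \<rho>) \<subseteq> G i - T" "ball (z i) (2 * \<rho>) \<subseteq> N (z i)" if "i \<in> I" for i
    using \<rho>(3) that by blast+
  ultimately show ?thesis
    by (intro exI[of _ z] exI[of _ \<rho>] conjI ballI \<rho>(1,2,4))
qed

lemma interior_finite_Union_empty:
  assumes "finite I" "\<And>i. i \<in> I \<Longrightarrow> closed (F i :: 'a set) \<and> interior (F i) = {}"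
  shows "interior (\<Union>i\<in>I. F i) = {}"
  using assms
proof (induction I rule: finite_induct)
  case (insert i I)
  then have "interior (F i \<union> (\<Union>i\<in>I. F i)) = interior (F i)"
    by (intro interior_closed_Un_empty_interior) auto
  then show ?case
    using insert.prems by simp
qed simp

lemma interior_singleton_empty: "interior {x :: 'a} = {}"
  using open_infinite[OF open_interior, of "{x}"] interior_subset[of "{x}"]
  by (metis finite.emptyI finite_insert finite_subset)

text \<open>Away from \<open>T\<close>, every ball of radius \<open>r\<close> acquires a nowhere dense subset that is
  mapped onto a ball of radius \<open>R\<close>, at the cost of moving the map by less than \<open>e\<close>. Nowhere dense sets
  can be left untouched by all later modifications.\<close>

lemma make_covering:
  fixes h :: "'a \<Rightarrow> 'a"
  assumes h: "continuous_on UNIV h" and T: "closed T" "lc_on (- T) h"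
    and R: "covering_radius TYPE('a) e R" and "0 < r"
    and q: "\<And>z. dist (h z) (q z) < R"
  shows "\<exists>h' F. continuous_on UNIV h' \<and> lc_on (- T) h' \<and> closed F \<and> interior F = {} \<and> F \<inter> T = {} \<and>
    (\<forall>x\<in>T. h' x = h x) \<and> (\<forall>x. dist (h x) (h' x) < e) \<and>
    (\<forall>x. \<not> ball x (r / 2) \<subseteq> T \<longrightarrow> (\<exists>z\<in>F \<inter> ball x r. h' z = q z \<and> ball (h z) R \<subseteq> h' ` (F \<inter> ball x r)))"
proof -
  obtain D where D: "0 < D" "\<And>z :: 'a. \<exists>w. D \<le> dist w z"
    using far_point by blast
  \<comment> \<open>Radii of \<open>r / 4\<close> for the net and for the bumps fit into
    \<open>r\<close>: from \<open>x\<close> to a point off \<open>T\<close> it is less than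
    \<open>r / 2\<close>, from there to the net less than \<open>r / 4\<close>, and the bump adds
    less than \<open>r / 4\<close>.\<close>
  obtain A where A: "finite A" "A \<subseteq> - T" "- T \<subseteq> (\<Union>a\<in>A. ball a (r / 4))"
    using finite_net[of "r / 4" "- T"] \<open>0 < r\<close> by auto
  have prem: "open (ball a (r / 4)) \<and> \<not> ball a (r / 4) \<subseteq> T" if "a \<in> A" for a
    using that A(2) \<open>0 < r\<close> by (auto dest: subsetD[of _ _ a])
  have "\<exists>z \<rho>. 0 < \<rho> \<and> \<rho> \<le> D \<and> disjoint_family_on (\<lambda>a. ball (z a) (2 * \<rho>)) A \<and>
    (\<forall>a\<in>A. ball (z a) (2 * \<rho>) \<subseteq> ball a (r / 4) - T \<and> ball (z a) (2 * \<rho>) \<subseteq> UNIV \<and>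
      (\<forall>x\<in>ball (z a) (2 * \<rho>). h x = h (z a)))"
    by (rule plateau_points[OF A(1) T prem _ D(1)]) simp_all
  then obtain z \<rho> where z\<rho>: "0 < \<rho>" "\<rho> \<le> D" "disjoint_family_on (\<lambda>a. ball (z a) (2 * \<rho>)) A"
    "\<forall>a\<in>A. ball (z a) (2 * \<rho>) \<subseteq> ball a (r / 4) - T \<and> ball (z a) (2 * \<rho>) \<subseteq> UNIV \<and>
      (\<forall>x\<in>ball (z a) (2 * \<rho>). h x = h (z a))"
    by (elim exE conjE) (rule that)
  define U where "U a = ball (z a) \<rho>" for a
  have U: "U a \<subseteq> ball a (r / 4) - T" "h x = h (z a)" if "a \<in> A" "x \<in> U a" for a x
  proof -
    have "U a \<subseteq> ball (z a) (2 * \<rho>)"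
      unfolding U_def using z\<rho>(1) by (intro subset_ball) simp
    then show "U a \<subseteq> ball a (r / 4) - T" "h x = h (z a)"
      using z\<rho>(4) that by blast+
  qed
  have disj: "disjoint_family_on U A"
    using z\<rho>(1) z\<rho>(3) unfolding disjoint_family_on_def U_def
    by (smt (verit, best) disjoint_iff mem_ball)
  have openU: "open (U a)" for a
    by (simp add: U_def)
  have zU: "z a \<in> U a" for a
    using z\<rho>(1) by (simp add: U_def)
  define \<psi> where "\<psi> a = tent (z a) \<rho>" for a
  have tent: "continuous_on S (\<psi> a)" "\<psi> a x \<in> {0..1}" "x \<notin> U a \<Longrightarrow> \<psi> a x = 0" "\<psi> a (z a) = 1"
    "0 < \<psi> a x \<Longrightarrow> x \<in> U a" for S a x
    unfolding \<psi>_def U_def using tent[OF z\<rho>(1)] by blast+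
  obtain c E where c: "staircase c E"
    using staircase_exists[of 1] by auto
  have c_range: "c s \<in> {0..1}" "continuous_on S c" "c 1 = 1" "s \<le> 0 \<Longrightarrow> c s = 0" for s S
  proof -
    show "continuous_on S c"
      using c unfolding staircase_def by (blast intro: continuous_on_subset)
  qed (use c in \<open>simp_all add: staircase_def\<close>)
  have "\<exists>\<gamma>. path \<gamma> \<and> pathstart \<gamma> = h (z a) \<and> pathfinish \<gamma> = q (z a) \<and>
      ball (h (z a)) R \<subseteq> path_image \<gamma> \<and> path_image \<gamma> \<subseteq> ball (h (z a)) e" for a
    using R q[of "z a"] unfolding covering_radius_def by blast
  then obtain \<gamma> where \<gamma>: "\<And>a. path (\<gamma> a)" "\<And>a. \<gamma> a 0 = h (z a)" "\<And>a. \<gamma> a 1 = q (z a)"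
    "\<And>a. ball (h (z a)) R \<subseteq> path_image (\<gamma> a)" "\<And>a. path_image (\<gamma> a) \<subseteq> ball (h (z a)) e"
    unfolding pathstart_def pathfinish_def by metis
  \<comment> \<open>Rescaling by \<open>2 * s - 1\<close> confines the motion to the part where
    \<open>\<psi> a\<close> exceeds 1/2. The points to be frozen then have coordinate at least 1/2,
    a closed condition that holds only inside \<open>U a\<close>.\<close>
  define \<Gamma> where "\<Gamma> a s = \<gamma> a (c (2 * s - 1))" for a s
  define g where "g = bump A U \<psi> \<Gamma> h"
  have g_in: "g x = \<gamma> a (c (2 * \<psi> a x - 1))" if "a \<in> A" "x \<in> U a" for a x
    unfolding g_def bump_inside[OF disj that] \<Gamma>_def ..
  have g_out: "g x = h x" if "x \<notin> (\<Union>a\<in>A. U a)" for x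
    unfolding g_def using that by (rule bump_outside)
  have 1: "continuous_on UNIV g"
    unfolding g_def
  proof (rule bump_continuous[where p = "\<lambda>a. h (z a)", OF A(1) disj openU h])
    show "path (\<Gamma> a)" for a
      unfolding path_def \<Gamma>_def
      by (rule continuous_on_compose2[OF \<gamma>(1)[unfolded path_def, of a]])
        (use c_range(1) in \<open>auto intro!: continuous_on_compose2[OF c_range(2)[of UNIV]] continuous_intros\<close>)
    show "\<Gamma> a 0 = h (z a)" for a
      using c_range(4)[of "- 1"] \<gamma>(2) by (simp add: \<Gamma>_def)
    show "h x = h (z a)" if "a \<in> A" "x \<in> U a" for a x
      using that by (rule U(2))
    show "continuous_on UNIV (\<psi> a)" "\<psi> a x \<in> {0..1}" for a x
      by (rule tent)+
    show "\<psi> a x = 0" if "x \<notin> U a" for a x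
      using that by (rule tent)
  qed
  have 2: "lc_on (- T) g"
    unfolding g_def
  proof (rule bump_lc_on[OF disj openU T(2)])
    show "lc_on (U a \<inter> - T) (\<lambda>x. \<Gamma> a (\<psi> a x))" for a
      unfolding lc_on_def
    proof (intro allI impI, elim conjE)
      fix V :: "'a set"
      assume V: "open V" "V \<noteq> {}"
      have "continuous_on V (\<lambda>x. 2 * \<psi> a x - 1)"
        by (intro continuous_intros tent(1))
      then obtain W where "open W" "W \<noteq> {}" "W \<subseteq> V" "(\<lambda>x. c (2 * \<psi> a x - 1)) constant_on W"
        using lc_on_staircase[OF c _ V] by blast
      moreover from this obtain y where "\<And>x. x \<in> W \<Longrightarrow> c (2 * \<psi> a x - 1) = y"
        unfolding constant_on_def by blast
      then have "(\<lambda>x. \<Gamma> a (\<psi> a x)) constant_on W"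
        unfolding \<Gamma>_def constant_on_def by (intro exI[of _ "\<gamma> a y"]) simp
      ultimately show "\<exists>W. open W \<and> W \<noteq> {} \<and> W \<subseteq> V \<and> (\<lambda>x. \<Gamma> a (\<psi> a x)) constant_on W"
        by blast
    qed
  qed
  have "\<exists>K. closed K \<and> interior K = {} \<and> K \<subseteq> {x. 2 * \<psi> a x - 1 \<in> E} \<and>
      (\<forall>t\<in>E \<inter> {0..1}. \<exists>x\<in>K. 2 * \<psi> a x - 1 = t)" for a
  proof -
    obtain w where w: "D \<le> dist w (z a)"
      using D(2) by blast
    then have "w \<notin> U a"
      using z\<rho>(2) by (auto simp: U_def dist_commute)
    then have "2 * \<psi> a w - 1 \<le> 0"
      using tent(3) by simp
    moreover have "1 \<le> 2 * \<psi> a (z a) - 1"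
      using tent(4) by simp
    ultimately show ?thesis
      using c unfolding staircase_def
      by (intro nowhere_dense_preimage[where a = w and b = "z a"]) (auto intro!: continuous_intros tent(1))
  qed
  then obtain K where K: "\<And>a. closed (K a)" "\<And>a. interior (K a) = {}"
    "\<And>a t. t \<in> E \<inter> {0..1} \<Longrightarrow> \<exists>x\<in>K a. 2 * \<psi> a x - 1 = t"
    by metis
  \<comment> \<open>The centre \<open>z a\<close> is frozen as well, because its value is the
    prescribed end point \<open>q (z a)\<close> of the path; \<open>K a\<close> carries the covering
    of the ball.\<close>
  define F' where "F' a = {z a} \<union> K a \<inter> {x. 1 / 2 \<le> \<psi> a x}" for a
  define F where "F = (\<Union>a\<in>A. F' a)"
  have closedF: "closed (F' a)" for a
    unfolding F'_def using K(1) tent(1)[of UNIV a]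
    by (intro closed_Un closed_Int closed_singleton closed_Collect_le) auto
  have F'U: "F' a \<subseteq> U a" for a
    using zU tent(5) by (force simp: F'_def)
  have intF: "interior (F' a) = {}" for a
  proof -
    have "interior (F' a) = interior {z a}"
      unfolding F'_def
    proof (rule interior_closed_Un_empty_interior)
      show "interior (K a \<inter> {x. 1 / 2 \<le> \<psi> a x}) = {}"
        using K(2)[of a] by (metis inf_le1 interior_mono subset_empty)
    qed simp
    then show ?thesis
      by (simp add: interior_singleton_empty)
  qed
  have 3: "closed F"
    unfolding F_def using A(1) closedF by (intro closed_UN) auto
  have 4: "interior F = {}"
    unfolding F_def using A(1) closedF intF by (intro interior_finite_Union_empty) auto
  have 5: "F \<inter> T = {}"
    unfolding F_def using F'U U(1) zU by blast
  have 6: "g x = h x" if "x \<in> T" for x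
    using that U(1) zU by (intro g_out) blast
  have e: "0 < e"
    using R unfolding covering_radius_def by linarith
  have 7: "dist (h x) (g x) < e" for x
  proof (cases "x \<in> (\<Union>a\<in>A. U a)")
    case True
    then obtain a where a: "a \<in> A" "x \<in> U a"
      by blast
    have "g x \<in> path_image (\<gamma> a)"
      unfolding g_in[OF a] path_image_def using c_range(1) by blast
    then have "g x \<in> ball (h (z a)) e"
      using \<gamma>(5) by blast
    then show ?thesis
      using U(2)[OF a] by simp
  next
    case False
    then show ?thesis
      using g_out e by simp
  qed
  have 8: "\<exists>z\<in>F \<inter> ball x r. g z = q z \<and> ball (h z) R \<subseteq> g ` (F \<inter> ball x r)" if "\<not> ball x (r / 2) \<subseteq> T" for x
  proof -
    from that obtain y where y: "dist x y < r / 2" "y \<notin> T"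
      by (auto simp: subset_iff)
    then obtain a where a: "a \<in> A" "dist a y < r / 4"
      using A(3) by force
    have Ur: "U a \<subseteq> ball x r"
    proof
      fix u
      assume "u \<in> U a"
      then have "dist a u < r / 4"
        using U(1)[OF a(1) \<open>u \<in> U a\<close>] by auto
      then show "u \<in> ball x r"
        using y(1) a(2) dist_triangle[of x u a] dist_triangle2[of x a y] by simp
    qed
    have sub: "F' a \<subseteq> F \<inter> ball x r"
      using F'U[of a] Ur a(1) by (auto simp: F_def)
    have "ball (h (z a)) R \<subseteq> g ` F' a"
    proof
      fix v
      assume "v \<in> ball (h (z a)) R"
      then have "v \<in> path_image (\<gamma> a)"
        using \<gamma>(4) by blast
      then obtain t where t: "t \<in> {0..1}" "v = \<gamma> a t"
        by (auto simp: path_image_def)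
      then obtain s where s: "s \<in> E \<inter> {0..1}" "c s = t"
        using c unfolding staircase_def by blast
      then obtain x where x: "x \<in> K a" "2 * \<psi> a x - 1 = s"
        using K(3) by blast
      then have "x \<in> F' a"
        using s(1) by (auto simp: F'_def)
      then have "g x = v"
        using g_in[OF a(1), of x] F'U x(2) s(2) t(2) by auto
      then show "v \<in> g ` F' a"
        using \<open>x \<in> F' a\<close> by blast
    qed
    moreover have "g (z a) = q (z a)"
      using g_in[OF a(1) zU] tent(4)[of a] c_range(3) \<gamma>(3) by simp
    moreover have "z a \<in> F' a"
      by (simp add: F'_def)
    ultimately show ?thesis
      using sub by blast
  qed
  show ?thesis
    by (rule exI[of _ g], rule exI[of _ F]) (intro conjI allI ballI impI 1 2 3 4 5 6 7 8)
qed

end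

subsection \<open>Chain mixing\<close>

text \<open>With chains as powers of a relation, concatenation and repetition of loops are
  relational algebra.\<close>

definition chain_step :: "('a::metric_space \<Rightarrow> 'a) \<Rightarrow> real \<Rightarrow> ('a \<times> 'a) set" where
  "chain_step f d = {(x, y). dist (f x) y < d}"

lemma chain_transitive_iff: "chain_transitive f \<longleftrightarrow> (\<forall>a b. \<forall>d>0. \<exists>n. (a, b) \<in> chain_step f d ^^ n)"
  unfolding chain_transitive_def delta_chain_def relpow_fun_conv chain_step_def by (simp, meson)

lemma chain_step_mono: "d \<le> d' \<Longrightarrow> p \<in> chain_step f d ^^ n \<Longrightarrow> p \<in> chain_step f d' ^^ n"
  by (cases p) (auto simp: relpow_fun_conv chain_step_def intro: less_le_trans)

lemma relpow_trans: "(a, b) \<in> R ^^ m \<Longrightarrow> (b, c) \<in> R ^^ n \<Longrightarrow> (a, c) \<in> R ^^ (m + n)"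
  by (auto simp: relpow_add)

lemma relpow_loop: "(b, b) \<in> R ^^ n \<Longrightarrow> (b, b) \<in> R ^^ (j * n)"
  by (induction j) (auto intro: relpow_trans)

context peano_space
begin

text \<open>The relation "some \<open>d\<close>-chains of equal length lead from \<open>x\<close> and from \<open>y\<close> to \<open>b\<close>" is an equivalence relation
  with open classes. Comparing \<open>b\<close> with \<open>f b\<close> gives loops at \<open>b\<close> of consecutive lengths.\<close>

lemma chain_mixing:
  fixes f :: "'a \<Rightarrow> 'a"
  assumes f: "continuous_on UNIV f" and "0 < d"
    and ct: "\<And>a b. \<exists>n. (a, b) \<in> chain_step f (d / 2) ^^ n"
  shows "\<exists>N. \<forall>n\<ge>N. (a, b) \<in> chain_step f d ^^ n"
proof -
  let ?R = "chain_step f d"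
  have half: "p \<in> ?R ^^ n" if "p \<in> chain_step f (d / 2) ^^ n" for p n
    using \<open>0 < d\<close> that by (intro chain_step_mono[of "d / 2" d]) auto
  have ct': "\<exists>n. (x, y) \<in> ?R ^^ n" for x y
    using ct half by blast
  have "\<exists>n. (b, b) \<in> ?R ^^ n \<and> (f b, b) \<in> ?R ^^ n"
  proof (rule connected_equivalence_relation[OF connected_space,
      of b "f b" "\<lambda>x y. \<exists>n. (x, b) \<in> ?R ^^ n \<and> (y, b) \<in> ?R ^^ n"])
    show "\<exists>n. (x, b) \<in> ?R ^^ n \<and> (z, b) \<in> ?R ^^ n"
      if xy: "\<exists>n. (x, b) \<in> ?R ^^ n \<and> (y, b) \<in> ?R ^^ n" and yz: "\<exists>n. (y, b) \<in> ?R ^^ n \<and> (z, b) \<in> ?R ^^ n" for x y z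
    proof -
      obtain n where n: "(x, b) \<in> ?R ^^ n" "(y, b) \<in> ?R ^^ n"
        using xy by blast
      obtain m where m: "(y, b) \<in> ?R ^^ m" "(z, b) \<in> ?R ^^ m"
        using yz by blast
      obtain l where l: "(b, y) \<in> ?R ^^ l"
        using ct' by blast
      have "(x, b) \<in> ?R ^^ (n + (l + m))"
        using n(1) l m(1) by (intro relpow_trans)
      moreover have "(z, b) \<in> ?R ^^ (m + (l + n))"
        using m(2) l n(2) by (intro relpow_trans)
      moreover have "m + (l + n) = n + (l + m)"
        by simp
      ultimately show ?thesis
        by metis
    qed
    show "\<exists>T. openin (top_of_set UNIV) T \<and> x \<in> T \<and> (\<forall>y\<in>T. \<exists>n. (x, b) \<in> ?R ^^ n \<and> (y, b) \<in> ?R ^^ n)" for x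
    proof -
      \<comment> \<open>The detour over a point other than \<open>x\<close> forces a chain of
        positive length, whose first step has slack \<open>d / 2\<close>. Starting points near
        \<open>x\<close> can therefore join it with that step.\<close>
      obtain c :: 'a where "c \<noteq> x"
        using two_points by metis
      obtain k l where kl: "(x, c) \<in> chain_step f (d / 2) ^^ k" "(c, b) \<in> chain_step f (d / 2) ^^ l"
        using ct by meson
      have "k \<noteq> 0"
        using kl(1) \<open>c \<noteq> x\<close> by (intro notI) simp
      then obtain m where m: "k + l = Suc m"
        by (metis add_is_0 not0_implies_Suc)
      have "(x, b) \<in> chain_step f (d / 2) ^^ Suc m"
        using relpow_trans[OF kl] unfolding m .
      then obtain y1 where y1: "(x, y1) \<in> chain_step f (d / 2)" "(y1, b) \<in> chain_step f (d / 2) ^^ m"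
        by (rule relpow_Suc_E2)
      define T where "T = f -` ball (f x) (d / 2)"
      have "open T"
        unfolding T_def using f by (intro open_vimage) auto
      have "(y, b) \<in> ?R ^^ Suc m" if "y \<in> T" for y
      proof -
        have "dist (f x) (f y) < d / 2" "dist (f x) y1 < d / 2"
          using that y1(1) by (auto simp: T_def chain_step_def)
        then have "dist (f y) y1 < d"
          using dist_triangle3[of "f y" y1 "f x"] by linarith
        then have "(y, y1) \<in> ?R"
          by (simp add: chain_step_def)
        then show ?thesis
          using half[OF y1(2)] by (rule relpow_Suc_I2)
      qed
      note main = this
      have "x \<in> T"
        using \<open>0 < d\<close> by (simp add: T_def)
      show ?thesis
      proof (rule exI[of _ T], intro conjI ballI)
        show "\<exists>n. (x, b) \<in> ?R ^^ n \<and> (y, b) \<in> ?R ^^ n" if "y \<in> T" for y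
          using main[OF \<open>x \<in> T\<close>] main[OF that] by blast
      qed (use \<open>open T\<close> \<open>x \<in> T\<close> in simp_all)
    qed
  qed auto
  then obtain n where n: "(b, b) \<in> ?R ^^ n" "(f b, b) \<in> ?R ^^ n"
    by blast
  have "(b, f b) \<in> ?R"
    using \<open>0 < d\<close> by (simp add: chain_step_def)
  then have n': "(b, b) \<in> ?R ^^ Suc n"
    using n(2) by (rule relpow_Suc_I2)
  \<comment> \<open>With loops of lengths \<open>n\<close> and \<open>n + 1\<close>, every
    \<open>k = q * n + s\<close> with \<open>s < n \<le> q\<close> is
    \<open>(q - s) * n + s * (n + 1)\<close>; hence the bound \<open>n * n\<close>.\<close>
  have loops: "(b, b) \<in> ?R ^^ k" if "n * n \<le> k" for k
  proof (cases "n = 0")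
    case True
    then show ?thesis
      using relpow_loop[OF n', of k] by simp
  next
    case False
    define q s where "q = k div n" and "s = k mod n"
    have qs: "k = q * n + s" "s < n" "n \<le> q"
      using False that by (auto simp: q_def s_def less_eq_div_iff_mult_less_eq)
    have "(b, b) \<in> ?R ^^ ((q - s) * n + s * Suc n)"
      by (intro relpow_trans[of _ b] relpow_loop n(1) n')
    moreover have "(q - s) * n + s * Suc n = k"
    proof -
      have "(q - s) * n + s * n = q * n"
        using qs(2,3) by (simp add: add_mult_distrib[symmetric])
      then show ?thesis
        using qs(1) by simp
    qed
    ultimately show ?thesis
      by metis
  qed
  obtain l where l: "(a, b) \<in> ?R ^^ l"
    using ct' by blast
  have "(a, b) \<in> ?R ^^ k" if "l + n * n \<le> k" for k
  proof -
    have "(a, b) \<in> ?R ^^ (l + (k - l))"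
      using that by (intro relpow_trans[OF l] loops) simp
    then show ?thesis
      using that by simp
  qed
  then show ?thesis
    by blast
qed

end

subsection \<open>Exact maps with dense periodic points\<close>

text \<open>All points of the orbit but the last have to lie in \<open>F\<close>. A later map that
  agrees with \<open>h\<close> on \<open>F\<close> has the same orbits up to time \<open>n\<close>,
  so the covering is inherited.\<close>

definition covers_in :: "('a \<Rightarrow> 'a) \<Rightarrow> 'a set \<Rightarrow> 'a set \<Rightarrow> nat \<Rightarrow> bool" where
  "covers_in h F B n \<longleftrightarrow> (\<forall>y. \<exists>q\<in>B. (\<forall>i<n. (h ^^ i) q \<in> F) \<and> (h ^^ n) q = y)"

definition exact_at :: "('a::metric_space \<Rightarrow> 'a) \<Rightarrow> 'a set \<Rightarrow> real \<Rightarrow> bool" where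
  "exact_at h F r \<longleftrightarrow> (\<forall>x. \<exists>n\<ge>1. covers_in h F (ball x r) n)"

lemma funpow_agree:
  assumes "\<forall>x\<in>F. h' x = h x" "\<forall>i<n. (h ^^ i) q \<in> F" "i \<le> n"
  shows "(h' ^^ i) q = (h ^^ i) q"
  using assms(3)
proof (induction i)
  case (Suc i)
  then show ?case
    using assms(1,2) by simp
qed simp

lemma covers_in_mono:
  assumes "covers_in h F B n" "\<forall>x\<in>F. h' x = h x" "F \<subseteq> F'" "B \<subseteq> B'"
  shows "covers_in h' F' B' n"
  unfolding covers_in_def
proof
  fix y
  obtain q where q: "q \<in> B" "\<forall>i<n. (h ^^ i) q \<in> F" "(h ^^ n) q = y"
    using assms(1) unfolding covers_in_def by blast
  have "(h' ^^ i) q = (h ^^ i) q" if "i \<le> n" for i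
    using funpow_agree[OF assms(2) q(2) that] .
  then show "\<exists>q\<in>B'. (\<forall>i<n. (h' ^^ i) q \<in> F') \<and> (h' ^^ n) q = y"
    using q assms(3,4) by (intro bexI[of _ q]) auto
qed

lemma covers_in_image:
  assumes "covers_in h F B n"
  shows "(h ^^ n) ` B = UNIV"
proof (intro UNIV_eq_I[symmetric])
  fix y
  obtain q where "q \<in> B" "(h ^^ n) q = y"
    using assms unfolding covers_in_def by metis
  then show "y \<in> (h ^^ n) ` B"
    by (metis imageI)
qed

lemma exact_at_mono: "exact_at h F r \<Longrightarrow> r \<le> r' \<Longrightarrow> exact_at h F r'"
  unfolding exact_at_def using covers_in_mono[OF _ _ order_refl subset_ball] by metis

lemma covers_in_Suc:
  assumes "covers_in h F S n" "S \<subseteq> h ` (F \<inter> B)"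
  shows "covers_in h F B (Suc n)"
  unfolding covers_in_def
proof
  fix y
  obtain q where q: "q \<in> S" "\<forall>i<n. (h ^^ i) q \<in> F" "(h ^^ n) q = y"
    using assms(1) unfolding covers_in_def by blast
  then obtain w where w: "w \<in> F" "w \<in> B" "q = h w"
    using assms(2) by blast
  have shift: "(h ^^ Suc i) w = (h ^^ i) q" for i
    using w(3) by (simp add: funpow_swap1)
  have "(h ^^ i) w \<in> F" if "i < Suc n" for i
  proof (cases i)
    case 0
    then show ?thesis
      using w(1) by simp
  next
    case (Suc j)
    then show ?thesis
      using q(2) that shift[of j] by simp
  qed
  then show "\<exists>q\<in>B. (\<forall>i<Suc n. (h ^^ i) q \<in> F) \<and> (h ^^ Suc n) q = y"
    using w(2) q(3) shift[of n] by blast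
qed

lemma lc_on_subset: "lc_on S h \<Longrightarrow> S' \<subseteq> S \<Longrightarrow> lc_on S' h"
  unfolding lc_on_def by blast

definition exact_stage :: "('a::metric_space \<Rightarrow> 'a) \<Rightarrow> 'a set \<Rightarrow> real \<Rightarrow> bool" where
  "exact_stage h F r \<longleftrightarrow> continuous_on UNIV h \<and> closed F \<and> interior F = {} \<and> lc_on (- F) h \<and> exact_at h F r"

definition periodic_at :: "('a::metric_space \<Rightarrow> 'a) \<Rightarrow> 'a set \<Rightarrow> real \<Rightarrow> bool" where
  "periodic_at h F r \<longleftrightarrow> (\<forall>x. \<exists>z\<in>ball x r. \<exists>n\<ge>1. (h ^^ n) z = z \<and> (\<forall>i<n. (h ^^ i) z \<in> F))"

context peano_space
begin

text \<open>The value \<open>q z\<close> is chosen so that the frozen orbit of \<open>q z\<close> leads back to \<open>z\<close>; thus \<open>z\<close> becomes periodic.\<close>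

lemma refine_exact_stage:
  fixes h :: "'a \<Rightarrow> 'a"
  assumes h: "exact_stage h F R" and R: "covering_radius TYPE('a) e R" and "0 < r"
  shows "\<exists>h' F'. exact_stage h' F' r \<and> F \<subseteq> F' \<and> (\<forall>x\<in>F. h' x = h x) \<and> (\<forall>x. dist (h x) (h' x) < e) \<and> periodic_at h' F' r"
proof -
  have hF: "continuous_on UNIV h" "closed F" "interior F = {}" "lc_on (- F) h" "exact_at h F R"
    using h by (auto simp: exact_stage_def)
  have "\<exists>q n. dist (h z) q < R \<and> (\<forall>i<n. (h ^^ i) q \<in> F) \<and> (h ^^ n) q = z" for z
  proof -
    obtain n where "covers_in h F (ball (h z) R) n"
      using hF(5) unfolding exact_at_def by blast
    then have "\<exists>q\<in>ball (h z) R. (\<forall>i<n. (h ^^ i) q \<in> F) \<and> (h ^^ n) q = z"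
      unfolding covers_in_def by (rule spec)
    then show ?thesis
      by (metis mem_ball)
  qed
  then obtain q n where q: "\<And>z. dist (h z) (q z) < R" "\<And>z. \<forall>i<n z. (h ^^ i) (q z) \<in> F"
    "\<And>z. (h ^^ n z) (q z) = z"
    by metis
  obtain h' G where h': "continuous_on UNIV h'" "lc_on (- F) h'" "closed G" "interior G = {}" "\<forall>x\<in>F. h' x = h x"
    "\<forall>x. dist (h x) (h' x) < e"
    "\<forall>x. \<not> ball x (r / 2) \<subseteq> F \<longrightarrow> (\<exists>z\<in>G \<inter> ball x r. h' z = q z \<and> ball (h z) R \<subseteq> h' ` (G \<inter> ball x r))"
    using make_covering[OF hF(1,2,4) R \<open>0 < r\<close> q(1)] by blast
  define F' where "F' = F \<union> G"
  have "\<exists>z\<in>G \<inter> ball x r. h' z = q z \<and> ball (h z) R \<subseteq> h' ` (F' \<inter> ball x r)" for x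
  proof -
    have "\<not> ball x (r / 2) \<subseteq> F"
      using hF(3) \<open>0 < r\<close> by (metis half_gt_zero interior_maximal open_ball subset_empty ball_eq_empty linorder_not_le)
    then obtain z where "z \<in> G \<inter> ball x r" "h' z = q z" "ball (h z) R \<subseteq> h' ` (G \<inter> ball x r)"
      using h'(7) by blast
    then show ?thesis
      unfolding F'_def by blast
  qed
  note z = this
  have "exact_at h' F' r"
    unfolding exact_at_def
  proof
    fix x
    obtain z where z: "ball (h z) R \<subseteq> h' ` (F' \<inter> ball x r)"
      using z[of x] by blast
    obtain n where "covers_in h F (ball (h z) R) n"
      using hF(5) unfolding exact_at_def by blast
    then have "covers_in h' F' (ball (h z) R) n"
      by (rule covers_in_mono) (use h'(5) in \<open>auto simp: F'_def\<close>)
    then have "covers_in h' F' (ball x r) (Suc n)"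
      using z by (rule covers_in_Suc)
    then show "\<exists>n\<ge>1. covers_in h' F' (ball x r) n"
      by (intro exI[of _ "Suc n"]) simp
  qed
  moreover have "periodic_at h' F' r"
    unfolding periodic_at_def
  proof
    fix x
    obtain z where z: "z \<in> G \<inter> ball x r" "h' z = q z"
      using z[of x] by blast
    have shift: "(h' ^^ Suc i) z = (h ^^ i) (q z)" if "i \<le> n z" for i
    proof -
      have "(h' ^^ Suc i) z = (h' ^^ i) (q z)"
        using z(2) by (simp add: funpow_swap1)
      also have "\<dots> = (h ^^ i) (q z)"
        by (rule funpow_agree[OF h'(5) q(2) that])
      finally show ?thesis .
    qed
    have "(h' ^^ i) z \<in> F'" if "i < Suc (n z)" for i
    proof (cases i)
      case 0
      then show ?thesis
        using z(1) by (simp add: F'_def)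
    next
      case (Suc j)
      then show ?thesis
        using that shift[of j] q(2)[of z] unfolding F'_def by auto
    qed
    moreover have "(h' ^^ Suc (n z)) z = z"
      by (rule trans[OF shift[OF order_refl] q(3)])
    ultimately show "\<exists>z\<in>ball x r. \<exists>n\<ge>1. (h' ^^ n) z = z \<and> (\<forall>i<n. (h' ^^ i) z \<in> F')"
      using z(1) by (intro bexI[of _ z] exI[of _ "Suc (n z)"]) auto
  qed
  moreover have "closed F'" "interior F' = {}" "lc_on (- F') h'"
    using hF h' by (auto simp: F'_def interior_closed_Un_empty_interior intro: lc_on_subset)
  ultimately show ?thesis
    using h'(1,5,6) unfolding exact_stage_def F'_def by blast
qed

text \<open>Refinement is iterated with amplitudes that sum to \<open>e\<close>. The limit agrees
  with stage \<open>n\<close> on the set frozen there, so the covering orbits and the periodic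
  orbits of every stage survive. The scale \<open>r\<close> depends on \<open>e\<close> alone, since
  a starting stage has to be constructed for it afterwards.\<close>

lemma exact_devaney_near_stage:
  assumes "0 < e"
  shows "\<exists>r>0. \<forall>(h :: 'a \<Rightarrow> 'a) F. exact_stage h F r \<longrightarrow>
    (\<exists>g. continuous_on UNIV g \<and> exact_devaney_chaotic g \<and> (\<forall>x. dist (h x) (g x) \<le> e))"
proof -
  define E where "E n = (e / 2) / 2 ^ n" for n :: nat
  have "\<exists>R. \<forall>n. covering_radius TYPE('a) (E n) (R n)"
    using assms by (intro choice allI covering_radius_exists) (simp add: E_def)
  then obtain R where R: "\<And>n. covering_radius TYPE('a) (E n) (R n)"
    by blast
  \<comment> \<open>The first bound lets stage \<open>n\<close> be refined with amplitude
    \<open>E n\<close>; the second makes the scales tend to 0.\<close>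
  define \<rho> where "\<rho> n = min (R n) (1 / Suc n)" for n
  have \<rho>: "0 < \<rho> n" "\<rho> n \<le> R n" "\<rho> n \<le> 1 / Suc n" for n
    using R[of n] by (auto simp: \<rho>_def covering_radius_def)
  have fine: "\<exists>n. \<rho> (Suc n) < t \<and> \<rho> n < t" if t: "0 < t" for t
  proof -
    obtain n where n: "1 / Suc n < t"
      using t nat_approx_posE by blast
    have "1 / Suc (Suc n) \<le> 1 / real (Suc n)"
      by (intro divide_left_mono) auto
    then show ?thesis
      using n \<rho>(3)[of n] \<rho>(3)[of "Suc n"] by (intro exI[of _ n]) linarith
  qed
  show ?thesis
  proof (rule exI[of _ "\<rho> 0"], intro conjI allI impI)
    show "0 < \<rho> 0"
      by (rule \<rho>)
    fix h0 :: "'a \<Rightarrow> 'a" and F0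
    assume start: "exact_stage h0 F0 (\<rho> 0)"
    define P where "P n z \<longleftrightarrow> exact_stage (fst z) (snd z) (\<rho> n) \<and> (n = 0 \<longrightarrow> z = (h0, F0))"
      for n and z :: "('a \<Rightarrow> 'a) \<times> 'a set"
    define Q where "Q n z z' \<longleftrightarrow> snd z \<subseteq> snd z' \<and> (\<forall>x\<in>snd z. fst z' x = fst z x) \<and>
      (\<forall>x. dist (fst z x) (fst z' x) < E n) \<and> periodic_at (fst z') (snd z') (\<rho> (Suc n))"
      for n and z z' :: "('a \<Rightarrow> 'a) \<times> 'a set"
    have "\<exists>s. \<forall>n. P n (s n) \<and> Q n (s n) (s (Suc n))"
    proof (rule dependent_nat_choice)
      show "\<exists>z. P 0 z"
        using start by (intro exI[of _ "(h0, F0)"]) (simp add: P_def)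
      fix z n
      assume "P n z"
      then have "exact_stage (fst z) (snd z) (R n)"
        using \<rho>(2)[of n] unfolding P_def exact_stage_def by (meson exact_at_mono)
      from refine_exact_stage[OF this R \<rho>(1)[of "Suc n"]]
      obtain h' F' where "exact_stage h' F' (\<rho> (Suc n))" "snd z \<subseteq> F'" "\<forall>x\<in>snd z. h' x = fst z x"
        "\<forall>x. dist (fst z x) (h' x) < E n" "periodic_at h' F' (\<rho> (Suc n))"
        by blast
      then show "\<exists>z'. P (Suc n) z' \<and> Q n z z'"
        unfolding P_def Q_def by (intro exI[of _ "(h', F')"]) simp
    qed
    then obtain s where s: "\<And>n. P n (s n)" "\<And>n. Q n (s n) (s (Suc n))"
      by blast
    define h F where "h n = fst (s n)" and "F n = snd (s n)" for n
    have stage: "exact_stage (h n) (F n) (\<rho> n)" for n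
      using s(1)[of n] by (simp add: P_def h_def F_def)
    have next_: "F n \<subseteq> F (Suc n)" "periodic_at (h (Suc n)) (F (Suc n)) (\<rho> (Suc n))" for n
      using s(2)[of n] by (auto simp: Q_def h_def F_def)
    have next2: "h (Suc n) x = h n x" if "x \<in> F n" for x n
      using s(2)[of n] that by (auto simp: Q_def h_def F_def)
    have next3: "dist (h n x) (h (Suc n) x) < E n" for n x
      using s(2)[of n] by (auto simp: Q_def h_def F_def)
    have "h 0 = h0"
      using s(1)[of 0] by (simp add: P_def h_def)
    have "\<exists>l. \<forall>n. dist (h n x) l \<le> 2 * (e / 2) / 2 ^ n" for x
      using next3[of _ x] by (intro geometric_limit) (simp add: E_def less_imp_le)
    then obtain g where g: "\<And>n x. dist (h n x) (g x) \<le> 2 * (e / 2) / 2 ^ n"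
      by metis
    have near: "\<exists>N. \<forall>n\<ge>N. \<forall>x. dist (h n x) (g x) < t" if t: "0 < t" for t
    proof -
      obtain N where "\<forall>n\<ge>N. 2 * (e / 2) / 2 ^ n < t"
        using power_half_small[OF t] by blast
      then show ?thesis
        using g by (meson le_less_trans)
    qed
    have cont: "continuous_on UNIV g"
    proof (rule uniform_limit_theorem)
      show "\<forall>\<^sub>F n in sequentially. continuous_on UNIV (h n)"
        using stage by (simp add: exact_stage_def)
      show "uniform_limit UNIV h g sequentially"
        unfolding uniform_limit_sequentially_iff using near by blast
    qed simp
    have frozen: "F n \<subseteq> F (n + k) \<and> (\<forall>x\<in>F n. h (n + k) x = h n x)" for n k
    proof (induction k)
      case (Suc k)
      then show ?case
        using next_(1)[of "n + k"] next2[of _ "n + k"] by (metis add_Suc_right subsetD subset_trans)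
    qed simp
    have agree: "\<forall>x\<in>F n. g x = h n x" for n
    proof
      fix x
      assume x: "x \<in> F n"
      show "g x = h n x"
      proof (rule ccontr)
        assume "g x \<noteq> h n x"
        then have "0 < dist (h n x) (g x)"
          by auto
        then obtain N where "\<forall>k\<ge>N. \<forall>y. dist (h k y) (g y) < dist (h n x) (g x)"
          using near by blast
        then have "dist (h (n + N) x) (g x) < dist (h n x) (g x)"
          by simp
        then show False
          using frozen[of n N] x by simp
      qed
    qed
    have exact: "exact_map g"
      unfolding exact_map_def
    proof (intro allI impI, elim conjE)
      fix U :: "'a set"
      assume U: "open U" "U \<noteq> {}"
      then obtain x t where t: "0 < t" "ball x t \<subseteq> U"
        by (meson ex_in_conv openE)
      obtain n where "\<rho> n < t"
        using fine[OF t(1)] by blast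
      obtain k where k: "1 \<le> k" "covers_in (h n) (F n) (ball x (\<rho> n)) k"
        using stage[of n] unfolding exact_stage_def exact_at_def by blast
      have "covers_in g (F n) U k"
        by (rule covers_in_mono[OF k(2) agree]) (use t(2) \<open>\<rho> n < t\<close> in auto)
      then have "(g ^^ k) ` U = UNIV"
        by (rule covers_in_image)
      then show "\<exists>k\<ge>1. (g ^^ k) ` U = UNIV"
        using k(1) by blast
    qed
    then have "transitive_map g"
      unfolding exact_map_def transitive_map_def by (metis Int_UNIV_left)
    moreover have "closure (periodic_points g) = UNIV"
    proof -
      have "\<exists>z\<in>periodic_points g. dist z x < t" if t: "0 < t" for x t
      proof -
        obtain n where n: "\<rho> (Suc n) < t"
          using fine[OF t] by blast
        obtain z k where z: "z \<in> ball x (\<rho> (Suc n))" "1 \<le> k" "(h (Suc n) ^^ k) z = z"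
          "\<forall>i<k. (h (Suc n) ^^ i) z \<in> F (Suc n)"
          using next_(2)[of n] unfolding periodic_at_def by blast
        have "(g ^^ k) z = z"
          using funpow_agree[OF agree z(4) order_refl] z(3) by simp
        then have "z \<in> periodic_points g"
          using z(2) unfolding periodic_points_def by blast
        then show ?thesis
          using z(1) n by (intro bexI[of _ z]) (auto simp: dist_commute)
      qed
      then show ?thesis
        by (auto simp: closure_approachable)
    qed
    ultimately have "exact_devaney_chaotic g"
      using exact by (simp add: exact_devaney_chaotic_def devaney_chaotic_def)
    moreover have "dist (h0 x) (g x) \<le> e" for x
      using g[of 0 x] \<open>h 0 = h0\<close> by simp
    ultimately show "\<exists>g. continuous_on UNIV g \<and> exact_devaney_chaotic g \<and> (\<forall>x. dist (h0 x) (g x) \<le> e)"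
      using cont by blast
  qed
qed

end

section \<open>Exact Devaney chaotic maps near chain transitive maps\<close>

text \<open>The three alternatives of the theorem enter the dynamical part only through this
  approximation property.\<close>

locale lc_dense_space = peano_space type_of_points for type_of_points :: "'a::metric_space itself" +
  assumes lc_dense: "\<And>(f :: 'a \<Rightarrow> 'a) e. continuous_on UNIV f \<Longrightarrow> 0 < e \<Longrightarrow>
    \<exists>h. continuous_on UNIV h \<and> lc_on UNIV h \<and> (\<forall>x. dist (f x) (h x) < e)"
begin

lemma uniform_modulus:
  fixes f :: "'a \<Rightarrow> 'b::metric_space"
  assumes "continuous_on UNIV f" "0 < e"
  shows "\<exists>d>0. \<forall>x y. dist x y < d \<longrightarrow> dist (f x) (f y) < e"
  using compact_uniformly_continuous[OF assms(1) compact_space] assms(2)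
  unfolding uniformly_continuous_on_def by (metis UNIV_I dist_commute)

text \<open>Once each ball of radius \<open>r\<close> contains frozen points covering a ball of
  radius \<open>R\<close> near its image, every step of an \<open>R / 4\<close>-chain of
  \<open>f\<close> can be followed by frozen points. Chain mixing provides chains of one common
  length from \<open>x\<close> to a whole finite net, so the ball at \<open>x\<close> covers
  everything at that time.\<close>

lemma exact_stage_near:
  fixes f :: "'a \<Rightarrow> 'a"
  assumes f: "continuous_on UNIV f" and R: "covering_radius TYPE('a) e R" and "0 < r0"
    and ct: "\<And>a b. \<exists>n. (a, b) \<in> chain_step f (R / 8) ^^ n"
  shows "\<exists>h F. exact_stage h F r0 \<and> (\<forall>x. dist (f x) (h x) < R / 8 + e)"
proof -
  have "0 < R"
    using R by (simp add: covering_radius_def)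
  then obtain \<delta> where \<delta>: "0 < \<delta>" "\<And>x y. dist x y < \<delta> \<Longrightarrow> dist (f x) (f y) < R / 8"
    using uniform_modulus[OF f, of "R / 8"] by auto
  \<comment> \<open>The errors in \<open>cover1\<close> are then \<open>R / 8\<close> three times
    and \<open>R / 4\<close> once, less than \<open>R\<close> in total.\<close>
  define r where "r = min r0 (min \<delta> (R / 8))"
  have r: "0 < r" "r \<le> r0" "r \<le> \<delta>" "r \<le> R / 8"
    using \<open>0 < R\<close> \<open>0 < r0\<close> \<delta>(1) by (auto simp: r_def)
  obtain h where h: "continuous_on UNIV h" "lc_on UNIV h" "\<And>x. dist (f x) (h x) < R / 8"
    using lc_dense[OF f, of "R / 8"] \<open>0 < R\<close> by auto
  \<comment> \<open>No periodic points are planted yet, so the prescribed value \<open>q\<close> is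
    just \<open>h\<close>.\<close>
  obtain g F where g: "continuous_on UNIV g" "lc_on UNIV g" "closed F" "interior F = {}"
    "\<forall>x. dist (h x) (g x) < e"
    "\<And>x. \<exists>z\<in>F \<inter> ball x r. g z = h z \<and> ball (h z) R \<subseteq> g ` (F \<inter> ball x r)"
    using make_covering[OF h(1), of "{}" e R r h] h(2) R \<open>0 < R\<close> r(1) by auto
  have cover1: "ball y r \<subseteq> g ` (F \<inter> ball x r)" if "(x, y) \<in> chain_step f (R / 4)" for x y
  proof -
    obtain z where z: "z \<in> ball x r" "ball (h z) R \<subseteq> g ` (F \<inter> ball x r)"
      using g(6)[of x] by blast
    have "ball y r \<subseteq> ball (h z) R"
    proof
      fix v
      assume "v \<in> ball y r"
      then have "dist y v < R / 8"
        using r(4) by simp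
      moreover have "dist (f x) y < R / 4"
        using that by (simp add: chain_step_def)
      moreover have "dist (f x) (f z) < R / 8"
        using z(1) r(3) by (intro \<delta>(2)) simp
      moreover have "dist (f z) (h z) < R / 8"
        by (rule h(3))
      moreover have "dist (h z) v \<le> dist (f z) (h z) + dist (f x) (f z) + dist (f x) y + dist y v"
        using dist_triangle[of "h z" v "f z"] dist_triangle[of "f z" v "f x"] dist_triangle[of "f x" v y]
        by (simp add: dist_commute)
      ultimately show "v \<in> ball (h z) R"
        using \<open>0 < R\<close> by simp
    qed
    then show ?thesis
      using z(2) by blast
  qed
  have cover: "\<exists>q\<in>ball x r. (\<forall>i<n. (g ^^ i) q \<in> F) \<and> (g ^^ n) q = v"
    if "(x, y) \<in> chain_step f (R / 4) ^^ n" "v \<in> ball y r" for x y v n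
    using that(1)
  proof (induction n arbitrary: x)
    case 0
    then show ?case
      using that(2) by auto
  next
    case (Suc n)
    then obtain w where w: "(x, w) \<in> chain_step f (R / 4)" "(w, y) \<in> chain_step f (R / 4) ^^ n"
      by (meson relpow_Suc_E2)
    obtain q where q: "q \<in> ball w r" "\<forall>i<n. (g ^^ i) q \<in> F" "(g ^^ n) q = v"
      using Suc.IH[OF w(2)] by blast
    then obtain u where u: "u \<in> F" "u \<in> ball x r" "q = g u"
      using cover1[OF w(1)] by blast
    have shift: "(g ^^ Suc i) u = (g ^^ i) q" for i
      using u(3) by (simp add: funpow_swap1)
    have "(g ^^ i) u \<in> F" if "i < Suc n" for i
    proof (cases i)
      case 0
      then show ?thesis
        using u(1) by simp
    next
      case (Suc j)
      then show ?thesis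
        using q(2) that shift[of j] by simp
    qed
    then show ?case
      using u(2) q(3) shift[of n] by blast
  qed
  have "exact_at g F r"
    unfolding exact_at_def
  proof
    fix x
    obtain Y :: "'a set" where Y: "finite Y" "UNIV \<subseteq> (\<Union>y\<in>Y. ball y r)"
      using finite_net[OF r(1), of UNIV] by auto
    have "\<exists>N. \<forall>n\<ge>N. (x, y) \<in> chain_step f (R / 4) ^^ n" for y
      using \<open>0 < R\<close> ct by (intro chain_mixing[OF f]) auto
    then obtain N where N: "\<And>y n. N y \<le> n \<Longrightarrow> (x, y) \<in> chain_step f (R / 4) ^^ n"
      by metis
    define n where "n = Suc (\<Sum>y\<in>Y. N y)"
    have "covers_in g F (ball x r) n"
      unfolding covers_in_def
    proof
      fix v
      obtain y where y: "y \<in> Y" "v \<in> ball y r"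
        using Y(2) by blast
      have "N y \<le> n"
        unfolding n_def using member_le_sum[of y Y N] Y(1) y(1) by simp
      then show "\<exists>q\<in>ball x r. (\<forall>i<n. (g ^^ i) q \<in> F) \<and> (g ^^ n) q = v"
        using cover[OF N y(2)] by blast
    qed
    then show "\<exists>n\<ge>1. covers_in g F (ball x r) n"
      by (intro exI[of _ n]) (simp add: n_def)
  qed
  then have "exact_stage g F r0"
    using g r(2) unfolding exact_stage_def by (meson exact_at_mono lc_on_subset subset_UNIV)
  moreover have "dist (f x) (g x) < R / 8 + e" for x
    using h(3)[of x] g(5) dist_triangle[of "f x" "g x" "h x"] by (meson add_strict_mono le_less_trans)
  ultimately show ?thesis
    by blast
qed

text \<open>Chain transitivity is only asked for at one scale \<open>d\<close>, which is independent
  of \<open>f\<close>. In \<open>robust_mixing\<close> the lemma is applied to a map whose chains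
  are known at that scale only.\<close>

lemma exact_devaney_near:
  assumes "0 < e"
  shows "\<exists>d>0. \<forall>f :: 'a \<Rightarrow> 'a. continuous_on UNIV f \<and> (\<forall>a b. \<exists>n. (a, b) \<in> chain_step f d ^^ n) \<longrightarrow>
    (\<exists>g. continuous_on UNIV g \<and> exact_devaney_chaotic g \<and> (\<forall>x. dist (f x) (g x) < e))"
proof -
  have "0 < e / 4"
    using assms by simp
  then obtain R where R: "covering_radius TYPE('a) (e / 4) R"
    using covering_radius_exists by blast
  obtain r where r: "0 < r" "\<forall>(h :: 'a \<Rightarrow> 'a) F. exact_stage h F r \<longrightarrow>
    (\<exists>g. continuous_on UNIV g \<and> exact_devaney_chaotic g \<and> (\<forall>x. dist (h x) (g x) \<le> e / 4))"
    using exact_devaney_near_stage[OF \<open>0 < e / 4\<close>] by blast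
  have R': "0 < R" "R \<le> e / 4"
    using R by (auto simp: covering_radius_def)
  have "\<exists>g. continuous_on UNIV g \<and> exact_devaney_chaotic g \<and> (\<forall>x. dist (f x) (g x) < e)"
    if f: "continuous_on UNIV f" and ct: "\<And>a b. \<exists>n. (a, b) \<in> chain_step f (R / 8) ^^ n" for f :: "'a \<Rightarrow> 'a"
  proof -
    obtain h F where h: "exact_stage h F r" "\<And>x. dist (f x) (h x) < R / 8 + e / 4"
      using exact_stage_near[OF f R r(1) ct] by blast
    obtain g where g: "continuous_on UNIV g" "exact_devaney_chaotic g" "\<And>x. dist (h x) (g x) \<le> e / 4"
      using r(2) h(1) by blast
    have "dist (f x) (g x) < e" for x
      using h(2)[of x] g(3)[of x] R' assms dist_triangle[of "f x" "g x" "h x"] by linarith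
    then show ?thesis
      using g by blast
  qed
  note main = this
  show ?thesis
  proof (rule exI[of _ "R / 8"], intro conjI allI impI, goal_cases)
    case 1
    then show ?case
      using R'(1) by simp
  next
    case (2 f)
    then show ?case
      by (intro main) blast+
  qed
qed

end

subsection \<open>Robust crossings and shadowing\<close>

text \<open>The conditions concern entire level sets of \<open>\<psi> j\<close>. Any path along
  which \<open>\<psi> j\<close> sweeps through [1/4, 3/4] meets both of them, so along its image
  \<open>\<psi> l\<close> goes from at most 1/4 to at least 3/4 or back.\<close>

definition crosses :: "('i \<Rightarrow> 'a \<Rightarrow> real) \<Rightarrow> ('a \<Rightarrow> 'a) \<Rightarrow> 'i \<Rightarrow> 'i \<Rightarrow> bool" where
  "crosses \<psi> f j l \<longleftrightarrow> (\<exists>s\<in>{1/4..3/4}. \<forall>x. \<psi> j x = s \<longrightarrow> \<psi> l (f x) \<le> 1/4) \<and>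
    (\<exists>t\<in>{1/4..3/4}. \<forall>x. \<psi> j x = t \<longrightarrow> 3/4 \<le> \<psi> l (f x))"

lemma crossing_subinterval_aux:
  fixes \<phi> :: "real \<Rightarrow> real"
  assumes \<phi>: "continuous_on {u..v} \<phi>" and "u \<le> v" "\<phi> u \<le> 1/4" "3/4 \<le> \<phi> v"
  shows "\<exists>a b. u \<le> a \<and> a \<le> b \<and> b \<le> v \<and> \<phi> ` {a..b} = {1/4..3/4}"
proof -
  have cl: "compact ({u..v'} \<inter> \<phi> -` C)" if "closed C" "v' \<le> v" for C v'
  proof -
    have "closed ({u..v'} \<inter> \<phi> -` C)"
      using \<phi> that by (intro continuous_closed_preimage) (auto elim: continuous_on_subset)
    then show ?thesis
      by (metis compact_Icc compact_Int_closed inf.left_idem)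
  qed
  have "{u..v} \<inter> \<phi> -` {3/4..} \<noteq> {}"
    using assms by auto
  then obtain b where b: "b \<in> {u..v} \<inter> \<phi> -` {3/4..}" "\<forall>t\<in>{u..v} \<inter> \<phi> -` {3/4..}. b \<le> t"
    using compact_attains_inf[OF cl[of "{3/4..}" v]] by (metis closed_atLeast order_refl)
  have below: "t = b" if "t \<in> {u..b}" "3/4 \<le> \<phi> t" for t
    using b that by (intro antisym) auto
  have \<phi>b: "continuous_on {u..b} \<phi>"
    using \<phi> b(1) by (auto elim: continuous_on_subset)
  have "\<phi> b = 3/4"
  proof -
    obtain t where "u \<le> t" "t \<le> b" "\<phi> t = 3/4"
      using IVT'[of \<phi> u "3/4" b] b(1) assms \<phi>b by auto
    then show ?thesis
      using below[of t] by simp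
  qed
  have "{u..b} \<inter> \<phi> -` {..1/4} \<noteq> {}"
    using assms b(1) by auto
  then obtain a where a: "a \<in> {u..b} \<inter> \<phi> -` {..1/4}" "\<forall>t\<in>{u..b} \<inter> \<phi> -` {..1/4}. t \<le> a"
    using compact_attains_sup[OF cl[of "{..1/4}" b]] b(1) by (metis IntD1 atLeastAtMost_iff closed_atMost)
  have above: "t = a" if "t \<in> {a..b}" "\<phi> t \<le> 1/4" for t
    using a that by (intro antisym) auto
  have \<phi>a: "continuous_on {a..b} \<phi>"
    using \<phi>b a(1) by (auto elim: continuous_on_subset)
  have "\<phi> a = 1/4"
  proof -
    obtain t where "a \<le> t" "t \<le> b" "\<phi> t = 1/4"
      using IVT'[of \<phi> a "1/4" b] a(1) \<open>\<phi> b = 3/4\<close> \<phi>a by auto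
    then show ?thesis
      using above[of t] by simp
  qed
  have "\<phi> ` {a..b} \<subseteq> {1/4..3/4}"
  proof
    fix y
    assume "y \<in> \<phi> ` {a..b}"
    then obtain t where t: "t \<in> {a..b}" "y = \<phi> t"
      by blast
    have "\<phi> t \<le> 3/4"
      using below[of t] t(1) a(1) \<open>\<phi> b = 3/4\<close> by (cases "3/4 \<le> \<phi> t") auto
    moreover have "1/4 \<le> \<phi> t"
      using above[of t] t(1) \<open>\<phi> a = 1/4\<close> by (cases "\<phi> t \<le> 1/4") auto
    ultimately show "y \<in> {1/4..3/4}"
      using t(2) by simp
  qed
  moreover have "{1/4..3/4} \<subseteq> \<phi> ` {a..b}"
  proof
    fix y :: real
    assume "y \<in> {1/4..3/4}"
    then obtain t where "a \<le> t" "t \<le> b" "\<phi> t = y"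
      using IVT'[of \<phi> a y b] a(1) \<open>\<phi> a = 1/4\<close> \<open>\<phi> b = 3/4\<close> \<phi>a by auto
    then show "y \<in> \<phi> ` {a..b}"
      by auto
  qed
  ultimately show ?thesis
    using a(1) b(1) by (intro exI[of _ a] exI[of _ b]) auto
qed

lemma crossing_subinterval:
  fixes \<phi> :: "real \<Rightarrow> real"
  assumes \<phi>: "continuous_on {a..b} \<phi>" and u: "u \<in> {a..b}" "\<phi> u \<le> 1/4" and v: "v \<in> {a..b}" "3/4 \<le> \<phi> v"
  shows "\<exists>a' b'. a \<le> a' \<and> a' \<le> b' \<and> b' \<le> b \<and> \<phi> ` {a'..b'} = {1/4..3/4}"
proof (cases "u \<le> v")
  case True
  have "continuous_on {u..v} \<phi>"
    using \<phi> by (rule continuous_on_subset) (use u(1) v(1) in auto)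
  from crossing_subinterval_aux[OF this True u(2) v(2)] show ?thesis
    using u(1) v(1) by (meson atLeastAtMost_iff order_trans)
next
  case False
  have "continuous_on {- u..- v} (\<lambda>t. \<phi> (- t))"
    by (rule continuous_on_compose2[OF \<phi>]) (use u(1) v(1) in \<open>auto intro!: continuous_intros\<close>)
  from crossing_subinterval_aux[OF this] False u(2) v(2)
  obtain a' b' where ab: "- u \<le> a'" "a' \<le> b'" "b' \<le> - v" "(\<lambda>t. \<phi> (- t)) ` {a'..b'} = {1/4..3/4}"
    by auto
  have "(\<lambda>t. \<phi> (- t)) ` {a'..b'} = \<phi> ` {- b'..- a'}"
    by (metis image_image image_uminus_atLeastAtMost)
  then show ?thesis
    using ab u(1) v(1) by (intro exI[of _ "- b'"] exI[of _ "- a'"]) auto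
qed

text \<open>Nested intervals as for interval maps, except that only the parameter \<open>t\<close>
  of a path is one-dimensional: the induction hypothesis is applied to the path \<open>f\<close>
  after \<open>\<phi>\<close> on a subinterval and to the shifted itinerary.\<close>

lemma crossing_itinerary:
  fixes f :: "'a::topological_space \<Rightarrow> 'a" and a b :: real and k :: "nat \<Rightarrow> 'i"
  assumes f: "continuous_on UNIV f" and \<psi>: "\<And>i. continuous_on UNIV (\<psi> i)"
    and "\<And>i. crosses \<psi> f (k i) (k (Suc i))"
    and "continuous_on {a..b} \<phi>" "a \<le> b" "(\<lambda>t. \<psi> (k 0) (\<phi> t)) ` {a..b} = {1/4..3/4}"
  shows "\<exists>t\<in>{a..b}. \<forall>i\<le>n. \<psi> (k i) ((f ^^ i) (\<phi> t)) \<in> {1/4..3/4}"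
  using assms(3-)
proof (induction n arbitrary: a b \<phi> k)
  case 0
  have "\<psi> (k 0) (\<phi> a) \<in> {1/4..3/4}"
    using 0(3,4) by (metis (no_types, lifting) atLeastAtMost_iff imageI order_refl)
  then show ?case
    using 0(3) by (intro bexI[of _ a]) auto
next
  case (Suc n)
  obtain s where s: "s \<in> {1/4..3/4}" "\<And>x. \<psi> (k 0) x = s \<Longrightarrow> \<psi> (k 1) (f x) \<le> 1/4"
    using Suc.prems(1)[of 0] unfolding crosses_def by auto
  obtain t where t: "t \<in> {1/4..3/4}" "\<And>x. \<psi> (k 0) x = t \<Longrightarrow> 3/4 \<le> \<psi> (k 1) (f x)"
    using Suc.prems(1)[of 0] unfolding crosses_def by auto
  obtain u where u: "u \<in> {a..b}" "\<psi> (k 0) (\<phi> u) = s"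
    using s(1) Suc.prems(4) by (metis (no_types, lifting) imageE)
  obtain v where v: "v \<in> {a..b}" "\<psi> (k 0) (\<phi> v) = t"
    using t(1) Suc.prems(4) by (metis (no_types, lifting) imageE)
  have f\<phi>: "continuous_on {a..b} (\<lambda>t. f (\<phi> t))"
    by (rule continuous_on_compose2[OF f Suc.prems(2)]) simp
  have "continuous_on {a..b} (\<lambda>t. \<psi> (k 1) (f (\<phi> t)))"
    by (rule continuous_on_compose2[OF \<psi> f\<phi>]) simp
  then obtain a' b' where ab: "a \<le> a'" "a' \<le> b'" "b' \<le> b" "(\<lambda>t. \<psi> (k 1) (f (\<phi> t))) ` {a'..b'} = {1/4..3/4}"
    using crossing_subinterval[of a b _ u v] u v s(2) t(2) by blast
  have "\<exists>t\<in>{a'..b'}. \<forall>i\<le>n. \<psi> (k (Suc i)) ((f ^^ i) (f (\<phi> t))) \<in> {1/4..3/4}"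
  proof (rule Suc.IH)
    show "continuous_on {a'..b'} (\<lambda>t. f (\<phi> t))"
      using f\<phi> by (rule continuous_on_subset) (use ab in auto)
  qed (use Suc.prems(1) ab in auto)
  then obtain r where r: "r \<in> {a'..b'}" "\<And>i. i \<le> n \<Longrightarrow> \<psi> (k (Suc i)) ((f ^^ i) (f (\<phi> r))) \<in> {1/4..3/4}"
    by blast
  have r': "r \<in> {a..b}"
    using r(1) ab by auto
  have "\<psi> (k i) ((f ^^ i) (\<phi> r)) \<in> {1/4..3/4}" if "i \<le> Suc n" for i
  proof (cases i)
    case 0
    have "\<psi> (k 0) (\<phi> r) \<in> {1/4..3/4}"
      using r' Suc.prems(4) by blast
    then show ?thesis
      using 0 by simp
  next
    case (Suc j)
    then show ?thesis
      using r(2)[of j] that by (simp add: funpow_swap1)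
  qed
  then show ?case
    using r' by blast
qed

lemma continuous_on_funpow:
  fixes f :: "'a::topological_space \<Rightarrow> 'a"
  assumes "continuous_on UNIV f"
  shows "continuous_on UNIV (f ^^ n)"
proof (induction n)
  case (Suc n)
  then show ?case
    using continuous_on_compose2[OF assms Suc] by (simp add: o_def)
qed (simp add: id_def)

context lc_dense_space
begin

lemma sphere_point:
  assumes "0 \<le> \<rho>" "\<rho> \<le> dist w z"
  shows "\<exists>v :: 'a. dist v z = \<rho>"
proof -
  have "connected (range (\<lambda>v. dist v z))"
    using connected_space by (intro connected_continuous_image continuous_intros)
  moreover have "dist z z \<in> range (\<lambda>v. dist v z)" "dist w z \<in> range (\<lambda>v. dist v z)"
    by blast+
  ultimately have "{dist z z..dist w z} \<subseteq> range (\<lambda>v. dist v z)"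
    by (rule connected_contains_Icc)
  moreover have "\<rho> \<in> {dist z z..dist w z}"
    using assms by simp
  ultimately have "\<rho> \<in> range (\<lambda>v. dist v z)"
    by blast
  then show ?thesis
    by blast
qed

lemma interior_frontier_open_empty:
  assumes "open (S :: 'a set)"
  shows "interior (frontier S) = {}"
proof -
  have "interior (frontier S) \<inter> S = {}"
    using assms interior_subset[of "frontier S"] by (auto simp: frontier_def interior_open)
  then have "interior (frontier S) \<inter> closure S = {}"
    using open_Int_closure_eq_empty[OF open_interior] by blast
  then show ?thesis
    using interior_subset[of "frontier S"] by (auto simp: frontier_def)
qed

text \<open>A path from \<open>u\<close> to \<open>v\<close> realises all finite initial parts of
  the itinerary; a limit of the points found realises all of it, because the lower bounds 1/4 are
  closed conditions.\<close>

lemma shadowing_orbit: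
  fixes f :: "'a \<Rightarrow> 'a"
  assumes f: "continuous_on UNIV f" and \<psi>: "\<And>i. continuous_on UNIV (\<psi> i)"
    and k: "\<And>i. crosses \<psi> f (k i) (k (Suc i))" and ends: "\<psi> (k 0) u \<le> 1/4" "3/4 \<le> \<psi> (k 0) v"
  shows "\<exists>z. \<forall>i. 1/4 \<le> \<psi> (k i) ((f ^^ i) z)"
proof -
  have "path_component UNIV u v"
    by (rule open_connected_path_component) (simp_all add: connected_space)
  then obtain \<phi> where \<phi>: "path \<phi>" "\<phi> 0 = u" "\<phi> 1 = v"
    unfolding path_component_def pathstart_def pathfinish_def by auto
  have \<phi>c: "continuous_on {0..1} \<phi>"
    using \<phi>(1) by (simp add: path_def)
  have "continuous_on {0..1} (\<lambda>t. \<psi> (k 0) (\<phi> t))"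
    by (rule continuous_on_compose2[OF \<psi> \<phi>c]) simp
  then have "\<exists>a b. 0 \<le> a \<and> a \<le> b \<and> b \<le> 1 \<and> (\<lambda>t. \<psi> (k 0) (\<phi> t)) ` {a..b} = {1/4..3/4}"
    by (rule crossing_subinterval[where u = 0 and v = 1]) (use \<phi> ends in simp_all)
  then obtain a b where ab: "0 \<le> a" "a \<le> b" "b \<le> 1" "(\<lambda>t. \<psi> (k 0) (\<phi> t)) ` {a..b} = {1/4..3/4}"
    by blast
  have "continuous_on {a..b} \<phi>"
    using \<phi>c by (rule continuous_on_subset) (use ab in auto)
  then have "\<exists>t\<in>{a..b}. \<forall>i\<le>n. \<psi> (k i) ((f ^^ i) (\<phi> t)) \<in> {1/4..3/4}" for n
    using crossing_itinerary[where f = f and \<psi> = \<psi> and k = k and a = a and b = b and \<phi> = \<phi> and n = n] f \<psi> k ab(2,4)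
    by blast
  then have "\<exists>p. \<forall>i\<le>n. 1/4 \<le> \<psi> (k i) ((f ^^ i) p)" for n
    by (meson atLeastAtMost_iff)
  then obtain p where p: "\<And>n i. i \<le> n \<Longrightarrow> 1/4 \<le> \<psi> (k i) ((f ^^ i) (p n))"
    by metis
  obtain l r where lr: "strict_mono (r :: nat \<Rightarrow> nat)" "(p \<circ> r) \<longlonglongrightarrow> l"
    using compact_space unfolding compact_def by (metis UNIV_I)
  have "1/4 \<le> \<psi> (k i) ((f ^^ i) l)" for i
  proof (rule tendsto_lowerbound)
    have "continuous_on UNIV (\<lambda>x. \<psi> (k i) ((f ^^ i) x))"
      by (rule continuous_on_compose2[OF \<psi> continuous_on_funpow[OF f]]) simp
    then show "(\<lambda>n. \<psi> (k i) ((f ^^ i) ((p \<circ> r) n))) \<longlonglongrightarrow> \<psi> (k i) ((f ^^ i) l)"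
      using lr(2) by (rule continuous_on_tendsto_compose) auto
    show "\<forall>\<^sub>F n in sequentially. 1/4 \<le> \<psi> (k i) ((f ^^ i) ((p \<circ> r) n))"
      unfolding eventually_sequentially
    proof (intro exI[of _ i] allI impI)
      fix n
      assume "i \<le> n"
      then have "i \<le> r n"
        using seq_suble[OF lr(1), of n] by linarith
      then show "1/4 \<le> \<psi> (k i) ((f ^^ i) ((p \<circ> r) n))"
        using p by simp
    qed
  qed simp
  then show ?thesis
    by blast
qed

text \<open>The bumps avoid the frontiers of the cover, so each lies inside or at positive distance from every
  member \<open>W x\<close>; the path of a bump runs through all bumps inside one member of the cover. A pseudo-orbit then
  determines an itinerary, and the next bump is forced only if the pseudo-orbit is inside a bump.\<close>

lemma robust_shadowing:
  fixes f0 :: "'a \<Rightarrow> 'a"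
  assumes f0: "continuous_on UNIV f0" and "0 < \<epsilon>"
  shows "\<exists>g. continuous_on UNIV g \<and> (\<forall>x. dist (f0 x) (g x) < \<epsilon>) \<and> (\<exists>\<eta>>0. \<forall>f. continuous_on UNIV f \<longrightarrow>
    (\<forall>x. dist (g x) (f x) < \<eta>) \<longrightarrow> (\<exists>\<delta>>0. \<forall>x. (\<forall>i :: nat. dist (f (x i)) (x (Suc i)) < \<delta>) \<longrightarrow>
      (\<exists>z. \<forall>i. dist (x i) ((f ^^ i) z) < \<epsilon>)))"
proof -
  have "\<forall>x :: 'a. \<exists>W. open W \<and> connected W \<and> x \<in> W \<and> W \<subseteq> ball x (\<epsilon> / 8)"
    using \<open>0 < \<epsilon>\<close> by (intro allI connected_open_nbhd) auto
  then obtain W where W: "\<And>x :: 'a. open (W x)" "\<And>x :: 'a. connected (W x)" "\<And>x. x \<in> W x"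
    "\<And>x. W x \<subseteq> ball x (\<epsilon> / 8)"
    by metis
  have W_diam: "dist y y' < \<epsilon> / 4" if "y \<in> W x" "y' \<in> W x" for x y y'
  proof -
    have "dist x y < \<epsilon> / 8" "dist x y' < \<epsilon> / 8"
      using W(4)[of x] that by auto
    then show ?thesis
      using dist_triangle3[of y y' x] by linarith
  qed
  obtain X0 where X0: "finite X0" "UNIV \<subseteq> (\<Union>x\<in>X0. W x)"
  proof (rule compactE_image[OF compact_space, of UNIV W])
    show "UNIV \<subseteq> (\<Union>x. W x)"
      using W(3) by blast
  qed (use W(1) in blast)+
  obtain \<mu>0 where \<mu>0: "0 < \<mu>0" "\<And>p. \<exists>x\<in>X0. ball p \<mu>0 \<subseteq> W x"
    using Heine_Borel_lemma[OF compact_space X0(2)] W(1) by (metis (no_types, lifting) UNIV_I imageE)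
  \<comment> \<open>A Lebesgue number of the cover. Later \<open>W (L i)\<close> contains the whole
    ball of radius \<mu> around \<open>h (z i)\<close>, hence also the values of \<open>h\<close> at
    all points within \<open>\<delta>0\<close> of \<open>z i\<close>.\<close>
  define \<mu> where "\<mu> = min \<mu>0 (\<epsilon> / 4)"
  have \<mu>: "0 < \<mu>" "\<mu> \<le> \<epsilon> / 4" "\<exists>x\<in>X0. ball p \<mu> \<subseteq> W x" for p
    using \<mu>0(1) \<mu>0(2)[of p] \<open>0 < \<epsilon>\<close> subset_ball[of \<mu> \<mu>0 p] by (auto simp: \<mu>_def)
  obtain \<delta>1 where \<delta>1: "0 < \<delta>1" "\<And>x y. dist x y < \<delta>1 \<Longrightarrow> dist (f0 x) (f0 y) < \<mu> / 8"
    using uniform_modulus[OF f0, of "\<mu> / 8"] \<mu>(1) by auto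
  define \<delta>0 where "\<delta>0 = min \<delta>1 (\<epsilon> / 4)"
  have \<delta>0: "0 < \<delta>0" "\<delta>0 \<le> \<delta>1" "\<delta>0 \<le> \<epsilon> / 4"
    using \<delta>1(1) \<open>0 < \<epsilon>\<close> by (auto simp: \<delta>0_def)
  obtain h where h: "continuous_on UNIV h" "lc_on UNIV h" "\<And>x. dist (f0 x) (h x) < \<mu> / 8"
    using lc_dense[OF f0, of "\<mu> / 8"] \<mu>(1) by auto
  have "\<forall>x. \<exists>A. finite A \<and> A \<subseteq> W x \<and> W x \<subseteq> (\<Union>a\<in>A. ball a (\<delta>0 / 4))"
    using \<delta>0(1) by (intro allI finite_net) simp
  then obtain A where A: "\<And>x. finite (A x)" "\<And>x. A x \<subseteq> W x" "\<And>x. W x \<subseteq> (\<Union>a\<in>A x. ball a (\<delta>0 / 4))"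
    by metis
  \<comment> \<open>One bump for each pair of a cover member and a net point in it: every point of a
    member then has bumps near it that belong to this very member.\<close>
  define I where "I = Sigma X0 A"
  have finI: "finite I"
    using X0(1) A(1) by (auto simp: I_def)
  define T where "T = (\<Union>x\<in>X0. frontier (W x))"
  have T: "closed T" "interior T = {}"
  proof -
    show "closed T"
      unfolding T_def using X0(1) by (intro closed_UN) auto
    show "interior T = {}"
      unfolding T_def using X0(1) W(1)
      by (intro interior_finite_Union_empty) (auto simp: interior_frontier_open_empty)
  qed
  \<comment> \<open>A neighbourhood of \<open>y\<close> that decides for every member of the cover
    at once: if \<open>y\<close> is off the frontiers, it lies inside the member or is disjoint from
    it.\<close>
  define N where "N y = (\<Inter>x\<in>X0. if y \<in> W x then W x else if y \<notin> closure (W x) then - closure (W x) else UNIV)" for y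
  have N: "open (N y) \<and> y \<in> N y" for y
  proof
    show "open (N y)"
      unfolding N_def using W(1) by (intro open_INT[OF X0(1)]) (simp add: open_Compl)
    show "y \<in> N y"
      unfolding N_def by (rule INT_I) simp
  qed
  define G where "G i = W (fst i) \<inter> ball (snd i) (\<delta>0 / 4)" for i
  have G: "open (G i) \<and> \<not> G i \<subseteq> T" if "i \<in> I" for i
  proof -
    have "snd i \<in> G i"
      using that subsetD[OF A(2)] \<delta>0(1) by (auto simp: I_def G_def)
    moreover have "open (G i)"
      using W(1) by (auto simp: G_def)
    ultimately show ?thesis
      using T(2) by (metis empty_iff interior_maximal subset_empty)
  qed
  obtain D where D: "0 < D" "\<And>z :: 'a. \<exists>w. D \<le> dist w z"
    using far_point by blast
  have "0 < min D \<delta>0"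
    using D(1) \<delta>0(1) by simp
  have "lc_on (- T) h"
    using h(2) by (rule lc_on_subset) simp
  have "\<exists>z \<rho>. 0 < \<rho> \<and> \<rho> \<le> min D \<delta>0 \<and> disjoint_family_on (\<lambda>i. ball (z i) (2 * \<rho>)) I \<and>
    (\<forall>i\<in>I. ball (z i) (2 * \<rho>) \<subseteq> G i - T \<and> ball (z i) (2 * \<rho>) \<subseteq> N (z i) \<and>
      (\<forall>x\<in>ball (z i) (2 * \<rho>). h x = h (z i)))"
    by (rule plateau_points[OF finI T(1) \<open>lc_on (- T) h\<close> G N \<open>0 < min D \<delta>0\<close>])
  then obtain z \<rho> where z\<rho>: "0 < \<rho>" "\<rho> \<le> min D \<delta>0" "disjoint_family_on (\<lambda>i. ball (z i) (2 * \<rho>)) I"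
    "\<forall>i\<in>I. ball (z i) (2 * \<rho>) \<subseteq> G i - T \<and> ball (z i) (2 * \<rho>) \<subseteq> N (z i) \<and>
      (\<forall>x\<in>ball (z i) (2 * \<rho>). h x = h (z i))"
    by (elim exE conjE) (rule that)
  have \<rho>: "\<rho> \<le> D" "\<rho> \<le> \<delta>0"
    using z\<rho>(2) by auto
  define U where "U i = ball (z i) \<rho>" for i
  define \<psi> where "\<psi> i = tent (z i) \<rho>" for i
  have tent: "continuous_on S (\<psi> i)" "\<psi> i x \<in> {0..1}" "x \<notin> U i \<Longrightarrow> \<psi> i x = 0" "\<psi> i (z i) = 1"
    "0 < \<psi> i x \<Longrightarrow> x \<in> U i" "\<bar>\<psi> i x - \<psi> i y\<bar> \<le> dist x y / \<rho>" for S i x y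
    unfolding \<psi>_def U_def using tent[OF z\<rho>(1)] by blast+
  have U2: "U i \<subseteq> ball (z i) (2 * \<rho>)" for i
    unfolding U_def using z\<rho>(1) by (intro subset_ball) simp
  have zU: "z i \<in> U i" "z i \<in> ball (z i) (2 * \<rho>)" for i
    using z\<rho>(1) by (auto simp: U_def)
  have hU: "h x = h (z i)" if "i \<in> I" "x \<in> U i" for i x
    using z\<rho>(4) U2 that by blast
  have zG: "z i \<in> W (fst i)" "dist (snd i) (z i) < \<delta>0 / 4" "z i \<notin> T" if "i \<in> I" for i
  proof -
    have "z i \<in> G i - T"
      using z\<rho>(4) zU(2)[of i] that by blast
    then show "z i \<in> W (fst i)" "dist (snd i) (z i) < \<delta>0 / 4" "z i \<notin> T"
      by (auto simp: G_def)
  qed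
  have disj: "disjoint_family_on U I"
    unfolding disjoint_family_on_def
  proof (intro ballI impI)
    fix i j
    assume "i \<in> I" "j \<in> I" "i \<noteq> j"
    then have "ball (z i) (2 * \<rho>) \<inter> ball (z j) (2 * \<rho>) = {}"
      using z\<rho>(3) unfolding disjoint_family_on_def by blast
    then show "U i \<inter> U j = {}"
      using U2[of i] U2[of j] by blast
  qed
  have inside: "ball (z i) (2 * \<rho>) \<subseteq> W x" if "i \<in> I" "x \<in> X0" "ball (z i) (2 * \<rho>) \<inter> W x \<noteq> {}" for i x
  proof (cases "z i \<in> W x")
    case True
    then have "N (z i) \<subseteq> W x"
      using that(2) by (auto simp: N_def)
    then show ?thesis
      using z\<rho>(4) that(1) by blast
  next
    case False
    have "z i \<notin> frontier (W x)"
      using zG(3)[OF that(1)] that(2) by (auto simp: T_def)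
    then have "z i \<notin> closure (W x)"
      using False W(1) by (simp add: frontier_def interior_open)
    then have "N (z i) \<subseteq> - closure (W x)"
      using that(2) False by (auto simp: N_def)
    then have "ball (z i) (2 * \<rho>) \<inter> W x = {}"
      using z\<rho>(4) that(1) closure_subset[of "W x"] by blast
    then show ?thesis
      using that(3) by blast
  qed
  \<comment> \<open>A point of the bounding sphere has coordinate 0 and still lies in the ball of
    radius \<open>2 * \<rho>\<close>, hence in the same members of the cover as
    \<open>z i\<close>.\<close>
  have "\<exists>w. dist w (z i) = \<rho>" for i
    using D(2)[of "z i"] sphere_point[of \<rho>] z\<rho>(1) \<rho>(1) by (meson less_imp_le order_trans)
  then obtain w where w: "\<And>i. dist (w i) (z i) = \<rho>"
    by metis
  have w': "w i \<in> ball (z i) (2 * \<rho>)" "\<psi> i (w i) = 0" for i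
  proof -
    show "w i \<in> ball (z i) (2 * \<rho>)"
      using w[of i] z\<rho>(1) by (simp add: dist_commute)
    have "w i \<notin> U i"
      using w[of i] by (simp add: U_def dist_commute)
    then show "\<psi> i (w i) = 0"
      by (rule tent(3))
  qed
  obtain L where L: "\<And>i. L i \<in> X0" "\<And>i. ball (h (z i)) \<mu> \<subseteq> W (L i)"
  proof -
    have "\<forall>i. \<exists>x. x \<in> X0 \<and> ball (h (z i)) \<mu> \<subseteq> W x"
      using \<mu>(3) by blast
    then show ?thesis
      using that by metis
  qed
  \<comment> \<open>The admissible successors of \<open>i\<close>. The path of bump \<open>i\<close>
    visits the centre and the sphere point of each of them, where the coordinates are 1 and
    0.\<close>
  define J where "J i = {j \<in> I. z j \<in> W (L i)}" for i
  have "\<exists>\<gamma>. path \<gamma> \<and> pathstart \<gamma> = h (z i) \<and> z ` J i \<union> w ` J i \<subseteq> path_image \<gamma> \<and> path_image \<gamma> \<subseteq> W (L i)" for i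
  proof (rule path_through[OF W(1,2)])
    show "finite (z ` J i \<union> w ` J i)"
      using finI by (simp add: J_def)
    show "h (z i) \<in> W (L i)"
      using L(2) \<mu>(1) by (meson centre_in_ball subsetD)
    show "z ` J i \<union> w ` J i \<subseteq> W (L i)"
    proof -
      have "ball (z j) (2 * \<rho>) \<subseteq> W (L i)" if "j \<in> J i" for j
      proof (rule inside)
        show "j \<in> I" "L i \<in> X0"
          using that L(1) by (simp_all add: J_def)
        show "ball (z j) (2 * \<rho>) \<inter> W (L i) \<noteq> {}"
          using that zU(2)[of j] unfolding J_def by blast
      qed
      then show ?thesis
        using w'(1) zU(2) by blast
    qed
  qed
  then obtain \<gamma> where \<gamma>: "\<And>i. path (\<gamma> i)" "\<And>i. \<gamma> i 0 = h (z i)" "\<And>i. z ` J i \<union> w ` J i \<subseteq> path_image (\<gamma> i)"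
    "\<And>i. path_image (\<gamma> i) \<subseteq> W (L i)"
    unfolding pathstart_def by metis
  \<comment> \<open>Stretches [1/4, 3/4] to [0, 1], so that the levels between 1/4 and 3/4 see the
    whole path \<open>\<gamma> i\<close>.\<close>
  define clamp where "clamp s = max 0 (min 1 (2 * s - 1 / 2))" for s :: real
  have clamp: "clamp s \<in> {0..1}" "clamp 0 = 0" "continuous_on S clamp" for s S
    unfolding clamp_def by (auto intro!: continuous_intros)
  define \<Gamma> where "\<Gamma> i s = \<gamma> i (clamp s)" for i s
  define g where "g = bump I U \<psi> \<Gamma> h"
  have g_in: "g x = \<gamma> i (clamp (\<psi> i x))" if "i \<in> I" "x \<in> U i" for i x
    unfolding g_def bump_inside[OF disj that] \<Gamma>_def ..
  have g_out: "g x = h x" if "x \<notin> (\<Union>i\<in>I. U i)" for x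
    unfolding g_def using that by (rule bump_outside)
  have cont: "continuous_on UNIV g"
    unfolding g_def
  proof (rule bump_continuous[where p = "\<lambda>i. h (z i)", OF finI disj _ h(1)])
    show "open (U i)" for i
      by (simp add: U_def)
    show "path (\<Gamma> i)" for i
      unfolding path_def \<Gamma>_def
      by (rule continuous_on_compose2[OF \<gamma>(1)[unfolded path_def, of i] clamp(3)]) (use clamp(1) in blast)
    show "\<Gamma> i 0 = h (z i)" for i
      using clamp(2) \<gamma>(2) by (simp add: \<Gamma>_def)
    show "h x = h (z i)" if "i \<in> I" "x \<in> U i" for i x
      using that by (rule hU)
    show "continuous_on UNIV (\<psi> i)" "\<psi> i x \<in> {0..1}" for i x
      by (rule tent)+
    show "\<psi> i x = 0" if "x \<notin> U i" for i x
      using that by (rule tent)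
  qed
  have gW: "g x \<in> W (L i)" if "i \<in> I" "x \<in> U i" for i x
  proof -
    have "g x \<in> path_image (\<gamma> i)"
      unfolding g_in[OF that] path_image_def using clamp(1) by blast
    then show ?thesis
      using \<gamma>(4) by blast
  qed
  have gh: "dist (h x) (g x) < \<epsilon> / 4" for x
  proof (cases "x \<in> (\<Union>i\<in>I. U i)")
    case True
    then obtain i where i: "i \<in> I" "x \<in> U i"
      by blast
    have "h x \<in> W (L i)"
      unfolding hU[OF i] using L(2) \<mu>(1) by (meson centre_in_ball subsetD)
    then show ?thesis
      using W_diam gW[OF i] by blast
  next
    case False
    then show ?thesis
      using g_out \<open>0 < \<epsilon>\<close> by simp
  qed
  have near: "dist (f0 x) (g x) < \<epsilon>" for x
    using h(3)[of x] gh[of x] \<mu>(1,2) \<open>0 < \<epsilon>\<close> dist_triangle[of "f0 x" "g x" "h x"] by linarith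
  \<comment> \<open>The coordinates are Lipschitz with constant \<open>1 / \<rho>\<close>, so an
    error below \<eta> changes them by at most 1/4: values 0 and 1 become at most 1/4 and at least
    3/4.\<close>
  define \<eta> where "\<eta> = \<rho> / 4"
  have \<eta>: "0 < \<eta>"
    using z\<rho>(1) by (simp add: \<eta>_def)
  have shadow: "\<exists>p. \<forall>i. dist (x i) ((f ^^ i) p) < \<epsilon>"
    if f: "continuous_on UNIV f" "\<And>x. dist (g x) (f x) < \<eta>" and x: "\<And>i :: nat. dist (f (x i)) (x (Suc i)) < \<eta>" for f x
  proof -
    have \<psi>f: "\<bar>\<psi> j (g x) - \<psi> j (f x)\<bar> \<le> 1/4" for j x
    proof -
      have "dist (g x) (f x) / \<rho> \<le> \<eta> / \<rho>"
        using f(2)[of x] z\<rho>(1) by (intro divide_right_mono) auto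
      also have "\<eta> / \<rho> = 1/4"
        using z\<rho>(1) by (simp add: \<eta>_def)
      finally show ?thesis
        using tent(6)[of j "g x" "f x"] by (rule order_trans[rotated])
    qed
    have cross: "crosses \<psi> f i j" if "i \<in> I" "j \<in> J i" for i j
    proof -
      have reach: "\<exists>s\<in>{1/4..3/4}. \<forall>x. \<psi> i x = s \<longrightarrow> g x = v" if "v \<in> path_image (\<gamma> i)" for v
      proof -
        from that obtain t where t: "t \<in> {0..1}" "v = \<gamma> i t"
          by (auto simp: path_image_def)
        have "g x = v" if "\<psi> i x = (t + 1/2) / 2" for x
        proof -
          have "x \<in> U i"
            using that t(1) by (intro tent(5)) simp
          moreover have "clamp (\<psi> i x) = t"
            using that t(1) by (simp add: clamp_def)
          ultimately show ?thesis
            using g_in[OF \<open>i \<in> I\<close>] t(2) by simp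
        qed
        then show ?thesis
          using t(1) by (intro bexI[of _ "(t + 1/2) / 2"]) auto
      qed
      have "w j \<in> path_image (\<gamma> i)" "z j \<in> path_image (\<gamma> i)"
        using \<gamma>(3)[of i] that(2) by auto
      then obtain s t where s: "s \<in> {1/4..3/4}" "\<And>x. \<psi> i x = s \<Longrightarrow> g x = w j"
        and t: "t \<in> {1/4..3/4}" "\<And>x. \<psi> i x = t \<Longrightarrow> g x = z j"
        using reach by metis
      have "\<psi> j (f x) \<le> 1/4" if "\<psi> i x = s" for x
        using \<psi>f[of j x] s(2)[OF that] w'(2)[of j] by simp
      moreover have "3/4 \<le> \<psi> j (f x)" if "\<psi> i x = t" for x
        using \<psi>f[of j x] t(2)[OF that] tent(4)[of j] by (simp only:)
      ultimately show ?thesis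
        unfolding crosses_def using s(1) t(1) by blast
    qed
    \<comment> \<open>If \<open>x n\<close> lay in a bump other than \<open>i\<close>, its image
      under \<open>g\<close> would follow another path and say nothing about \<open>W (L i)\<close>.
      Being close to \<open>z i\<close> is enough only off all bumps.\<close>
    define good where "good n i \<longleftrightarrow> i \<in> I \<and> dist (x n) (z i) < \<delta>0 \<and> (x n \<in> U i \<or> x n \<notin> (\<Union>i\<in>I. U i))" for n i
    \<comment> \<open>The tolerance \<open>\<rho> / 2\<close> is twice \<eta>: the distance of
      \<open>f\<close> from \<open>g\<close> plus the jump of the pseudo-orbit.\<close>
    have find: "\<exists>j. good n j \<and> z j \<in> W v" if y: "v \<in> X0" "y \<in> W v" "dist (x n) y < \<rho> / 2" for n y v
    proof (cases "\<exists>j\<in>I. x n \<in> U j")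
      case True
      then obtain j where j: "j \<in> I" "x n \<in> U j"
        by blast
      have xz: "dist (z j) (x n) < \<rho>"
        using j(2) by (simp add: U_def)
      then have "y \<in> ball (z j) (2 * \<rho>)"
        using y(3) dist_triangle[of "z j" y "x n"] z\<rho>(1) by simp
      then have "ball (z j) (2 * \<rho>) \<subseteq> W v"
        using y(1,2) j(1) by (intro inside) auto
      then have "z j \<in> W v"
        using zU(2) by blast
      moreover have "good n j"
        using j xz \<rho>(2) by (simp add: good_def dist_commute)
      ultimately show ?thesis
        by blast
    next
      case False
      obtain a where a: "a \<in> A v" "dist a y < \<delta>0 / 4"
        using A(3)[of v] y(2) by force
      have j: "(v, a) \<in> I"
        using a(1) y(1) by (simp add: I_def)
      have "dist a (z (v, a)) < \<delta>0 / 4"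
        using zG(2)[OF j] by simp
      then have "dist (x n) (z (v, a)) < \<rho> / 2 + \<delta>0 / 2"
        using y(3) a(2) dist_triangle[of "x n" "z (v, a)" y] dist_triangle3[of y "z (v, a)" a] by linarith
      then have "dist (x n) (z (v, a)) < \<delta>0"
        using \<rho>(2) by linarith
      then have "good n (v, a)"
        using j False by (auto simp: good_def)
      then show ?thesis
        using zG(1)[OF j] by auto
    qed
    have "\<exists>k. \<forall>n. good n (k n) \<and> k (Suc n) \<in> J (k n)"
    proof (rule dependent_nat_choice)
      obtain v where "v \<in> X0" "x 0 \<in> W v"
        using X0(2) by blast
      then show "\<exists>i. good 0 i"
        using find[of v "x 0" 0] z\<rho>(1) by auto
    next
      fix i n
      assume i: "good n i"
      then have "i \<in> I"
        by (simp add: good_def)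
      have "g (x n) \<in> W (L i)"
      proof (cases "x n \<in> U i")
        case True
        then show ?thesis
          using gW \<open>i \<in> I\<close> by blast
      next
        case False
        then have "g (x n) = h (x n)"
          using i by (intro g_out) (simp add: good_def)
        have "dist (f0 (x n)) (f0 (z i)) < \<mu> / 8"
          using i \<delta>0(2) by (intro \<delta>1(2)) (simp add: good_def)
        then have "dist (h (z i)) (h (x n)) < \<mu>"
          using h(3)[of "x n"] h(3)[of "z i"] \<mu>(1) dist_triangle[of "h (z i)" "h (x n)" "f0 (z i)"]
            dist_triangle[of "f0 (z i)" "h (x n)" "f0 (x n)"] by (simp add: dist_commute)
        then have "h (x n) \<in> W (L i)"
          using L(2)[of i] by auto
        then show ?thesis
          using \<open>g (x n) = h (x n)\<close> by simp
      qed
      moreover have "dist (x (Suc n)) (g (x n)) < \<rho> / 2"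
        using x[of n] f(2)[of "x n"] dist_triangle[of "x (Suc n)" "g (x n)" "f (x n)"]
        by (simp add: \<eta>_def dist_commute)
      ultimately obtain j where "good (Suc n) j" "z j \<in> W (L i)"
        using find[OF L(1)] by blast
      then show "\<exists>j. good (Suc n) j \<and> j \<in> J i"
        unfolding J_def good_def by blast
    qed
    then obtain k where k: "\<And>n. good n (k n)" "\<And>n. k (Suc n) \<in> J (k n)"
      by blast
    have "crosses \<psi> f (k n) (k (Suc n))" for n
      using k(1)[of n] k(2)[of n] by (intro cross) (simp_all add: good_def)
    moreover have "\<psi> (k 0) (w (k 0)) \<le> 1/4" "3/4 \<le> \<psi> (k 0) (z (k 0))"
      using w'(2) tent(4) by simp_all
    ultimately obtain p where p: "\<And>i. 1/4 \<le> \<psi> (k i) ((f ^^ i) p)"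
      using shadowing_orbit[where f = f and \<psi> = \<psi> and k = k and u = "w (k 0)" and v = "z (k 0)"] f(1) tent(1)
      by blast
    have "dist (x i) ((f ^^ i) p) < \<epsilon>" for i
    proof -
      have "0 < \<psi> (k i) ((f ^^ i) p)"
        using p[of i] by linarith
      then have "(f ^^ i) p \<in> U (k i)"
        by (rule tent(5))
      then have "dist (z (k i)) ((f ^^ i) p) < \<rho>"
        by (simp add: U_def)
      moreover have "dist (x i) (z (k i)) < \<delta>0"
        using k(1)[of i] by (simp add: good_def)
      ultimately show ?thesis
        using \<rho>(2) \<delta>0(3) \<open>0 < \<epsilon>\<close> dist_triangle[of "x i" "(f ^^ i) p" "z (k i)"] by linarith
    qed
    then show ?thesis
      by blast
  qed
  show ?thesis
  proof (rule exI[of _ g], intro conjI allI)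
    show "\<exists>\<eta>>0. \<forall>f. continuous_on UNIV f \<longrightarrow> (\<forall>x. dist (g x) (f x) < \<eta>) \<longrightarrow> (\<exists>\<delta>>0. \<forall>x.
        (\<forall>i :: nat. dist (f (x i)) (x (Suc i)) < \<delta>) \<longrightarrow> (\<exists>z. \<forall>i. dist (x i) ((f ^^ i) z) < \<epsilon>))"
    proof (rule exI[of _ \<eta>], intro conjI allI impI, rule \<eta>)
      fix f
      assume f: "continuous_on UNIV f" "\<forall>x. dist (g x) (f x) < \<eta>"
      have "\<forall>x. (\<forall>i :: nat. dist (f (x i)) (x (Suc i)) < \<eta>) \<longrightarrow> (\<exists>z. \<forall>i. dist (x i) ((f ^^ i) z) < \<epsilon>)"
        using shadow[OF f(1)] f(2) by blast
      then show "\<exists>\<delta>>0. \<forall>x. (\<forall>i :: nat. dist (f (x i)) (x (Suc i)) < \<delta>) \<longrightarrow> (\<exists>z. \<forall>i. dist (x i) ((f ^^ i) z) < \<epsilon>)"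
        using \<eta> by blast
    qed
  qed (use cont near in blast)+
qed

end

subsection \<open>Robust mixing\<close>

text \<open>A finite graph with one successor per vertex that still realises every large length:
  disjoint chains from \<open>u\<close> to \<open>v\<close> of lengths \<open>N\<close>, ...,
  \<open>N + M - 1\<close> all lead into one loop at \<open>v\<close> of length \<open>M\<close>.
  The residue of \<open>n - N\<close> modulo \<open>M\<close> selects the chain and the quotient
  counts the turns in the loop.\<close>

lemma relpow_imp_pseudo_orbit_graph:
  assumes uv: "\<forall>n\<ge>N1. (u, v) \<in> R ^^ n" and vv: "\<forall>n\<ge>N2. (v, v) \<in> R ^^ n"
  shows "\<exists>(J :: (nat \<times> nat) set) s c jv N. finite J \<and> s ` J \<subseteq> J \<and> (\<forall>j\<in>J. (c j, c (s j)) \<in> R) \<and> jv \<in> J \<and> c jv = v \<and>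
    (\<forall>n\<ge>N. \<exists>j\<in>J. c j = u \<and> (s ^^ n) j = jv)"
proof -
  \<comment> \<open>The successors keep every length positive, so that each chain has a first
    vertex.\<close>
  define M N where "M = Suc N2" and "N = Suc N1"
  define l where "l a = (if a < M then N + a else M)" for a
  define b where "b a = (if a < M then u else v)" for a
  have l: "0 < l a" for a
    by (simp add: l_def M_def N_def)
  have "(b a, v) \<in> R ^^ l a" for a
    using uv[rule_format, of "N + a"] vv[rule_format, of M] by (simp add: l_def b_def M_def N_def)
  then have "\<forall>a. \<exists>x. x 0 = b a \<and> x (l a) = v \<and> (\<forall>i<l a. (x i, x (Suc i)) \<in> R)"
    by (simp add: relpow_fun_conv)
  then obtain x where x: "\<And>a. x a 0 = b a" "\<And>a. x a (l a) = v" "\<And>a i. i < l a \<Longrightarrow> (x a i, x a (Suc i)) \<in> R"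
    by metis
  define J where "J = Sigma {..M} (\<lambda>a. {..<l a})"
  define s where "s j = (if Suc (snd j) < l (fst j) then (fst j, Suc (snd j)) else (M, 0))" for j :: "nat \<times> nat"
  define c where "c j = x (fst j) (snd j)" for j
  have "finite J" "s ` J \<subseteq> J" "(M, 0) \<in> J"
    using l[of M] by (auto simp: J_def s_def)
  moreover have "(c j, c (s j)) \<in> R" if "j \<in> J" for j
  proof -
    have i: "snd j < l (fst j)"
      using that by (auto simp: J_def)
    show ?thesis
    proof (cases "Suc (snd j) < l (fst j)")
      case True
      then show ?thesis
        using x(3)[OF i] by (simp add: c_def s_def)
    next
      case False
      then have "Suc (snd j) = l (fst j)"
        using i by simp
      then have "c (s j) = x (fst j) (Suc (snd j))"
        using x(1)[of M] x(2)[of "fst j"] by (simp add: c_def s_def b_def)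
      then show ?thesis
        using x(3)[OF i] by (simp add: c_def)
    qed
  qed
  moreover have "c (M, 0) = v"
    using x(1)[of M] by (simp add: c_def b_def)
  moreover have "\<exists>j\<in>J. c j = u \<and> (s ^^ n) j = (M, 0)" if n: "N \<le> n" for n
  proof -
    have run: "(s ^^ i) (a, 0) = (a, i)" if "i < l a" for a i
      using that by (induction i) (auto simp: s_def l)
    have full: "(s ^^ l a) (a, 0) = (M, 0)" for a
    proof -
      obtain m where m: "l a = Suc m"
        using l[of a] by (cases "l a") auto
      then show ?thesis
        using run[of m a] by (simp add: s_def)
    qed
    have cycle: "(s ^^ (k * M)) (M, 0) = (M, 0)" for k
    proof (induction k)
      case (Suc k)
      have "l M = M"
        by (simp add: l_def)
      then have "(s ^^ M) (M, 0) = (M, 0)"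
        using full[of M] by simp
      then show ?case
        using Suc by (simp add: funpow_add)
    qed simp
    define a k where "a = (n - N) mod M" and "k = (n - N) div M"
    have "a < M"
      by (simp add: a_def M_def)
    have "n - N = k * M + a"
      by (simp add: a_def k_def)
    then have "n = k * M + l a"
      using n \<open>a < M\<close> by (simp add: l_def)
    then have "(s ^^ n) (a, 0) = (s ^^ (k * M)) ((s ^^ l a) (a, 0))"
      by (simp add: funpow_add)
    then have "(s ^^ n) (a, 0) = (M, 0)"
      using full cycle by simp
    moreover have "(a, 0) \<in> J" "c (a, 0) = u"
      using \<open>a < M\<close> l[of a] x(1)[of a] by (auto simp: J_def c_def b_def)
    ultimately show ?thesis
      by blast
  qed
  ultimately show ?thesis
    by (intro exI[of _ J] exI[of _ s] exI[of _ c] exI[of _ "(M, 0)"] exI[of _ N]) blast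
qed

text \<open>The inverse of the arc, put to 0 off \<open>W\<close>, is continuous on a closed set and
  extends by Tietze's theorem. Unlike a tent function it inverts the arc exactly, which makes the
  dynamics on the arcs explicit.\<close>

lemma arc_coordinate:
  fixes q :: "real \<Rightarrow> 'a::metric_space"
  assumes q: "arc q" "path_image q \<subseteq> W" and "open W"
  shows "\<exists>\<psi>. continuous_on UNIV \<psi> \<and> (\<forall>x. \<psi> x \<in> {0..1 :: real}) \<and> (\<forall>s\<in>{0..1}. \<psi> (q s) = s) \<and> (\<forall>x. x \<notin> W \<longrightarrow> \<psi> x = 0)"
proof -
  have inj: "inj_on q {0..1}" and cq: "continuous_on {0..1} q"
    using q(1) by (auto simp: arc_def path_def)
  define f where "f x = (if x \<in> path_image q then the_inv_into {0..1} q x else 0)" for x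
  have fq: "f (q s) = s" if "s \<in> {0..1}" for s
    using that inj by (auto simp: f_def path_image_def the_inv_into_f_f)
  have "continuous_on (path_image q) f"
    unfolding path_image_def by (rule continuous_on_inv[OF cq]) (use fq in auto)
  moreover have "continuous_on (- W) f"
  proof (rule continuous_on_eq)
    show "continuous_on (- W) (\<lambda>x. 0)"
      by simp
  qed (use q(2) in \<open>auto simp: f_def\<close>)
  moreover have "closed (path_image q)"
    using q(1) by (simp add: arc_imp_path closed_path_image)
  moreover have "closed (- W)"
    using \<open>open W\<close> by auto
  ultimately have f: "continuous_on (path_image q \<union> - W) f" and cl: "closed (path_image q \<union> - W)"
    by (auto intro: continuous_on_closed_Un)
  have "f ` (path_image q \<union> - W) \<subseteq> {0..1}"
    using fq q(2) by (auto simp: path_image_def f_def)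
  moreover have "normal_space (euclidean :: 'a topology)"
    by (simp add: metrizable_imp_normal_space metrizable_space_euclidean)
  moreover have "closedin euclidean (path_image q \<union> - W)"
    using cl by simp
  ultimately obtain \<psi> where \<psi>: "continuous_map euclidean euclideanreal \<psi>" "\<And>x. x \<in> path_image q \<union> - W \<Longrightarrow> \<psi> x = f x"
    "\<psi> ` topspace euclidean \<subseteq> {0..1}"
    using Tietze_extension_closed_real_interval[of "euclidean :: 'a topology" "path_image q \<union> - W" f 0 1] f
    by (auto simp: continuous_map_iff_continuous)
  have "\<psi> x = 0" if "x \<notin> W" for x
    using \<psi>(2)[of x] that q(2) by (auto simp: f_def)
  moreover have "\<psi> (q s) = s" if "s \<in> {0..1}" for s
    using \<psi>(2)[of "q s"] fq[OF that] that by (auto simp: path_image_def)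
  moreover have "\<psi> x \<in> {0..1}" for x
    using subsetD[OF \<psi>(3), of "\<psi> x"] by simp
  ultimately show ?thesis
    using \<psi>(1) by (intro exI[of _ \<psi>]) auto
qed

lemma funpow_chain: "0 < d \<Longrightarrow> (q, (f ^^ n) q) \<in> chain_step f d ^^ n"
proof (induction n)
  case (Suc n)
  have "((f ^^ n) q, (f ^^ Suc n) q) \<in> chain_step f d"
    using Suc.prems by (simp add: chain_step_def)
  then show ?case
    using Suc by (intro relpow_Suc_I) auto
qed simp

text \<open>The values 0 at 1/4 and 1 at 1/2 give the crossing. The descent to 0 at 3/4 makes the
  function constant beyond, so that bumps stay locally constant off the middle region.\<close>

definition spike :: "real \<Rightarrow> real" where
  "spike s = max 0 (min (4 * s - 1) (3 - 4 * s))"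

lemma spike: "continuous_on S spike" "spike s \<in> {0..1}" "spike (1/4) = 0" "spike (1/2) = 1" "3/4 \<le> s \<Longrightarrow> spike s = 0"
  unfolding spike_def by (auto intro!: continuous_intros)

text \<open>The 4-adic rationals leave the interval \<open>[1/4, 3/4]\<close> under iteration of the spike, because the
  denominator decreases.\<close>

lemma spike_quadic:
  assumes "real m / 4 ^ Suc n \<in> {1/4..3/4}"
  shows "\<exists>m'. m' \<le> 4 ^ n \<and> spike (real m / 4 ^ Suc n) = real m' / 4 ^ n"
proof -
  have lo: "4 ^ n \<le> real m" and hi: "real m \<le> 3 * 4 ^ n"
    using assms by (auto simp: field_simps)
  have "4 ^ n \<le> m" "m \<le> 3 * 4 ^ n"
  proof -
    show "4 ^ n \<le> m"
      using lo by simp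
    have "real m \<le> real (3 * 4 ^ n)"
      using hi by simp
    then show "m \<le> 3 * 4 ^ n"
      by (simp only: of_nat_le_iff)
  qed
  show ?thesis
  proof (cases "m \<le> 2 * 4 ^ n")
    case True
    then have "real m \<le> real (2 * 4 ^ n)"
      by (simp only: of_nat_le_iff)
    then have "real m \<le> 2 * 4 ^ n"
      by simp
    then have "spike (real m / 4 ^ Suc n) = real (m - 4 ^ n) / 4 ^ n"
      using lo \<open>4 ^ n \<le> m\<close> by (simp add: spike_def field_simps of_nat_diff max_def min_def)
    then show ?thesis
      using True by (intro exI[of _ "m - 4 ^ n"]) auto
  next
    case False
    then have "real (2 * 4 ^ n) \<le> real m"
      by (simp only: of_nat_le_iff)
    then have "2 * 4 ^ n \<le> real m"
      by simp
    then have "spike (real m / 4 ^ Suc n) = real (3 * 4 ^ n - m) / 4 ^ n"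
      using hi \<open>m \<le> 3 * 4 ^ n\<close> by (simp add: spike_def field_simps of_nat_diff max_def min_def)
    then show ?thesis
      using False by (intro exI[of _ "3 * 4 ^ n - m"]) auto
  qed
qed

context lc_dense_space
begin

text \<open>A finite graph of pseudo-orbits is planted so that every map near the new map \<open>g\<close> crosses along the
  edges of the graph. Off the region \<open>T\<close> that realises the crossings, \<open>g\<close> is made exact at a scale
  much finer than the robustness of the crossings. Inside \<open>T\<close>, which follows spikes along arcs, chains
  escape. Hence \<open>g\<close> is approximately chain transitive, so a nearby map is exact.\<close>

lemma robust_mixing:
  fixes f0 :: "'a \<Rightarrow> 'a"
  assumes f0: "continuous_on UNIV f0" "chain_transitive f0"
    and U: "open U" "U \<noteq> {}" and V: "open V" "V \<noteq> {}" and "0 < \<epsilon>"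
  shows "\<exists>g. continuous_on UNIV g \<and> exact_devaney_chaotic g \<and> (\<forall>x. dist (f0 x) (g x) < \<epsilon>) \<and>
    (\<exists>\<eta>>0. \<forall>f. continuous_on UNIV f \<longrightarrow> (\<forall>x. dist (g x) (f x) < \<eta>) \<longrightarrow>
      (\<exists>N. \<forall>n\<ge>N. (f ^^ n) ` U \<inter> V \<noteq> {}))"
proof -
  \<comment> \<open>The distances in the end are \<open>R / 8\<close>, \<open>e\<close>,
    \<open>e\<close> and \<open>\<eta> / 2\<close>, with \<open>R\<close> and \<eta> at most
    \<open>e\<close>.\<close>
  define e where "e = \<epsilon> / 8"
  have e: "0 < e"
    using \<open>0 < \<epsilon>\<close> by (simp add: e_def)
  obtain R where R: "covering_radius TYPE('a) e R"
    using covering_radius_exists[OF e] by blast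
  have R': "0 < R" "R \<le> e"
    using R by (auto simp: covering_radius_def)
  obtain R1 where R1: "covering_radius TYPE('a) (R / 16) R1"
    using covering_radius_exists[of "R / 16"] R'(1) by auto
  have R1': "0 < R1" "R1 \<le> R / 16"
    using R1 by (auto simp: covering_radius_def)
  have ct: "\<exists>n. (a, b) \<in> chain_step f0 d ^^ n" if "0 < d" for a b d
    using f0(2) that unfolding chain_transitive_iff by blast
  obtain u v where uv: "u \<in> U" "v \<in> V"
    using U(2) V(2) by blast
  have mix: "\<exists>N. \<forall>n\<ge>N. (a, b) \<in> chain_step f0 (R / 8) ^^ n" for a b
    using R'(1) by (intro chain_mixing[OF f0(1)] ct) auto
  obtain N1 where N1: "\<forall>n\<ge>N1. (u, v) \<in> chain_step f0 (R / 8) ^^ n"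
    using mix by blast
  obtain N2 where N2: "\<forall>n\<ge>N2. (v, v) \<in> chain_step f0 (R / 8) ^^ n"
    using mix by blast
  obtain J :: "(nat \<times> nat) set" and s c jv N where J: "finite J" "s ` J \<subseteq> J"
    "\<forall>j\<in>J. (c j, c (s j)) \<in> chain_step f0 (R / 8)" "jv \<in> J" "c jv = v"
    "\<forall>n\<ge>N. \<exists>j\<in>J. c j = u \<and> (s ^^ n) j = jv"
    using relpow_imp_pseudo_orbit_graph[OF N1 N2] by (elim exE conjE) (rule that)
  have sJ: "s j \<in> J" if "j \<in> J" for j
    using J(2) that by blast
  obtain \<kappa>1 where \<kappa>1: "0 < \<kappa>1" "\<And>x y. dist x y < \<kappa>1 \<Longrightarrow> dist (f0 x) (f0 y) < R / 8"
    using uniform_modulus[OF f0(1), of "R / 8"] R'(1) by auto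
  obtain \<kappa>u \<kappa>v where \<kappa>uv: "0 < \<kappa>u" "ball u \<kappa>u \<subseteq> U" "0 < \<kappa>v" "ball v \<kappa>v \<subseteq> V"
    using U(1) V(1) uv by (meson openE)
  define \<kappa> where "\<kappa> = min (min \<kappa>1 (R / 8)) (min \<kappa>u \<kappa>v)"
  have \<kappa>: "0 < \<kappa>" "\<kappa> \<le> \<kappa>1" "\<kappa> \<le> R / 8" "ball u \<kappa> \<subseteq> U" "ball v \<kappa> \<subseteq> V"
    using \<kappa>1(1) R'(1) \<kappa>uv subset_ball[of \<kappa> \<kappa>u u] subset_ball[of \<kappa> \<kappa>v v] by (auto simp: \<kappa>_def)
  obtain h0 F0 where h0: "exact_stage h0 F0 R" "\<And>x. dist (f0 x) (h0 x) < R1 / 8 + R / 16"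
    using exact_stage_near[OF f0(1) R1 R'(1) ct] R1'(1) by auto
  have hF: "continuous_on UNIV h0" "closed F0" "interior F0 = {}" "lc_on (- F0) h0" "exact_at h0 F0 R"
    using h0(1) by (auto simp: exact_stage_def)
  have h0f0: "dist (f0 x) (h0 x) < R / 8" for x
    using h0(2)[of x] R1' by linarith

  have G: "open (ball (c j) \<kappa>) \<and> \<not> ball (c j) \<kappa> \<subseteq> F0" for j
    using hF(3) \<kappa>(1) by (metis ball_eq_empty interior_maximal linorder_not_le open_ball subset_empty)
  have "\<exists>z \<rho>. 0 < \<rho> \<and> \<rho> \<le> 1 \<and> disjoint_family_on (\<lambda>j. ball (z j) (2 * \<rho>)) J \<and>
    (\<forall>j\<in>J. ball (z j) (2 * \<rho>) \<subseteq> ball (c j) \<kappa> - F0 \<and> ball (z j) (2 * \<rho>) \<subseteq> UNIV \<and>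
      (\<forall>x\<in>ball (z j) (2 * \<rho>). h0 x = h0 (z j)))"
    by (rule plateau_points[OF J(1) hF(2,4) G]) simp_all
  then obtain z \<rho> where z\<rho>: "0 < \<rho>" "disjoint_family_on (\<lambda>j. ball (z j) (2 * \<rho>)) J"
    "\<forall>j\<in>J. ball (z j) (2 * \<rho>) \<subseteq> ball (c j) \<kappa> - F0 \<and> ball (z j) (2 * \<rho>) \<subseteq> UNIV \<and>
      (\<forall>x\<in>ball (z j) (2 * \<rho>). h0 x = h0 (z j))"
    by (elim exE conjE) (rule that)
  define W where "W j = ball (z j) (2 * \<rho>)" for j
  have disj: "disjoint_family_on W J"
    using z\<rho>(2) by (simp add: W_def[abs_def])
  have W: "open (W j)" "W j \<noteq> {}" "z j \<in> W j" for j
    using z\<rho>(1) by (auto simp: W_def)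
  have WJ: "W j \<subseteq> ball (c j) \<kappa>" "W j \<inter> F0 = {}" if "j \<in> J" for j
    using z\<rho>(3) that unfolding W_def by blast+
  have h0W: "h0 x = h0 (z j)" if "j \<in> J" "x \<in> W j" for j x
    using z\<rho>(3) that unfolding W_def by blast
  obtain \<alpha> where \<alpha>: "\<And>j. arc (\<alpha> j)" "\<And>j. path_image (\<alpha> j) \<subseteq> W j"
    using small_arc[OF W(1,2)] by metis
  obtain \<psi> where \<psi>: "\<And>j. continuous_on UNIV (\<psi> j)" "\<And>j x. \<psi> j x \<in> {0..1}"
    "\<And>j t. t \<in> {0..1} \<Longrightarrow> \<psi> j (\<alpha> j t) = t" "\<And>j x. x \<notin> W j \<Longrightarrow> \<psi> j x = 0"
    using arc_coordinate[OF \<alpha> W(1)] by metis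
  have \<psi>W: "x \<in> W j" if "0 < \<psi> j x" for j x
    using \<psi>(4)[of x j] that by auto
  have \<alpha>W: "\<alpha> j t \<in> W j" if "t \<in> {0..1}" for j t
    using \<alpha>(2)[of j] that unfolding path_image_def by blast
  have \<alpha>c: "continuous_on {0..1} (\<alpha> j)" for j
    using \<alpha>(1)[of j] by (simp add: arc_def path_def)
  \<comment> \<open>Four errors of \<open>R / 8\<close>. So the value on a plateau can be joined to
    any point of the next region by a path of size \<open>e\<close>.\<close>
  have jump: "dist (h0 (z j)) y < R" if "j \<in> J" "y \<in> W (s j)" for j y
  proof -
    have "dist (c j) (z j) < \<kappa>"
      using WJ(1)[OF that(1)] W(3)[of j] by auto
    then have 1: "dist (f0 (c j)) (f0 (z j)) < R / 8"
      using \<kappa>(2) by (intro \<kappa>1(2)) simp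
    have 2: "dist (f0 (c j)) (c (s j)) < R / 8"
      using J(3) that(1) by (simp add: chain_step_def)
    have 3: "dist (c (s j)) y < R / 8"
      using WJ(1)[OF sJ[OF that(1)]] that(2) \<kappa>(3) by auto
    have "dist (h0 (z j)) y \<le> dist (f0 (z j)) (h0 (z j)) + dist (f0 (c j)) (f0 (z j)) + dist (f0 (c j)) (c (s j)) + dist (c (s j)) y"
      using dist_triangle[of "h0 (z j)" y "f0 (z j)"] dist_triangle[of "f0 (z j)" y "f0 (c j)"]
        dist_triangle[of "f0 (c j)" y "c (s j)"] by (simp add: dist_commute)
    then show ?thesis
      using 1 2 3 h0f0[of "z j"] R'(1) by linarith
  qed
  have "\<forall>j. \<exists>\<beta>. j \<in> J \<longrightarrow> path \<beta> \<and> \<beta> 0 = h0 (z j) \<and> \<beta> 1 = \<alpha> (s j) 0 \<and> path_image \<beta> \<subseteq> ball (h0 (z j)) e"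
  proof
    fix j
    show "\<exists>\<beta>. j \<in> J \<longrightarrow> path \<beta> \<and> \<beta> 0 = h0 (z j) \<and> \<beta> 1 = \<alpha> (s j) 0 \<and> path_image \<beta> \<subseteq> ball (h0 (z j)) e"
    proof (cases "j \<in> J")
      case True
      have "dist (h0 (z j)) (\<alpha> (s j) 0) < R"
        using \<alpha>W[of 0 "s j"] by (intro jump[OF True]) simp
      then show ?thesis
        using R unfolding covering_radius_def pathstart_def pathfinish_def by blast
    qed simp
  qed
  then obtain \<beta> where \<beta>: "\<And>j. j \<in> J \<Longrightarrow> path (\<beta> j)" "\<And>j. j \<in> J \<Longrightarrow> \<beta> j 0 = h0 (z j)"
    "\<And>j. j \<in> J \<Longrightarrow> \<beta> j 1 = \<alpha> (s j) 0" "\<And>j. j \<in> J \<Longrightarrow> path_image (\<beta> j) \<subseteq> ball (h0 (z j)) e"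
    by metis
  obtain st E where st: "staircase st E"
    using staircase_exists[of 1] by auto
  have st_range: "st t \<in> {0..1}" "continuous_on S st" "st 1 = 1" "st 0 = 0" for t S
  proof -
    show "continuous_on S st"
      using st unfolding staircase_def by (blast intro: continuous_on_subset)
  qed (use st in \<open>simp_all add: staircase_def\<close>)
  \<comment> \<open>Up to 1/4 the path runs from the plateau value to the start of the next arc,
    slowed down by a staircase; from 1/4 on it moves along this arc as the spike prescribes and
    rests at its start after 3/4.\<close>
  define \<Gamma> where "\<Gamma> j t = (if t \<le> 1/4 then \<beta> j (st (4 * t)) else \<alpha> (s j) (spike t))" for j t
  have \<Gamma>mid: "\<Gamma> j t = \<alpha> (s j) (spike t)" if "j \<in> J" "1/4 \<le> t" for j t
  proof (cases "t = 1/4")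
    case True
    show ?thesis
      unfolding \<Gamma>_def True using \<beta>(3)[OF that(1)] st_range(3) spike(3) by simp
  next
    case False
    then show ?thesis
      using that(2) by (simp add: \<Gamma>_def)
  qed
  have \<Gamma>path: "path (\<Gamma> j)" if "j \<in> J" for j
    unfolding path_def \<Gamma>_def
  proof (rule continuous_on_cases_le)
    show "continuous_on {t \<in> {0..1}. t \<le> 1/4} (\<lambda>t. \<beta> j (st (4 * t)))"
      by (rule continuous_on_compose2[OF \<beta>(1)[OF that, unfolded path_def]])
        (use st_range(1) in \<open>auto intro!: continuous_on_compose2[OF st_range(2)[of UNIV]] continuous_intros\<close>)
    show "continuous_on {t \<in> {0..1}. 1/4 \<le> t} (\<lambda>t. \<alpha> (s j) (spike t))"
      by (rule continuous_on_compose2[OF \<alpha>c spike(1)]) (use spike(2) in blast)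
    show "\<beta> j (st (4 * t)) = \<alpha> (s j) (spike t)" if "t = 1/4" for t
      unfolding that using \<beta>(3)[OF \<open>j \<in> J\<close>] st_range(3) spike(3) by simp
  qed simp
  have \<Gamma>near: "dist (h0 (z j)) (\<Gamma> j t) < e" if "j \<in> J" for j t
  proof (cases "t \<le> 1/4")
    case True
    have "\<beta> j (st (4 * t)) \<in> path_image (\<beta> j)"
      using st_range(1) unfolding path_image_def by blast
    then show ?thesis
      using \<beta>(4)[OF that] True unfolding \<Gamma>_def by auto
  next
    case False
    have "dist (h0 (z j)) (\<alpha> (s j) (spike t)) < R"
      using \<alpha>W[OF spike(2)] by (rule jump[OF that])
    then show ?thesis
      using False R'(2) by (simp add: \<Gamma>_def)
  qed
  define h1 where "h1 = bump J W \<psi> \<Gamma> h0"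
  have h1_in: "h1 x = \<Gamma> j (\<psi> j x)" if "j \<in> J" "x \<in> W j" for j x
    unfolding h1_def bump_inside[OF disj that] ..
  have h1_out: "h1 x = h0 x" if "x \<notin> (\<Union>j\<in>J. W j)" for x
    unfolding h1_def using that by (rule bump_outside)
  have h1c: "continuous_on UNIV h1"
    unfolding h1_def
  proof (rule bump_continuous[where p = "\<lambda>j. h0 (z j)", OF J(1) disj W(1) hF(1)])
    show "h0 x = h0 (z j)" if "j \<in> J" "x \<in> W j" for j x
      using that by (rule h0W)
    show "path (\<Gamma> j)" if "j \<in> J" for j
      using that by (rule \<Gamma>path)
    show "\<Gamma> j 0 = h0 (z j)" if "j \<in> J" for j
      using \<beta>(2)[OF that] st_range(4) by (simp add: \<Gamma>_def)
    show "continuous_on UNIV (\<psi> j)" "\<psi> j x \<in> {0..1}" for j x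
      by (rule \<psi>)+
    show "\<psi> j x = 0" if "x \<notin> W j" for j x
      using that by (rule \<psi>)
  qed
  have h1near: "dist (h0 x) (h1 x) < e" for x
  proof (cases "x \<in> (\<Union>j\<in>J. W j)")
    case True
    then obtain j where j: "j \<in> J" "x \<in> W j"
      by blast
    then show ?thesis
      using \<Gamma>near[OF j(1)] h0W[OF j] h1_in[OF j] by simp
  next
    case False
    then show ?thesis
      using h1_out e by simp
  qed
  \<comment> \<open>The crossings depend only on the values on \<open>T\<close>. The step from
    \<open>h1\<close> to \<open>h2\<close> keeps these values, so off \<open>T\<close> it may move
    the map by up to \<open>e\<close>.\<close>
  define T where "T = (\<Union>j\<in>J. {x. 1/4 \<le> \<psi> j x \<and> \<psi> j x \<le> 3/4})"
  have "closed T"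
    unfolding T_def
    by (intro closed_UN ballI closed_Collect_conj closed_Collect_le continuous_on_const \<psi>(1) J(1))
  have h1F: "h1 x = h0 x" if "x \<in> F0" for x
    using that WJ(2) by (intro h1_out) blast
  have lc1: "lc_on (- (T \<union> F0)) h1"
    unfolding h1_def
  proof (rule bump_lc_on[OF disj W(1)])
    show "lc_on (- (T \<union> F0)) h0"
      using hF(4) by (rule lc_on_subset) blast
    show "lc_on (W j \<inter> - (T \<union> F0)) (\<lambda>x. \<Gamma> j (\<psi> j x))" if j: "j \<in> J" for j
      unfolding lc_on_def
    proof (intro allI impI, elim conjE)
      fix A :: "'a set"
      assume A: "open A" "A \<noteq> {}" "A \<subseteq> W j \<inter> - (T \<union> F0)"
      define A1 where "A1 = A \<inter> {x. \<psi> j x < 1/4}"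
      show "\<exists>B. open B \<and> B \<noteq> {} \<and> B \<subseteq> A \<and> (\<lambda>x. \<Gamma> j (\<psi> j x)) constant_on B"
      proof (cases "A1 = {}")
        case False
        have "open A1"
          unfolding A1_def using A(1) \<psi>(1) by (intro open_Int open_Collect_less) auto
        moreover have "continuous_on A1 (\<lambda>x. 4 * \<psi> j x)"
          by (intro continuous_intros continuous_on_subset[OF \<psi>(1)]) simp
        ultimately obtain B where B: "open B" "B \<noteq> {}" "B \<subseteq> A1" "(\<lambda>x. st (4 * \<psi> j x)) constant_on B"
          using lc_on_staircase[OF st _ _ False] by blast
        then obtain y where y: "\<And>x. x \<in> B \<Longrightarrow> st (4 * \<psi> j x) = y"
          unfolding constant_on_def by blast
        have "\<Gamma> j (\<psi> j x) = \<beta> j y" if "x \<in> B" for x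
          using y[OF that] B(3) that by (auto simp: \<Gamma>_def A1_def)
        then have "(\<lambda>x. \<Gamma> j (\<psi> j x)) constant_on B"
          unfolding constant_on_def by blast
        then show ?thesis
          using B by (intro exI[of _ B]) (auto simp: A1_def)
      next
        case True
        have "\<Gamma> j (\<psi> j x) = \<alpha> (s j) 0" if "x \<in> A" for x
        proof -
          have "\<not> \<psi> j x < 1/4"
            using True that by (auto simp: A1_def)
          moreover have "x \<notin> T"
            using A(3) that by blast
          ultimately have "3/4 < \<psi> j x"
            using j by (auto simp: T_def not_less)
          then show ?thesis
            using \<Gamma>mid[OF j, of "\<psi> j x"] spike(5)[of "\<psi> j x"] by simp
        qed
        then have "(\<lambda>x. \<Gamma> j (\<psi> j x)) constant_on A"
          unfolding constant_on_def by blast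
        then show ?thesis
          using A by blast
      qed
    qed
  qed

  have "\<forall>j. \<exists>\<eta>>0. \<forall>x y. dist x y < \<eta> \<longrightarrow> dist (\<psi> j x) (\<psi> j y) < 1/4"
    using uniform_modulus[OF \<psi>(1), of "1/4"] by auto
  then obtain \<eta>0 where \<eta>0: "\<And>j. 0 < \<eta>0 j" "\<And>j x y. dist x y < \<eta>0 j \<Longrightarrow> dist (\<psi> j x) (\<psi> j y) < 1/4"
    by metis
  have "\<exists>r>0. \<forall>a\<in>insert e (\<eta>0 ` J). r \<le> a"
    using J(1) \<eta>0(1) e by (intro finite_positive_bound) auto
  then obtain \<eta> where \<eta>: "0 < \<eta>" "\<eta> \<le> e" "\<And>j. j \<in> J \<Longrightarrow> \<eta> \<le> \<eta>0 j"
    by auto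
  have \<eta>\<psi>: "\<bar>\<psi> j x - \<psi> j y\<bar> < 1/4" if "dist x y < \<eta>" "j \<in> J" for j x y
    using \<eta>0(2)[of x y j] \<eta>(3)[of j] that by (simp add: dist_real_def)
  have "0 < \<eta> / 2"
    using \<eta>(1) by simp
  \<comment> \<open>The order of choices matters: \<eta> measures the robustness of the crossings
    and determines \<open>d\<close>; only then are coverings of radius \<open>d / 2\<close> planted
    off \<open>T\<close>.\<close>
  from exact_devaney_near[OF this] obtain d where d: "0 < d"
    "\<And>f :: 'a \<Rightarrow> 'a. continuous_on UNIV f \<and> (\<forall>a b. \<exists>n. (a, b) \<in> chain_step f d ^^ n) \<Longrightarrow>
      \<exists>g. continuous_on UNIV g \<and> exact_devaney_chaotic g \<and> (\<forall>x. dist (f x) (g x) < \<eta> / 2)"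
    by blast
  have cl: "closed (T \<union> F0)"
    using \<open>closed T\<close> hF(2) by auto
  have q: "dist (h1 x) (h1 x) < R" for x
    using R'(1) by simp
  have "0 < d / 2"
    using d(1) by simp
  from make_covering[OF h1c cl lc1 R this q]
  obtain h2 F2 where h2: "continuous_on UNIV h2" "\<forall>x\<in>T \<union> F0. h2 x = h1 x" "\<forall>x. dist (h1 x) (h2 x) < e"
    "\<forall>x. \<not> ball x (d / 2 / 2) \<subseteq> T \<union> F0 \<longrightarrow>
      (\<exists>z\<in>F2 \<inter> ball x (d / 2). h2 z = h1 z \<and> ball (h1 z) R \<subseteq> h2 ` (F2 \<inter> ball x (d / 2)))"
    by (elim exE conjE) (rule that)
  \<comment> \<open>As \<open>F0\<close> has no interior, near a point off the closed set
    \<open>T\<close> there is a covering planted in \<open>h2\<close>. Its image contains a ball of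
    radius \<open>R\<close>, from which frozen orbits reach every \<open>y\<close>.\<close>
  have reach: "\<exists>q\<in>ball x (d / 2). \<exists>n. (h2 ^^ n) q = y" if "x \<notin> T" for x y
  proof -
    have "\<not> ball x (d / 2 / 2) \<subseteq> T \<union> F0"
    proof
      assume "ball x (d / 2 / 2) \<subseteq> T \<union> F0"
      then have "ball x (d / 2 / 2) - T \<subseteq> interior F0"
        using \<open>closed T\<close> by (intro interior_maximal open_Diff) auto
      moreover have "x \<in> ball x (d / 2 / 2) - T"
        using that d(1) by simp
      ultimately show False
        using hF(3) by blast
    qed
    then obtain w where w: "ball (h1 w) R \<subseteq> h2 ` (F2 \<inter> ball x (d / 2))"
      using h2(4) by blast
    obtain n where "covers_in h0 F0 (ball (h1 w) R) n"
      using hF(5) unfolding exact_at_def by blast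
    then have "covers_in h2 (F0 \<union> F2) (ball (h1 w) R) n"
      by (rule covers_in_mono) (use h2(2) h1F in auto)
    then have "covers_in h2 (F0 \<union> F2) (ball x (d / 2)) (Suc n)"
      by (rule covers_in_Suc) (use w in blast)
    then show ?thesis
      unfolding covers_in_def by blast
  qed
  have h2T: "h2 x = \<alpha> (s j) (spike (\<psi> j x))" if "j \<in> J" "1/4 \<le> \<psi> j x" "\<psi> j x \<le> 3/4" for j x
  proof -
    have "x \<in> W j"
      using that(2) by (intro \<psi>W) linarith
    moreover have "x \<in> T"
      using that by (auto simp: T_def)
    ultimately show ?thesis
      using h2(2) h1_in[OF that(1)] \<Gamma>mid[OF that(1,2)] by simp
  qed
  \<comment> \<open>A chain that gets off \<open>T\<close> can be finished by \<open>reach\<close>.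
    Inside \<open>T\<close> it is steered to a 4-adic parameter of the next arc by an error below
    \<open>d / 2\<close> and then follows the map until it leaves \<open>T\<close>.\<close>
  have chains: "\<exists>n. (a, b) \<in> chain_step h2 d ^^ n" for a b
  proof -
    have leave: "\<exists>n. (a, b) \<in> chain_step h2 d ^^ n" if "x \<notin> T" "dist (h2 a) x < d / 2" for a x
    proof -
      from reach[OF that(1), of b] obtain q n where q: "q \<in> ball x (d / 2)" "(h2 ^^ n) q = b"
        by blast
      have "dist x q < d / 2"
        using q(1) by simp
      then have "dist (h2 a) q < d"
        using that(2) dist_triangle[of "h2 a" q x] by linarith
      then have "(a, q) \<in> chain_step h2 d"
        by (simp add: chain_step_def)
      moreover have "(q, b) \<in> chain_step h2 d ^^ n"
        using funpow_chain[OF d(1), of q n h2] q(2) by simp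
      ultimately show ?thesis
        using relpow_Suc_I2 by metis
    qed
    have step: "\<exists>n. (a, b) \<in> chain_step h2 d ^^ n"
      if "dist (h2 a) x < d / 2" "x \<in> T \<Longrightarrow> \<exists>n. (x, b) \<in> chain_step h2 d ^^ n" for a x
    proof (cases "x \<in> T")
      case True
      from that(2)[OF this] obtain n where "(x, b) \<in> chain_step h2 d ^^ n"
        by blast
      moreover have "(a, x) \<in> chain_step h2 d"
        using that(1) d(1) by (simp add: chain_step_def)
      ultimately show ?thesis
        using relpow_Suc_I2 by metis
    next
      case False
      then show ?thesis
        using leave that(1) by blast
    qed
    have T_arc: "t \<in> {1/4..3/4}" if "j \<in> J" "t \<in> {0..1}" "\<alpha> j t \<in> T" for j t
    proof -
      from that(3) obtain i where i: "i \<in> J" "1/4 \<le> \<psi> i (\<alpha> j t)" "\<psi> i (\<alpha> j t) \<le> 3/4"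
        by (auto simp: T_def)
      have "\<alpha> j t \<in> W i"
        using i(2) by (intro \<psi>W) linarith
      then have "i = j"
        using \<alpha>W[OF that(2), of j] disj i(1) that(1) unfolding disjoint_family_on_def by blast
      then show ?thesis
        using i \<psi>(3)[OF that(2), of j] by simp
    qed
    have quadic: "\<exists>k. (\<alpha> j (real m / 4 ^ n), b) \<in> chain_step h2 d ^^ k"
      if "j \<in> J" "m \<le> 4 ^ n" "\<alpha> j (real m / 4 ^ n) \<in> T" for j m n
      using that
    proof (induction n arbitrary: j m)
      \<comment> \<open>With denominator 1 the parameter is 0 or 1, and the end points of the arcs
        are not in \<open>T\<close>.\<close>
      case 0
      then have "real m / 4 ^ 0 \<in> {1/4..3/4}"
        by (intro T_arc[of j]) auto
      then show ?case
        by (cases m) auto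
    next
      case (Suc n)
      define t where "t = real m / 4 ^ Suc n"
      have t01: "t \<in> {0..1}"
      proof -
        have "real m \<le> real (4 ^ Suc n)"
          using Suc.prems(2) by (simp only: of_nat_le_iff)
        then show ?thesis
          by (simp add: t_def)
      qed
      have t: "t \<in> {1/4..3/4}"
        using Suc.prems(1,3) t01 by (intro T_arc[of j]) (simp_all add: t_def)
      then obtain m' where m': "m' \<le> 4 ^ n" "spike t = real m' / 4 ^ n"
        using spike_quadic[of m n] unfolding t_def by blast
      have "h2 (\<alpha> j t) = \<alpha> (s j) (real m' / 4 ^ n)"
        using h2T[OF Suc.prems(1), of "\<alpha> j t"] \<psi>(3)[OF t01, of j] t m'(2) by simp
      then show ?case
        using Suc.IH[OF sJ[OF Suc.prems(1)] m'(1)] d(1) unfolding t_def[symmetric]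
        by (intro step[of "\<alpha> j t" "\<alpha> (s j) (real m' / 4 ^ n)"]) auto
    qed
    show ?thesis
    proof (rule step[of a "h2 a"])
      assume "h2 a \<in> T"
      then obtain j where j: "j \<in> J" "1/4 \<le> \<psi> j (h2 a)" "\<psi> j (h2 a) \<le> 3/4"
        by (auto simp: T_def)
      define \<tau> where "\<tau> = spike (\<psi> j (h2 a))"
      have \<tau>: "\<tau> \<in> {0..1}"
        unfolding \<tau>_def by (rule spike)
      obtain \<zeta> where \<zeta>: "0 < \<zeta>" "\<And>t. t \<in> {0..1} \<Longrightarrow> dist t \<tau> < \<zeta> \<Longrightarrow> dist (\<alpha> (s j) t) (\<alpha> (s j) \<tau>) < d / 2"
        using \<alpha>c[of "s j"] \<tau> d(1) unfolding continuous_on_iff by (meson half_gt_zero)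
      obtain n where n: "(1 / 4) ^ n < \<zeta>"
        using real_arch_pow_inv[OF \<zeta>(1), of "1/4"] by auto
      define m where "m = nat \<lfloor>\<tau> * 4 ^ n\<rfloor>"
      have m: "real m \<le> \<tau> * 4 ^ n" "\<tau> * 4 ^ n < real m + 1"
        using \<tau> by (auto simp: m_def of_nat_nat)
      have "real m \<le> 4 ^ n"
      proof -
        have "\<tau> * 4 ^ n \<le> 1 * 4 ^ n"
          using \<tau> by (intro mult_right_mono) auto
        then show ?thesis
          using m(1) by linarith
      qed
      then have m4: "m \<le> 4 ^ n"
        by simp
      have "\<bar>real m / 4 ^ n - \<tau>\<bar> \<le> (1 / 4) ^ n"
      proof -
        have "real m / 4 ^ n - \<tau> = (real m - \<tau> * 4 ^ n) / 4 ^ n"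
          by (simp add: field_simps)
        then have "\<bar>real m / 4 ^ n - \<tau>\<bar> = \<bar>real m - \<tau> * 4 ^ n\<bar> / 4 ^ n"
          by simp
        also have "\<dots> \<le> 1 / 4 ^ n"
          using m by (intro divide_right_mono) auto
        finally show ?thesis
          by (simp add: power_one_over)
      qed
      then have "dist (real m / 4 ^ n) \<tau> < \<zeta>"
        using n by (simp add: dist_real_def)
      moreover have "real m / 4 ^ n \<in> {0..1}"
        using \<open>real m \<le> 4 ^ n\<close> by simp
      ultimately have "dist (\<alpha> (s j) (real m / 4 ^ n)) (\<alpha> (s j) \<tau>) < d / 2"
        by (intro \<zeta>(2))
      then have "dist (h2 (h2 a)) (\<alpha> (s j) (real m / 4 ^ n)) < d / 2"
        using h2T[OF j] by (simp add: \<tau>_def dist_commute)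
      then show "\<exists>n. (h2 a, b) \<in> chain_step h2 d ^^ n"
        by (rule step) (rule quadic[OF sJ[OF j(1)] m4])
    qed (use d(1) in simp)
  qed
  obtain g where g: "continuous_on UNIV g" "exact_devaney_chaotic g" "\<And>x. dist (h2 x) (g x) < \<eta> / 2"
    using d(2)[of h2] h2(1) chains by blast
  have near: "dist (f0 x) (g x) < \<epsilon>" for x
  proof -
    have "dist (f0 x) (g x) \<le> dist (f0 x) (h0 x) + dist (h0 x) (h1 x) + dist (h1 x) (h2 x) + dist (h2 x) (g x)"
      using dist_triangle[of "f0 x" "g x" "h0 x"] dist_triangle[of "h0 x" "g x" "h1 x"]
        dist_triangle[of "h1 x" "g x" "h2 x"] by linarith
    also have "\<dots> < R / 8 + e + e + \<eta> / 2"
      using h0f0[of x] h1near[of x] h2(3) g(3)[of x] by (intro add_strict_mono) auto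
    also have "\<dots> \<le> \<epsilon>"
      using R'(2) \<eta>(2) \<open>0 < \<epsilon>\<close> by (simp add: e_def)
    finally show ?thesis .
  qed
  have mixing: "\<exists>N. \<forall>n\<ge>N. (f ^^ n) ` U \<inter> V \<noteq> {}"
    if f: "continuous_on UNIV f" "\<And>x. dist (g x) (f x) < \<eta> / 2" for f
  proof (intro exI allI impI)
    fix n
    assume "N \<le> n"
    then obtain j where j: "j \<in> J" "c j = u" "(s ^^ n) j = jv"
      using J(6) by blast
    \<comment> \<open>The crossings are known for \<open>h2\<close>; \<open>g\<close> and
      \<open>f\<close> each add an error of \<open>\<eta> / 2\<close>.\<close>
    have fh: "dist (h2 x) (f x) < \<eta>" for x
      using g(3)[of x] f(2)[of x] dist_triangle[of "h2 x" "f x" "g x"] by linarith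
    have cross: "crosses \<psi> f i (s i)" if i: "i \<in> J" for i
    proof -
      have "\<psi> (s i) (f x) \<le> 1/4" if "\<psi> i x = 1/4" for x
      proof -
        have "h2 x = \<alpha> (s i) 0"
          using h2T[OF i, of x] spike(3) that by simp
        then have "\<psi> (s i) (h2 x) = 0"
          using \<psi>(3)[of 0 "s i"] by simp
        then show ?thesis
          using \<eta>\<psi>[OF fh sJ[OF i], of x] by linarith
      qed
      moreover have "3/4 \<le> \<psi> (s i) (f x)" if "\<psi> i x = 1/2" for x
      proof -
        have "h2 x = \<alpha> (s i) 1"
          using h2T[OF i, of x] spike(4) that by simp
        then have "\<psi> (s i) (h2 x) = 1"
          using \<psi>(3)[of 1 "s i"] by simp
        then show ?thesis
          using \<eta>\<psi>[OF fh sJ[OF i], of x] by linarith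
      qed
      moreover have "1/4 \<in> {1/4..3/4 :: real}" "1/2 \<in> {1/4..3/4 :: real}"
        by auto
      ultimately show ?thesis
        unfolding crosses_def by blast
    qed
    have kJ: "(s ^^ i) j \<in> J" for i
      using j(1) sJ by (induction i) auto
    have img: "(\<lambda>t. \<psi> ((s ^^ 0) j) (\<alpha> j t)) ` {1/4..3/4} = {1/4..3/4}"
      using \<psi>(3)[of _ j] by (auto simp: image_iff)
    \<comment> \<open>The starting path is the arc at vertex \<open>j\<close>, a copy of
      \<open>u\<close>, from which exactly \<open>n\<close> edges lead to \<open>jv\<close>.\<close>
    have "\<exists>t\<in>{1/4..3/4}. \<forall>i\<le>n. \<psi> ((s ^^ i) j) ((f ^^ i) (\<alpha> j t)) \<in> {1/4..3/4}"
    proof (rule crossing_itinerary[where k = "\<lambda>i. (s ^^ i) j", OF f(1) \<psi>(1)])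
      show "crosses \<psi> f ((s ^^ i) j) ((s ^^ Suc i) j)" for i
        using cross[OF kJ[of i]] by simp
      show "continuous_on {1/4..3/4} (\<alpha> j)"
        using \<alpha>c by (rule continuous_on_subset) auto
    qed (use img in auto)
    then obtain t where t: "t \<in> {1/4..3/4}" "\<psi> ((s ^^ n) j) ((f ^^ n) (\<alpha> j t)) \<in> {1/4..3/4}"
      by blast
    have "(f ^^ n) (\<alpha> j t) \<in> W jv"
      using t(2) j(3) by (intro \<psi>W) auto
    then have "(f ^^ n) (\<alpha> j t) \<in> V"
      using WJ(1)[OF J(4)] J(5) \<kappa>(5) by blast
    moreover have "\<alpha> j t \<in> U"
    proof -
      have "\<alpha> j t \<in> W j"
        using t(1) by (intro \<alpha>W) auto
      then show ?thesis
        using WJ(1)[OF j(1)] j(2) \<kappa>(4) by blast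
    qed
    ultimately show "(f ^^ n) ` U \<inter> V \<noteq> {}"
      by blast
  qed
  show ?thesis
  proof (rule exI[of _ g], intro conjI allI)
    show "\<exists>\<eta>>0. \<forall>f. continuous_on UNIV f \<longrightarrow> (\<forall>x. dist (g x) (f x) < \<eta>) \<longrightarrow>
        (\<exists>N. \<forall>n\<ge>N. (f ^^ n) ` U \<inter> V \<noteq> {})"
      using mixing \<open>0 < \<eta> / 2\<close> by (intro exI[of _ "\<eta> / 2"]) blast
  qed (use g(1,2) near in blast)+
qed

end

subsection \<open>Spaces on which locally constant maps are dense\<close>

lemma (in peano_space) bcontfun_apply:
  fixes f :: "'a \<Rightarrow> 'a"
  assumes "continuous_on UNIV f"
  shows "apply_bcontfun (Bcontfun f) = f"
  using continuous_imp_bcontfun[OF compact_space assms] by (rule Bcontfun_inverse)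

text \<open>A strict pointwise bound passes to the supremum only as a weak one; hence the
  half.\<close>

lemma dist_bcontfun_less:
  fixes f g :: "'a::topological_space \<Rightarrow>\<^sub>C 'b::metric_space"
  assumes "\<And>x. dist (apply_bcontfun f x) (apply_bcontfun g x) < e / 2" "0 < e"
  shows "dist f g < e"
proof -
  have "dist f g \<le> e / 2"
    using assms(1) by (intro dist_bound) (simp add: less_imp_le)
  then show ?thesis
    using assms(2) by linarith
qed

lemma LC_maps_lc_on:
  assumes "f \<in> LC_maps"
  shows "lc_on UNIV (apply_bcontfun f)"
  unfolding lc_on_def
proof (intro allI impI, elim conjE)
  fix V :: "'a set"
  assume V: "open V" "V \<noteq> {}"
  obtain D where D: "closure D = UNIV" "\<And>x. x \<in> D \<Longrightarrow> \<exists>U. open U \<and> x \<in> U \<and> apply_bcontfun f constant_on U"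
    using assms unfolding LC_maps_def by blast
  have "D \<inter> V \<noteq> {}"
    using V D(1) by (metis Int_UNIV_right inf_commute open_Int_closure_eq_empty)
  then obtain x where x: "x \<in> D" "x \<in> V"
    by blast
  from D(2)[OF x(1)] obtain U where U: "open U" "x \<in> U" "apply_bcontfun f constant_on U"
    by blast
  then have "apply_bcontfun f constant_on (U \<inter> V)"
    unfolding constant_on_def by blast
  then show "\<exists>W. open W \<and> W \<noteq> {} \<and> W \<subseteq> V \<and> apply_bcontfun f constant_on W"
    using U V(1) x(2) by (intro exI[of _ "U \<inter> V"]) auto
qed

lemma (in peano_space) lc_dense_if_LC_maps_dense:
  fixes f :: "'a \<Rightarrow> 'a"
  assumes dense: "dense_in euclidean (LC_maps :: ('a \<Rightarrow>\<^sub>C 'a) set)" and f: "continuous_on UNIV f" and "0 < e"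
  shows "\<exists>h. continuous_on UNIV h \<and> lc_on UNIV h \<and> (\<forall>x. dist (f x) (h x) < e)"
proof -
  have "Bcontfun f \<in> closure LC_maps"
    using dense by (simp add: dense_in_def)
  then obtain h :: "'a \<Rightarrow>\<^sub>C 'a" where h: "h \<in> LC_maps" "dist h (Bcontfun f) < e"
    using \<open>0 < e\<close> unfolding closure_approachable by blast
  have "dist (f x) (apply_bcontfun h x) < e" for x
    using dist_bounded[of h x "Bcontfun f"] h(2) bcontfun_apply[OF f] by (simp add: dist_commute)
  then show ?thesis
    using LC_maps_lc_on[OF h(1)] by (intro exI[of _ "apply_bcontfun h"]) simp
qed

lemma (in peano_space) common_plateau:
  fixes \<phi> :: "nat \<Rightarrow> 'a \<Rightarrow> real"
  assumes c: "staircase c E" and \<phi>: "\<And>i. continuous_on UNIV (\<phi> i)" and V: "open V" "V \<noteq> {}"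
  shows "\<exists>W. open W \<and> W \<noteq> {} \<and> W \<subseteq> V \<and> (\<forall>i<n. (\<lambda>x. c (\<phi> i x)) constant_on W)"
proof (induction n)
  case 0
  then show ?case
    using V by blast
next
  case (Suc n)
  then obtain W where W: "open W" "W \<noteq> {}" "W \<subseteq> V" "\<forall>i<n. (\<lambda>x. c (\<phi> i x)) constant_on W"
    by blast
  have "continuous_on W (\<phi> n)"
    using \<phi> by (rule continuous_on_subset) simp
  from lc_on_staircase[OF c this W(1,2)]
  obtain W' where W': "open W'" "W' \<noteq> {}" "W' \<subseteq> W" "(\<lambda>x. c (\<phi> n x)) constant_on W'"
    by blast
  have "(\<lambda>x. c (\<phi> i x)) constant_on W'" if "i < Suc n" for i
    using W(4) W' that by (metis constant_on_subset less_Suc_eq)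
  then show ?case
    using W(3) W' by (intro exI[of _ W']) auto
qed

text \<open>Only finitely many coordinates in the Hilbert cube matter up to a small error, and each of them can be
  composed with a staircase.\<close>

lemma (in peano_space) lc_dense_if_ANR:
  fixes f :: "'a \<Rightarrow> 'a"
  assumes "compact_ANR (UNIV :: 'a set)" and f: "continuous_on UNIV f" and "0 < e"
  shows "\<exists>h. continuous_on UNIV h \<and> lc_on UNIV h \<and> (\<forall>x. dist (f x) (h x) < e)"
proof -
  obtain A U where AU: "A \<subseteq> U" "openin (top_of_set hilbert_cube) U" "A retract_of U" "(UNIV :: 'a set) homeomorphic A"
    using assms(1) unfolding compact_ANR_def by blast
  obtain r where r: "continuous_on U r" "\<And>x. x \<in> U \<Longrightarrow> r x \<in> A" "\<And>x. x \<in> A \<Longrightarrow> r x = x"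
    using AU(3) unfolding retract_of_def retraction_def by blast
  obtain \<phi> \<phi>' where hom: "homeomorphism (UNIV :: 'a set) A \<phi> \<phi>'"
    using AU(4) unfolding homeomorphic_def by blast
  then have \<phi>: "continuous_on UNIV \<phi>" "\<And>x. \<phi> x \<in> A" "continuous_on A \<phi>'" "\<And>x. \<phi>' (\<phi> x) = x"
    by (auto simp: homeomorphism_def)
  obtain O' where O': "open O'" "U = hilbert_cube \<inter> O'"
    using AU(2) by (auto simp: openin_open)
  have cube: "\<phi> x i \<in> {0..1}" for x i
    using \<phi>(2)[of x] AU(1) O'(2) by (auto simp: hilbert_cube_def)
  have "\<forall>n :: nat. \<exists>c E. staircase c E \<and> (\<forall>x\<in>{0..1}. \<bar>c x - x\<bar> \<le> 1 / Suc n)"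
    by (intro allI staircase_exists) simp
  then obtain c E where c: "\<And>n. staircase (c n) (E n)" "\<And>n x. x \<in> {0..1} \<Longrightarrow> \<bar>c n x - x\<bar> \<le> 1 / Suc n"
    by metis
  have c_cont: "continuous_on UNIV (c n)" and c01: "0 \<le> c n x" "c n x \<le> 1" for n x
    using c(1)[of n] by (simp_all add: staircase_def)
  have \<phi>f: "continuous_on UNIV (\<lambda>x. \<phi> (f x) i)" for i
  proof -
    have "continuous_on UNIV (\<lambda>x. \<phi> (f x))"
      by (rule continuous_on_compose2[OF \<phi>(1) f]) simp
    then show ?thesis
      by (rule continuous_on_product_then_coordinatewise)
  qed
  \<comment> \<open>Coordinates from \<open>n\<close> on are cut to 0, a small change in the product
    topology for large \<open>n\<close>. Thus \<open>g n\<close> takes a single value on any set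
    where the first \<open>n\<close> coordinates are constant.\<close>
  define g where "g n x = (\<lambda>i. if i < n then c n (\<phi> (f x) i) else 0)" for n x
  have g_cube: "g n x \<in> hilbert_cube" for n x
    using c01 by (simp add: g_def hilbert_cube_def)
  have g_cont: "continuous_on UNIV (g n)" for n
  proof (rule continuous_on_coordinatewise_then_product)
    show "continuous_on UNIV (\<lambda>x. g n x i)" for i
      unfolding g_def by (cases "i < n") (simp_all add: continuous_on_compose2[OF c_cont \<phi>f])
  qed
  define k where "k y = \<phi>' (r y)" for y
  have k_cont: "continuous_on U k"
    unfolding k_def by (rule continuous_on_compose2[OF \<phi>(3) r(1)]) (use r(2) in blast)
  \<comment> \<open>Compactness replaces a uniform estimate near the retract: counterexamples
    \<open>x n\<close> accumulate at some \<open>l\<close>, where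
    \<open>k (\<phi> (f l)) = f l\<close>.\<close>
  have "\<exists>n. \<forall>x. g n x \<in> U \<and> dist (f x) (k (g n x)) < e"
  proof (rule ccontr)
    assume "\<nexists>n. \<forall>x. g n x \<in> U \<and> dist (f x) (k (g n x)) < e"
    then have "\<forall>n. \<exists>x. \<not> (g n x \<in> U \<and> dist (f x) (k (g n x)) < e)"
      by blast
    then obtain x where x: "\<And>n. \<not> (g n (x n) \<in> U \<and> dist (f (x n)) (k (g n (x n))) < e)"
      by metis
    obtain l \<sigma> where l: "strict_mono (\<sigma> :: nat \<Rightarrow> nat)" "(x \<circ> \<sigma>) \<longlonglongrightarrow> l"
      using compact_space unfolding compact_def by (metis UNIV_I)
    have fl: "(\<lambda>n. f (x (\<sigma> n))) \<longlonglongrightarrow> f l"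
      using continuous_on_tendsto_compose[OF f l(2)] by simp
    have lim: "(\<lambda>n. g (\<sigma> n) (x (\<sigma> n)) i) \<longlonglongrightarrow> \<phi> (f l) i" for i
    proof -
      have 1: "(\<lambda>n. \<phi> (f (x (\<sigma> n))) i) \<longlonglongrightarrow> \<phi> (f l) i"
        using continuous_on_tendsto_compose[OF \<phi>f l(2)] by simp
      have 2: "(\<lambda>n. c (\<sigma> n) (\<phi> (f (x (\<sigma> n))) i) - \<phi> (f (x (\<sigma> n))) i) \<longlonglongrightarrow> 0"
      proof (rule Lim_null_comparison)
        show "\<forall>\<^sub>F n in sequentially. norm (c (\<sigma> n) (\<phi> (f (x (\<sigma> n))) i) - \<phi> (f (x (\<sigma> n))) i) \<le> 1 / Suc n"
        proof (intro always_eventually allI)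
          fix n
          have "1 / real (Suc (\<sigma> n)) \<le> 1 / Suc n"
            using seq_suble[OF l(1), of n] by (intro divide_left_mono) auto
          moreover have "\<bar>c (\<sigma> n) (\<phi> (f (x (\<sigma> n))) i) - \<phi> (f (x (\<sigma> n))) i\<bar> \<le> 1 / Suc (\<sigma> n)"
            by (rule c(2)[OF cube])
          ultimately show "norm (c (\<sigma> n) (\<phi> (f (x (\<sigma> n))) i) - \<phi> (f (x (\<sigma> n))) i) \<le> 1 / Suc n"
            unfolding real_norm_def by (rule order_trans[rotated])
        qed
        show "(\<lambda>n. 1 / real (Suc n)) \<longlonglongrightarrow> 0"
          by (rule LIMSEQ_inverse_real_of_nat[unfolded inverse_eq_divide])
      qed
      have "(\<lambda>n. c (\<sigma> n) (\<phi> (f (x (\<sigma> n))) i)) \<longlonglongrightarrow> \<phi> (f l) i"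
        using tendsto_add[OF 2 1] by simp
      moreover have "\<forall>\<^sub>F n in sequentially. c (\<sigma> n) (\<phi> (f (x (\<sigma> n))) i) = g (\<sigma> n) (x (\<sigma> n)) i"
        unfolding eventually_sequentially
      proof (intro exI[of _ "Suc i"] allI impI)
        fix n
        assume "Suc i \<le> n"
        then have "i < \<sigma> n"
          using seq_suble[OF l(1), of n] by linarith
        then show "c (\<sigma> n) (\<phi> (f (x (\<sigma> n))) i) = g (\<sigma> n) (x (\<sigma> n)) i"
          by (simp add: g_def)
      qed
      ultimately show ?thesis
        by (rule Lim_transform_eventually)
    qed
    have glim: "(\<lambda>n. g (\<sigma> n) (x (\<sigma> n))) \<longlonglongrightarrow> \<phi> (f l)"
    proof -
      have "limitin (product_topology (\<lambda>i. euclidean) UNIV) (\<lambda>n. g (\<sigma> n) (x (\<sigma> n))) (\<phi> (f l)) sequentially"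
        unfolding limitin_componentwise using lim by (simp add: limitin_canonical_iff)
      then show ?thesis
        by (simp add: euclidean_product_topology limitin_canonical_iff)
    qed
    have limU: "\<phi> (f l) \<in> U"
      using \<phi>(2) AU(1) by blast
    have inU: "\<forall>\<^sub>F n in sequentially. g (\<sigma> n) (x (\<sigma> n)) \<in> U"
    proof -
      have "\<forall>\<^sub>F n in sequentially. g (\<sigma> n) (x (\<sigma> n)) \<in> O'"
        using topological_tendstoD[OF glim O'(1)] limU O'(2) by blast
      then show ?thesis
        using g_cube O'(2) by (simp add: eventually_mono)
    qed
    have "(\<lambda>n. k (g (\<sigma> n) (x (\<sigma> n)))) \<longlonglongrightarrow> k (\<phi> (f l))"
      by (rule continuous_on_tendsto_compose[OF k_cont glim limU inU])
    moreover have "k (\<phi> (f l)) = f l"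
      using r(3)[OF \<phi>(2)] \<phi>(4) by (simp add: k_def)
    ultimately have "(\<lambda>n. dist (f (x (\<sigma> n))) (k (g (\<sigma> n) (x (\<sigma> n))))) \<longlonglongrightarrow> dist (f l) (f l)"
      using fl by (intro tendsto_dist) simp_all
    then have "\<forall>\<^sub>F n in sequentially. dist (f (x (\<sigma> n))) (k (g (\<sigma> n) (x (\<sigma> n)))) < e"
      using \<open>0 < e\<close> by (intro order_tendstoD(2)) auto
    with inU have "\<forall>\<^sub>F n in sequentially. False"
      by eventually_elim (use x in blast)
    then show False
      by simp
  qed
  then obtain n where n: "\<And>x. g n x \<in> U" "\<And>x. dist (f x) (k (g n x)) < e"
    by blast
  have "continuous_on UNIV (\<lambda>x. k (g n x))"
    by (rule continuous_on_compose2[OF k_cont g_cont]) (use n(1) in blast)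
  moreover have "lc_on UNIV (\<lambda>x. k (g n x))"
    unfolding lc_on_def
  proof (intro allI impI, elim conjE)
    fix V :: "'a set"
    assume V: "open V" "V \<noteq> {}"
    obtain W where W: "open W" "W \<noteq> {}" "W \<subseteq> V" "\<forall>i<n. (\<lambda>x. c n (\<phi> (f x) i)) constant_on W"
      using common_plateau[where \<phi> = "\<lambda>i x. \<phi> (f x) i" and n = n, OF c(1)[of n] \<phi>f V] by (elim exE conjE) (rule that)
    have "\<forall>i. \<exists>y. i < n \<longrightarrow> (\<forall>x\<in>W. c n (\<phi> (f x) i) = y)"
      using W(4) unfolding constant_on_def by blast
    then obtain y where y: "\<And>i x. i < n \<Longrightarrow> x \<in> W \<Longrightarrow> c n (\<phi> (f x) i) = y i"
      by metis
    have "k (g n x) = k (\<lambda>i. if i < n then y i else 0)" if "x \<in> W" for x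
    proof -
      have "g n x = (\<lambda>i. if i < n then y i else 0)"
        unfolding g_def using y that by auto
      then show ?thesis
        by simp
    qed
    then have "(\<lambda>x. k (g n x)) constant_on W"
      unfolding constant_on_def by blast
    then show "\<exists>W. open W \<and> W \<noteq> {} \<and> W \<subseteq> V \<and> (\<lambda>x. k (g n x)) constant_on W"
      using W by blast
  qed
  ultimately show ?thesis
    using n(2) by blast
qed

lemma covering_dim_eq_1D:
  assumes "covering_dim X = 1"
  shows "covering_dim_le X 1"
proof -
  let ?S = "{enat n |n. covering_dim_le X n}"
  have "?S \<noteq> {}"
  proof
    assume "?S = {}"
    then have "covering_dim X = \<infinity>"
      unfolding covering_dim_def by (simp add: Inf_enat_def)
    then show False
      using assms by simp
  qed
  then have "Inf ?S \<in> ?S"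
    unfolding Inf_enat_def by (metis (mono_tags, lifting) LeastI_ex ex_in_conv)
  then have "(1 :: enat) \<in> ?S"
    using assms by (simp add: covering_dim_def)
  then show ?thesis
    by (auto simp: one_enat_def)
qed

text \<open>A cover of order two gives a map that factors through a graph: where the partition functions of two
  members \<open>V\<close> and \<open>V'\<close> add up to 1, follow a path from \<open>p V\<close> to \<open>p V'\<close>.\<close>

lemma (in peano_space) lc_dense_if_dim_1:
  fixes f :: "'a \<Rightarrow> 'a"
  assumes dim: "covering_dim_le (euclidean :: 'a topology) 1" and f: "continuous_on UNIV f" and "0 < e"
  shows "\<exists>h. continuous_on UNIV h \<and> lc_on UNIV h \<and> (\<forall>x. dist (f x) (h x) < e)"
proof -
  \<comment> \<open>The final error is \<open>R / 2\<close> within a cover member, \<open>R\<close>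
    between adjacent vertices and \<open>e / 4\<close> along an edge path, with
    \<open>R \<le> e / 4\<close>.\<close>
  obtain R where "covering_radius TYPE('a) (e / 4) R"
    using covering_radius_exists[of "e / 4"] \<open>0 < e\<close> by auto
  then have R: "0 < R" "R \<le> e / 4" "\<And>p q :: 'a. dist p q < R \<Longrightarrow>
      \<exists>\<gamma>. path \<gamma> \<and> \<gamma> 0 = p \<and> \<gamma> 1 = q \<and> path_image \<gamma> \<subseteq> ball p (e / 4)"
    unfolding covering_radius_def pathstart_def pathfinish_def by blast+
  have "uniformly_continuous_on UNIV f"
    using f compact_space by (rule compact_uniformly_continuous)
  then obtain \<delta> where \<delta>: "0 < \<delta>" "\<And>x y. dist x y < \<delta> \<Longrightarrow> dist (f x) (f y) < R / 2"
    using R(1) unfolding uniformly_continuous_on_def by (metis UNIV_I dist_commute half_gt_zero)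
  have "0 < \<delta> / 2"
    using \<delta>(1) by simp
  from finite_net[OF this, of UNIV]
  obtain X0 :: "'a set" where X0: "finite X0" "UNIV \<subseteq> (\<Union>x\<in>X0. ball x (\<delta> / 2))"
    by blast
  have "finite ((\<lambda>x. ball x (\<delta> / 2)) ` X0) \<and> (\<forall>U\<in>(\<lambda>x. ball x (\<delta> / 2)) ` X0. openin euclidean U) \<and>
      \<Union>((\<lambda>x. ball x (\<delta> / 2)) ` X0) = topspace euclidean"
    using X0 by auto
  from dim[unfolded covering_dim_le_def, rule_format, OF this]
  obtain \<V> where \<V>0: "finite \<V>" "\<forall>V\<in>\<V>. openin (euclidean :: 'a topology) V" "\<Union>\<V> = topspace euclidean"
    "\<forall>V\<in>\<V>. \<exists>U\<in>(\<lambda>x. ball x (\<delta> / 2)) ` X0. V \<subseteq> U"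
    "\<forall>x\<in>topspace euclidean. card {V \<in> \<V>. x \<in> V} \<le> 1 + 1"
    by (elim exE conjE) (rule that)
  then have \<V>: "finite \<V>" "\<And>V. V \<in> \<V> \<Longrightarrow> open V" "\<Union>\<V> = (UNIV :: 'a set)"
    "\<forall>V\<in>\<V>. \<exists>U\<in>(\<lambda>x. ball x (\<delta> / 2)) ` X0. V \<subseteq> U" "\<And>x. card {V \<in> \<V>. x \<in> V} \<le> 2"
    by (simp_all add: numeral_2_eq_2)
  have inV: "\<exists>V\<in>\<V>. x \<in> V" for x
  proof -
    have "x \<in> \<Union>\<V>"
      unfolding \<V>(3) by simp
    then show ?thesis
      by blast
  qed
  have small: "dist (f x) (f y) < R / 2" if "V \<in> \<V>" "x \<in> V" "y \<in> V" for V x y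
  proof -
    obtain a where "V \<subseteq> ball a (\<delta> / 2)"
      using \<V>(4) \<open>V \<in> \<V>\<close> by blast
    then have "dist a x < \<delta> / 2" "dist a y < \<delta> / 2"
      using \<open>x \<in> V\<close> \<open>y \<in> V\<close> by auto
    then show ?thesis
      using dist_triangle3[of x y a] by (intro \<delta>(2)) linarith
  qed
  obtain F :: "'a set \<Rightarrow> 'a \<Rightarrow> real" where F0: "\<And>V. V \<in> \<V> \<Longrightarrow> continuous_on UNIV (F V) \<and> (\<forall>x\<in>UNIV. 0 \<le> F V x)"
    "\<And>x V. V \<in> \<V> \<Longrightarrow> x \<in> UNIV \<Longrightarrow> x \<notin> V \<Longrightarrow> F V x = 0"
    "\<And>x. x \<in> UNIV \<Longrightarrow> supp_sum (\<lambda>W. F W x) \<V> = 1"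
  proof (rule subordinate_partition_of_unity[of "UNIV :: 'a set" \<V>])
    show "\<exists>V. open V \<and> x \<in> V \<and> finite {U \<in> \<V>. U \<inter> V \<noteq> {}}" for x
      using \<V>(1) by (intro exI[of _ UNIV]) simp
  qed (use \<V>(2,3) in auto)
  have F: "continuous_on UNIV (F V)" "0 \<le> F V x" "x \<notin> V \<Longrightarrow> F V x = 0" if "V \<in> \<V>" for V x
    using F0(1,2)[OF that] by auto
  have Fsum: "(\<Sum>V\<in>{V \<in> \<V>. x \<in> V}. F V x) = 1" for x
  proof -
    have "(\<Sum>V\<in>{V \<in> \<V>. x \<in> V}. F V x) = (\<Sum>V\<in>{V \<in> \<V>. F V x \<noteq> 0}. F V x)"
      using \<V>(1) F(3) by (intro sum.mono_neutral_right) auto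
    then show ?thesis
      using F0(3)[of x] by (simp add: supp_sum_def support_on_def)
  qed
  have pair: "F V x + F V' x = 1" if "V \<in> \<V>" "V' \<in> \<V>" "V \<noteq> V'" "x \<in> V" "x \<in> V'" for V V' x
  proof -
    have "{V, V'} = {V \<in> \<V>. x \<in> V}"
    proof (rule card_seteq)
      show "card {V \<in> \<V>. x \<in> V} \<le> card {V, V'}"
        using \<V>(5)[of x] that(3) by simp
    qed (use that \<V>(1) in auto)
    then have "(\<Sum>V\<in>{V, V'}. F V x) = 1"
      using Fsum[of x] by simp
    then show ?thesis
      using that(3) by simp
  qed
  have other: "V' = V \<or> F V' x = 0" if "V \<in> \<V>" "V' \<in> \<V>" "F V x = 1" for V V' x
  proof (cases "V' = V \<or> x \<notin> V'")
    case False
    then have "x \<in> V"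
      using F(3)[OF that(1), of x] that(3) by force
    then show ?thesis
      using pair[OF that(1,2), of x] False that(3) by auto
  qed (use F(3)[OF that(2)] in auto)
  \<comment> \<open>The numbering orients the edges: of \<open>(V, V')\<close> and
    \<open>(V', V)\<close> with distinct members only one enters \<open>P\<close>.\<close>
  obtain idx :: "'a set \<Rightarrow> nat" where idx: "inj_on idx \<V>"
    using finite_imp_inj_to_nat_seg[OF \<V>(1)] by blast
  define v where "v V = (SOME x. x \<in> V)" for V :: "'a set"
  have v: "v V \<in> V" if "x \<in> V" for x V
    unfolding v_def using that by (rule someI)
  define p where "p V = f (v V)" for V
  define P where "P = {(V, V') \<in> \<V> \<times> \<V>. V \<inter> V' \<noteq> {} \<and> idx V \<le> idx V'}"
  have finP: "finite P"
    unfolding P_def using \<V>(1) by (auto intro: finite_subset[of _ "\<V> \<times> \<V>"])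
  have dist_p: "dist (p V) (p V') < R" if "(V, V') \<in> P" for V V'
  proof -
    from that obtain w where w: "V \<in> \<V>" "V' \<in> \<V>" "w \<in> V" "w \<in> V'"
      by (auto simp: P_def)
    have "dist (p V) (f w) < R / 2" "dist (p V') (f w) < R / 2"
      unfolding p_def using small[OF w(1) v[OF w(3)] w(3)] small[OF w(2) v[OF w(4)] w(4)] .
    then show ?thesis
      using dist_triangle2[of "p V" "p V'" "f w"] by linarith
  qed
  have "\<forall>q. \<exists>\<gamma>. q \<in> P \<longrightarrow> path \<gamma> \<and> \<gamma> 0 = p (fst q) \<and> \<gamma> 1 = p (snd q) \<and> path_image \<gamma> \<subseteq> ball (p (fst q)) (e / 4)"
    using R(3) dist_p by (metis prod.collapse)
  then obtain \<gamma> where \<gamma>: "\<And>q. q \<in> P \<Longrightarrow> path (\<gamma> q)" "\<And>q. q \<in> P \<Longrightarrow> \<gamma> q 0 = p (fst q)"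
    "\<And>q. q \<in> P \<Longrightarrow> \<gamma> q 1 = p (snd q)" "\<And>q. q \<in> P \<Longrightarrow> path_image (\<gamma> q) \<subseteq> ball (p (fst q)) (e / 4)"
    by metis
  obtain c E where c: "staircase c E"
    using staircase_exists[of 1] by auto
  have c_props: "c t \<in> {0..1}" "continuous_on UNIV c" "c 1 = 1" "c 0 = 0" for t
    using c by (simp_all add: staircase_def)
  \<comment> \<open>Closed pieces indexed by the nerve: pairs \<open>(V, V)\<close> stand for its
    vertices, proper pairs for its edges.\<close>
  define A where "A q = {x. (if fst q = snd q then F (fst q) x else F (fst q) x + F (snd q) x) = 1}" for q
  define H where "H q x = (if fst q = snd q then p (fst q) else \<gamma> q (c (F (snd q) x)))" for q x
  have PV: "fst q \<in> \<V>" "snd q \<in> \<V>" if "q \<in> P" for q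
    using that by (auto simp: P_def)
  have closedA: "closed (A q)" if "q \<in> P" for q
  proof (cases "fst q = snd q")
    case True
    then show ?thesis
      unfolding A_def using F(1)[OF PV(1)[OF that]] by (simp add: closed_Collect_eq)
  next
    case False
    then show ?thesis
      unfolding A_def using F(1)[OF PV(1)[OF that]] F(1)[OF PV(2)[OF that]]
      by (simp add: closed_Collect_eq continuous_on_add)
  qed
  have contH: "continuous_on (A q) (H q)" if "q \<in> P" for q
  proof (cases "fst q = snd q")
    case True
    then show ?thesis
      unfolding H_def by simp
  next
    case False
    have "continuous_on (A q) (\<lambda>x. c (F (snd q) x))"
      by (rule continuous_on_compose2[OF c_props(2) continuous_on_subset[OF F(1)[OF PV(2)[OF that]]]]) simp_all
    then have "continuous_on (A q) (\<lambda>x. \<gamma> q (c (F (snd q) x)))"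
      by (rule continuous_on_compose2[OF \<gamma>(1)[OF that, unfolded path_def]]) (use c_props(1) in blast)
    then show ?thesis
      unfolding H_def using False by simp
  qed
  \<comment> \<open>Different pieces can meet over a vertex. There \<open>c 0 = 0\<close> and
    \<open>c 1 = 1\<close> put every edge path at the end that belongs to this vertex.\<close>
  have H_vertex: "H q x = p V" if q: "q \<in> P" "x \<in> A q" and V: "V \<in> \<V>" "F V x = 1" for q x V
  proof (cases "fst q = snd q")
    case True
    then have "F (fst q) x = 1"
      using q(2) by (simp add: A_def)
    then have "fst q = V"
      using other[OF V(1) PV(1)[OF q(1)] V(2)] by auto
    then show ?thesis
      using True by (simp add: H_def)
  next
    case False
    then have sum: "F (fst q) x + F (snd q) x = 1"
      using q(2) by (simp add: A_def)
    show ?thesis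
    proof (cases "snd q = V")
      case True
      then show ?thesis
        using False V(2) \<gamma>(3)[OF q(1)] c_props(3) by (simp add: H_def)
    next
      case snd: False
      then have "F (snd q) x = 0"
        using other[OF V(1) PV(2)[OF q(1)] V(2)] by auto
      then have "fst q = V"
        using other[OF V(1) PV(1)[OF q(1)] V(2)] sum by auto
      then show ?thesis
        using False \<open>F (snd q) x = 0\<close> \<gamma>(2)[OF q(1)] c_props(4) by (simp add: H_def)
    qed
  qed
  have edge: "fst q \<noteq> snd q \<and> x \<in> fst q \<and> x \<in> snd q" if q: "q \<in> P" "x \<in> A q" and no: "\<forall>V\<in>\<V>. F V x \<noteq> 1" for q x
  proof -
    have ne: "fst q \<noteq> snd q"
      using q no PV(1)[OF q(1)] by (auto simp: A_def)
    then have sum: "F (fst q) x + F (snd q) x = 1"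
      using q(2) by (simp add: A_def)
    have "x \<in> fst q"
    proof (rule ccontr)
      assume "x \<notin> fst q"
      then have "F (snd q) x = 1"
        using F(3)[OF PV(1)[OF q(1)]] sum by auto
      then show False
        using no PV(2)[OF q(1)] by blast
    qed
    moreover have "x \<in> snd q"
    proof (rule ccontr)
      assume "x \<notin> snd q"
      then have "F (fst q) x = 1"
        using F(3)[OF PV(2)[OF q(1)]] sum by auto
      then show False
        using no PV(1)[OF q(1)] by blast
    qed
    ultimately show ?thesis
      using ne by blast
  qed
  \<comment> \<open>Away from the vertices a point lies in exactly two members, which together with
    the orientation determine the edge.\<close>
  have consistent: "H q x = H q' x" if q: "q \<in> P" "x \<in> A q" and q': "q' \<in> P" "x \<in> A q'" for q q' x
  proof (cases "\<exists>V\<in>\<V>. F V x = 1")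
    case True
    then show ?thesis
      using H_vertex[OF q] H_vertex[OF q'] by metis
  next
    case False
    have two: "{fst q, snd q} = {V \<in> \<V>. x \<in> V}" if "q \<in> P" "x \<in> A q" for q
    proof (rule card_seteq)
      have "fst q \<noteq> snd q \<and> x \<in> fst q \<and> x \<in> snd q"
        using edge[OF that] False by blast
      then show "{fst q, snd q} \<subseteq> {V \<in> \<V>. x \<in> V}" "card {V \<in> \<V>. x \<in> V} \<le> card {fst q, snd q}"
        using PV[OF that(1)] \<V>(5)[of x] by auto
    qed (use \<V>(1) in simp)
    have eq: "{fst q, snd q} = {fst q', snd q'}"
      using two[OF q] two[OF q'] by simp
    have le: "idx (fst q) \<le> idx (snd q)" "idx (fst q') \<le> idx (snd q')"
      using q(1) q'(1) by (auto simp: P_def)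
    have "q = q'"
    proof (rule ccontr)
      assume "q \<noteq> q'"
      then have sw: "fst q = snd q'" "snd q = fst q'"
        using eq by (auto simp: doubleton_eq_iff prod_eq_iff)
      then have "idx (fst q) = idx (snd q)"
        using le by simp
      then have "fst q = snd q"
        using idx PV[OF q(1)] by (auto simp: inj_on_def)
      then show False
        using sw \<open>q \<noteq> q'\<close> by (simp add: prod_eq_iff)
    qed
    then show ?thesis
      by simp
  qed
  have inP: "\<exists>q\<in>P. {fst q, snd q} = {V, V'}" if "V \<in> \<V>" "V' \<in> \<V>" "x \<in> V" "x \<in> V'" for V V' x
  proof (cases "idx V \<le> idx V'")
    case True
    then show ?thesis
      using that by (intro bexI[of _ "(V, V')"]) (auto simp: P_def)
  next
    case False
    then show ?thesis
      using that by (intro bexI[of _ "(V', V)"]) (auto simp: P_def)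
  qed
  have inA: "x \<in> A q" if "q \<in> P" "fst q \<noteq> snd q" "x \<in> fst q" "x \<in> snd q" for q x
    unfolding A_def using pair[OF PV[OF that(1)] that(2-4)] that(2) by simp
  have cover: "\<exists>q\<in>P. x \<in> A q" for x
  proof -
    obtain V where V: "V \<in> \<V>" "x \<in> V"
      using inV by blast
    show ?thesis
    proof (cases "\<exists>V'\<in>\<V>. V' \<noteq> V \<and> x \<in> V'")
      case True
      then obtain V' where V': "V' \<in> \<V>" "V' \<noteq> V" "x \<in> V'"
        by blast
      obtain q where q: "q \<in> P" "{fst q, snd q} = {V, V'}"
        using inP[OF V(1) V'(1) V(2) V'(3)] by blast
      have "x \<in> A q"
        using q V V' by (intro inA) (auto simp: doubleton_eq_iff)
      then show ?thesis
        using q(1) by blast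
    next
      case False
      then have "{V \<in> \<V>. x \<in> V} = {V}"
        using V by blast
      then have "F V x = 1"
        using Fsum[of x] by simp
      then have "x \<in> A (V, V)"
        by (simp add: A_def)
      moreover have "(V, V) \<in> P"
        using V by (auto simp: P_def)
      ultimately show ?thesis
        by blast
    qed
  qed
  define h where "h x = H (SOME q. q \<in> P \<and> x \<in> A q) x" for x
  have h: "h x = H q x" if "q \<in> P" "x \<in> A q" for q x
  proof -
    have "(SOME q. q \<in> P \<and> x \<in> A q) \<in> P \<and> x \<in> A (SOME q. q \<in> P \<and> x \<in> A q)"
      by (rule someI[of "\<lambda>q. q \<in> P \<and> x \<in> A q" q]) (use that in simp)
    then show ?thesis
      unfolding h_def using consistent that by blast
  qed
  have "continuous_on (\<Union>q\<in>P. A q) h"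
  proof (rule continuous_on_closed_Union[OF finP closedA])
    show "continuous_on (A q) h" if "q \<in> P" for q
      by (rule continuous_on_eq[OF contH[OF that]]) (rule h[OF that, symmetric])
  qed
  moreover have "(\<Union>q\<in>P. A q) = UNIV"
    using cover by (intro UNIV_eq_I[symmetric] UN_iff[THEN iffD2])
  ultimately have "continuous_on UNIV h"
    by simp
  moreover have "dist (f x) (h x) < e" for x
  proof -
    obtain q where q: "q \<in> P" "x \<in> A q"
      using cover by blast
    have "x \<in> fst q \<or> x \<in> snd q"
    proof (rule ccontr)
      assume "\<not> (x \<in> fst q \<or> x \<in> snd q)"
      then have "F (fst q) x = 0" "F (snd q) x = 0"
        using F(3) PV[OF q(1)] by blast+
      then show False
        using q(2) by (auto simp: A_def split: if_splits)
    qed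
    then have "dist (f x) (p (fst q)) < R / 2 + R"
    proof
      assume "x \<in> fst q"
      then have "dist (f x) (p (fst q)) < R / 2"
        using small[OF PV(1)[OF q(1)] \<open>x \<in> fst q\<close> v[OF \<open>x \<in> fst q\<close>]] by (simp only: p_def)
      then show ?thesis
        using R(1) by linarith
    next
      assume "x \<in> snd q"
      then have "dist (f x) (p (snd q)) < R / 2"
        using small[OF PV(2)[OF q(1)] \<open>x \<in> snd q\<close> v[OF \<open>x \<in> snd q\<close>]] by (simp only: p_def)
      moreover have "dist (p (fst q)) (p (snd q)) < R"
        using dist_p[of "fst q" "snd q"] q(1) by simp
      ultimately show ?thesis
        using dist_triangle2[of "f x" "p (fst q)" "p (snd q)"] by linarith
    qed
    moreover have "dist (p (fst q)) (h x) < e / 4"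
    proof (cases "fst q = snd q")
      case True
      then show ?thesis
        using h[OF q] \<open>0 < e\<close> by (simp add: H_def)
    next
      case False
      have "\<gamma> q (c (F (snd q) x)) \<in> path_image (\<gamma> q)"
        using c_props(1) unfolding path_image_def by blast
      then show ?thesis
        using \<gamma>(4)[OF q(1)] h[OF q] False by (auto simp: H_def)
    qed
    ultimately show ?thesis
      using R(2) \<open>0 < e\<close> dist_triangle[of "f x" "h x" "p (fst q)"] by linarith
  qed
  moreover have "lc_on UNIV h"
    unfolding lc_on_def
  proof (intro allI impI, elim conjE)
    fix U :: "'a set"
    assume U: "open U" "U \<noteq> {}"
    show "\<exists>W. open W \<and> W \<noteq> {} \<and> W \<subseteq> U \<and> h constant_on W"
    \<comment> \<open>Either \<open>U\<close> meets an overlap of two members, where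
      \<open>h\<close> depends on a staircase of one function, or near a point of \<open>U\<close>
      only one member is present and \<open>h\<close> is at its vertex.\<close>
    proof (cases "\<exists>q\<in>P. fst q \<noteq> snd q \<and> U \<inter> fst q \<inter> snd q \<noteq> {}")
      case True
      then obtain q where q: "q \<in> P" "fst q \<noteq> snd q" "U \<inter> fst q \<inter> snd q \<noteq> {}"
        by blast
      have "open (U \<inter> fst q \<inter> snd q)"
        using U(1) \<V>(2) PV[OF q(1)] by blast
      moreover have "continuous_on (U \<inter> fst q \<inter> snd q) (F (snd q))"
        using F(1)[OF PV(2)[OF q(1)]] by (rule continuous_on_subset) simp
      ultimately obtain W where W: "open W" "W \<noteq> {}" "W \<subseteq> U \<inter> fst q \<inter> snd q" "(\<lambda>x. c (F (snd q) x)) constant_on W"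
        using lc_on_staircase[OF c _ _ q(3)] by blast
      obtain y where y: "\<And>x. x \<in> W \<Longrightarrow> c (F (snd q) x) = y"
        using W(4) unfolding constant_on_def by blast
      have "h x = \<gamma> q y" if "x \<in> W" for x
      proof -
        have "x \<in> A q"
          using W(3) that q(2) by (intro inA[OF q(1)]) auto
        then show ?thesis
          using h[OF q(1)] y[OF that] q(2) by (simp add: H_def)
      qed
      then have "h constant_on W"
        unfolding constant_on_def by blast
      then show ?thesis
        using W by blast
    next
      case False
      obtain x where "x \<in> U"
        using U(2) by blast
      obtain V where V: "V \<in> \<V>" "x \<in> V"
        using inV by blast
      have "h y = p V" if y: "y \<in> U \<inter> V" for y
      proof -
        have "V' = V" if "V' \<in> \<V>" "y \<in> V'" for V'
        proof (rule ccontr)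
          assume "V' \<noteq> V"
          from inP[OF V(1) that(1) _ that(2)] y
          obtain q where q: "q \<in> P" "{fst q, snd q} = {V, V'}"
            by blast
          then have "fst q \<noteq> snd q \<and> y \<in> fst q \<and> y \<in> snd q"
            using \<open>V' \<noteq> V\<close> y that(2) by (auto simp: doubleton_eq_iff)
          then show False
            using False q(1) y by blast
        qed
        then have "{V \<in> \<V>. y \<in> V} = {V}"
          using V(1) y by blast
        then have "F V y = 1"
          using Fsum[of y] by simp
        moreover obtain q where "q \<in> P" "y \<in> A q"
          using cover by blast
        ultimately show ?thesis
          using h H_vertex V(1) by metis
      qed
      then have "h constant_on (U \<inter> V)"
        unfolding constant_on_def by blast
      then show ?thesis
        using U(1) \<V>(2)[OF V(1)] \<open>x \<in> U\<close> V(2) by (intro exI[of _ "U \<inter> V"]) auto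
    qed
  qed
  ultimately show ?thesis
    by blast
qed

subsection \<open>Dense and comeager sets of maps\<close>

text \<open>Near every map the condition \<open>A k\<close> holds on a nonempty relatively open set,
  so the maps violating it form a nowhere dense set. This set is intersected with
  \<open>M - S\<close> because \<open>meager_in\<close> asks for a union equal to the given
  set.\<close>

lemma comeager_inI:
  fixes M :: "'m::metric_space set"
  assumes K: "countable K" and S: "S \<subseteq> M" "\<And>f. f \<in> M \<Longrightarrow> (\<And>k. k \<in> K \<Longrightarrow> f \<in> A k) \<Longrightarrow> f \<in> S"
    and dense: "\<And>k f e. k \<in> K \<Longrightarrow> f \<in> M \<Longrightarrow> 0 < e \<Longrightarrow>
      \<exists>g\<in>M. dist f g < e \<and> (\<exists>\<eta>>0. \<forall>f'\<in>M. dist g f' < \<eta> \<longrightarrow> f' \<in> A k)"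
  shows "comeager_in (top_of_set M) S"
proof -
  let ?T = "top_of_set M"
  define N where "N k = (M - S) - A k" for k
  have "nowhere_dense_in ?T (N k)" if k: "k \<in> K" for k
  proof -
    have "?T interior_of (?T closure_of N k) = {}"
    proof (rule ccontr)
      assume "?T interior_of (?T closure_of N k) \<noteq> {}"
      then obtain f where f: "f \<in> ?T interior_of (?T closure_of N k)"
        by blast
      have "openin ?T (?T interior_of (?T closure_of N k))"
        by (rule openin_interior_of)
      then obtain O' where O': "open O'" "?T interior_of (?T closure_of N k) = M \<inter> O'"
        unfolding openin_open by blast
      have "f \<in> M" "f \<in> O'"
        using f O'(2) by blast+
      then obtain e where e: "0 < e" "ball f e \<subseteq> O'"
        using O'(1) openE by blast
      obtain g \<eta> where g: "g \<in> M" "dist f g < e" "0 < \<eta>" "\<forall>f'\<in>M. dist g f' < \<eta> \<longrightarrow> f' \<in> A k"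
        using dense[OF k \<open>f \<in> M\<close> e(1)] by blast
      have "g \<in> O'"
        using e(2) g(2) by (auto simp: subset_iff)
      then have "g \<in> ?T interior_of (?T closure_of N k)"
        using g(1) O'(2) by blast
      then have "g \<in> ?T closure_of N k"
        using interior_of_subset[of ?T "?T closure_of N k"] by blast
      moreover have "openin ?T (M \<inter> ball g \<eta>)"
        by (auto simp: openin_open)
      moreover have "g \<in> M \<inter> ball g \<eta>"
        using g(1,3) by simp
      ultimately obtain f' where "f' \<in> N k" "f' \<in> M \<inter> ball g \<eta>"
        unfolding in_closure_of by blast
      then show False
        using g(4) by (auto simp: N_def)
    qed
    then show ?thesis
      unfolding nowhere_dense_in_def by (auto simp: N_def)
  qed
  moreover have "M - S = \<Union>(N ` K)"
    using S(2) by (auto simp: N_def)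
  ultimately have "meager_in ?T (M - S)"
    unfolding meager_in_def using K by (intro exI[of _ "N ` K"]) auto
  then show ?thesis
    unfolding comeager_in_def using S(1) by simp
qed

text \<open>The first step may jump anywhere in \<open>ball (f a) d\<close>, and some point of this
  ball has \<open>b\<close> in its orbit. So the exact approximations stay in
  \<open>CT_maps\<close>.\<close>

lemma exact_map_chain_transitive:
  fixes f :: "'a::metric_space \<Rightarrow> 'a"
  assumes "exact_map f"
  shows "chain_transitive f"
  unfolding chain_transitive_iff
proof (intro allI impI)
  fix a b :: 'a and d :: real
  assume "0 < d"
  then obtain n where n: "(f ^^ n) ` ball (f a) d = UNIV"
    using assms unfolding exact_map_def by (metis ball_eq_empty linorder_not_le open_ball)
  then have "b \<in> (f ^^ n) ` ball (f a) d"
    by simp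
  then obtain q where q: "q \<in> ball (f a) d" "b = (f ^^ n) q"
    by blast
  have "(a, q) \<in> chain_step f d"
    using q(1) by (simp add: chain_step_def)
  then have "(a, b) \<in> chain_step f d ^^ Suc n"
    using funpow_chain[OF \<open>0 < d\<close>, of q n f] q(2) by (intro relpow_Suc_I2) auto
  then show "\<exists>n. (a, b) \<in> chain_step f d ^^ n"
    by blast
qed

text \<open>Here both the first and the last step are jumps, since \<open>b\<close> is only
  approached.\<close>

lemma mixing_map_chain_transitive:
  fixes f :: "'a::metric_space \<Rightarrow> 'a"
  assumes "mixing_map f"
  shows "chain_transitive f"
  unfolding chain_transitive_iff
proof (intro allI impI)
  fix a b :: 'a and d :: real
  assume "0 < d"
  then have "open (ball (f a) d)" "ball (f a) d \<noteq> {}" "open (ball b d)" "ball b d \<noteq> {}"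
    by auto
  then obtain N where "\<forall>n\<ge>N. (f ^^ n) ` ball (f a) d \<inter> ball b d \<noteq> {}"
    using assms unfolding mixing_map_def by meson
  then have "(f ^^ Suc N) ` ball (f a) d \<inter> ball b d \<noteq> {}"
    by (meson le_SucI order_refl)
  then obtain q where q: "q \<in> ball (f a) d" "(f ^^ Suc N) q \<in> ball b d"
    by blast
  have "(a, q) \<in> chain_step f d" "((f ^^ N) q, b) \<in> chain_step f d"
    using q by (simp_all add: chain_step_def dist_commute)
  then have "(a, b) \<in> chain_step f d ^^ Suc (Suc N)"
    using funpow_chain[OF \<open>0 < d\<close>, of q N f] by (intro relpow_Suc_I2[of a q] relpow_Suc_I[of q "(f ^^ N) q"])
  then show "\<exists>n. (a, b) \<in> chain_step f d ^^ n"
    by blast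
qed

lemma (in peano_space) countable_base:
  "\<exists>\<B> :: 'a set set. countable \<B> \<and> (\<forall>B\<in>\<B>. open B \<and> B \<noteq> {}) \<and> (\<forall>U. open U \<and> U \<noteq> {} \<longrightarrow> (\<exists>B\<in>\<B>. B \<subseteq> U))"
proof -
  have "\<forall>n :: nat. \<exists>Y :: 'a set. finite Y \<and> Y \<subseteq> UNIV \<and> UNIV \<subseteq> (\<Union>y\<in>Y. ball y (1 / Suc n))"
    by (intro allI finite_net) simp
  then obtain Y :: "nat \<Rightarrow> 'a set" where Y: "\<And>n. finite (Y n)" "\<And>n. UNIV \<subseteq> (\<Union>y\<in>Y n. ball y (1 / Suc n))"
    by metis
  define \<B> where "\<B> = (\<Union>n. (\<lambda>y. ball y (1 / Suc n)) ` Y n)"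
  have "countable \<B>"
    unfolding \<B>_def using Y(1) by (intro countable_UN countable_image) (auto simp: countable_finite)
  moreover have "\<forall>B\<in>\<B>. open B \<and> B \<noteq> {}"
    by (auto simp: \<B>_def)
  moreover have "\<exists>B\<in>\<B>. B \<subseteq> U" if "open U" "U \<noteq> {}" for U
  proof -
    from that obtain x t where t: "0 < t" "ball x t \<subseteq> U"
      by (meson ex_in_conv openE)
    obtain n where n: "1 / Suc n < t / 2"
      using nat_approx_posE[of "t / 2"] t(1) by auto
    obtain y where y: "y \<in> Y n" "dist y x < 1 / Suc n"
      using Y(2)[of n] by (force simp: subset_iff)
    have "ball y (1 / Suc n) \<subseteq> ball x t"
    proof
      fix w
      assume "w \<in> ball y (1 / Suc n)"
      then have "dist y w < t / 2" "dist y x < t / 2"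
        using n y(2) by auto
      then show "w \<in> ball x t"
        using dist_triangle3[of x w y] by simp
    qed
    then show ?thesis
      using t(2) y(1) unfolding \<B>_def by blast
  qed
  ultimately show ?thesis
    by blast
qed

context lc_dense_space
begin

lemma exact_devaney_dense:
  "dense_in (top_of_set CT_maps) {f :: 'a \<Rightarrow>\<^sub>C 'a. exact_devaney_chaotic (apply_bcontfun f)}"
  (is "dense_in ?T ?D")
proof -
  have sub: "?D \<subseteq> CT_maps"
    by (auto simp: CT_maps_def exact_devaney_chaotic_def exact_map_chain_transitive)
  have "f \<in> ?T closure_of ?D" if f: "f \<in> CT_maps" for f
    unfolding in_closure_of
  proof (intro conjI allI impI)
    show "f \<in> topspace ?T"
      using f by simp
    fix S
    assume S: "f \<in> S \<and> openin ?T S"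
    then obtain O' where O': "open O'" "S = CT_maps \<inter> O'"
      by (auto simp: openin_open)
    then obtain e where e: "0 < e" "ball f e \<subseteq> O'"
      using S openE by blast
    have "0 < e / 2"
      using e(1) by simp
    from exact_devaney_near[OF this] obtain d where d: "0 < d"
      "\<forall>f :: 'a \<Rightarrow> 'a. continuous_on UNIV f \<and> (\<forall>a b. \<exists>n. (a, b) \<in> chain_step f d ^^ n) \<longrightarrow>
        (\<exists>g. continuous_on UNIV g \<and> exact_devaney_chaotic g \<and> (\<forall>x. dist (f x) (g x) < e / 2))"
      by blast
    have "\<forall>a b. \<exists>n. (a, b) \<in> chain_step (apply_bcontfun f) d ^^ n"
      using f d(1) unfolding CT_maps_def chain_transitive_iff by blast
    then obtain g where g: "continuous_on UNIV g" "exact_devaney_chaotic g" "\<And>x. dist (apply_bcontfun f x) (g x) < e / 2"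
      using d(2) by (meson continuous_on_apply_bcontfun)
    have "dist f (Bcontfun g) < e"
      using g(3) e(1) by (intro dist_bcontfun_less) (simp_all add: bcontfun_apply[OF g(1)])
    moreover have "Bcontfun g \<in> ?D"
      using g(2) by (simp add: bcontfun_apply[OF g(1)])
    ultimately show "\<exists>y. y \<in> ?D \<and> y \<in> S"
      using e(2) O'(2) sub by (intro exI[of _ "Bcontfun g"]) auto
  qed
  then have "?T closure_of ?D = CT_maps"
    using closure_of_subset_topspace[of ?T ?D] by auto
  then show ?thesis
    unfolding dense_in_def using sub by simp
qed

lemma mixing_comeager:
  "comeager_in (top_of_set CT_maps) {f :: 'a \<Rightarrow>\<^sub>C 'a. mixing_map (apply_bcontfun f)}"
proof -
  obtain \<B> :: "'a set set" where \<B>: "countable \<B>" "\<forall>B\<in>\<B>. open B \<and> B \<noteq> {}"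
    "\<forall>U. open U \<and> U \<noteq> {} \<longrightarrow> (\<exists>B\<in>\<B>. B \<subseteq> U)"
    using countable_base by blast
  define A where "A k = {f :: 'a \<Rightarrow>\<^sub>C 'a. \<exists>N. \<forall>n\<ge>N. (apply_bcontfun f ^^ n) ` fst k \<inter> snd k \<noteq> {}}" for k
  show ?thesis
  \<comment> \<open>Countably many pairs of open sets are enough, since enlarging \<open>U\<close>
    and \<open>V\<close> preserves the condition.\<close>
  proof (rule comeager_inI[of "\<B> \<times> \<B>" _ _ A])
    show "countable (\<B> \<times> \<B>)"
      using \<B>(1) by blast
    show "{f :: 'a \<Rightarrow>\<^sub>C 'a. mixing_map (apply_bcontfun f)} \<subseteq> CT_maps"
      by (auto simp: CT_maps_def mixing_map_chain_transitive)
    show "f \<in> {f. mixing_map (apply_bcontfun f)}" if all: "\<And>k. k \<in> \<B> \<times> \<B> \<Longrightarrow> f \<in> A k" for f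
    proof -
      have "\<exists>N. \<forall>n\<ge>N. (apply_bcontfun f ^^ n) ` U \<inter> V \<noteq> {}" if "open U" "U \<noteq> {}" "open V" "V \<noteq> {}" for U V
      proof -
        from that \<B>(3) obtain B B' where B: "B \<in> \<B>" "B \<subseteq> U" "B' \<in> \<B>" "B' \<subseteq> V"
          by meson
        have "f \<in> A (B, B')"
          using B by (intro all) simp
        then obtain N where N: "\<forall>n\<ge>N. (apply_bcontfun f ^^ n) ` B \<inter> B' \<noteq> {}"
          by (auto simp: A_def)
        have "(apply_bcontfun f ^^ n) ` B \<inter> B' \<subseteq> (apply_bcontfun f ^^ n) ` U \<inter> V" for n
          using B by blast
        then have "\<forall>n\<ge>N. (apply_bcontfun f ^^ n) ` U \<inter> V \<noteq> {}"
          using N by (metis subset_empty)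
        then show ?thesis
          by blast
      qed
      then show ?thesis
        by (simp add: mixing_map_def)
    qed
    show "\<exists>g\<in>CT_maps. dist f g < e \<and> (\<exists>\<eta>>0. \<forall>f'\<in>CT_maps. dist g f' < \<eta> \<longrightarrow> f' \<in> A k)"
      if k: "k \<in> \<B> \<times> \<B>" and f: "f \<in> CT_maps" and e: "0 < e" for k f e
    proof -
      have UV: "open (fst k)" "fst k \<noteq> {}" "open (snd k)" "snd k \<noteq> {}"
        using k \<B>(2) by auto
      have f': "chain_transitive (apply_bcontfun f)" and "0 < e / 2"
        using f e by (auto simp: CT_maps_def)
      from robust_mixing[OF continuous_on_apply_bcontfun this(1) UV this(2)]
      obtain g \<eta> where g: "continuous_on UNIV g" "exact_devaney_chaotic g" "\<forall>x. dist (apply_bcontfun f x) (g x) < e / 2"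
        and \<eta>: "0 < \<eta>" "\<forall>f. continuous_on UNIV f \<longrightarrow> (\<forall>x. dist (g x) (f x) < \<eta>) \<longrightarrow>
          (\<exists>N. \<forall>n\<ge>N. (f ^^ n) ` fst k \<inter> snd k \<noteq> {})"
        by (elim exE conjE) (rule that)
      have "dist f (Bcontfun g) < e"
        using g(3) e by (intro dist_bcontfun_less) (simp_all add: bcontfun_apply[OF g(1)])
      moreover have "Bcontfun g \<in> CT_maps"
        using g(2) by (simp add: bcontfun_apply[OF g(1)] CT_maps_def exact_devaney_chaotic_def exact_map_chain_transitive)
      moreover have "f' \<in> A k" if "dist (Bcontfun g) f' < \<eta>" for f'
      proof -
        have "dist (g x) (apply_bcontfun f' x) < \<eta>" for x
          using dist_bounded[of "Bcontfun g" x f'] that by (simp add: bcontfun_apply[OF g(1)])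
        then show ?thesis
          unfolding A_def using \<eta>(2) by (simp add: continuous_on_apply_bcontfun)
      qed
      ultimately show ?thesis
        using \<eta>(1) by blast
    qed
  qed
qed

lemma shadowing_comeager:
  "comeager_in euclidean {f :: 'a \<Rightarrow>\<^sub>C 'a. shadowing (apply_bcontfun f)}"
proof -
  define sh where "sh \<epsilon> f \<longleftrightarrow> (\<exists>\<delta>>0. \<forall>x :: nat \<Rightarrow> 'a. (\<forall>i. dist (f (x i)) (x (Suc i)) < \<delta>) \<longrightarrow>
    (\<exists>z. \<forall>i. dist (x i) ((f ^^ i) z) < \<epsilon>))" for \<epsilon> and f :: "'a \<Rightarrow> 'a"
  have sh_mono: "sh \<epsilon> f" if "sh \<epsilon>' f" "\<epsilon>' \<le> \<epsilon>" for \<epsilon> \<epsilon>' f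
    using that unfolding sh_def by (meson less_le_trans)
  define A where "A n = {f :: 'a \<Rightarrow>\<^sub>C 'a. sh (1 / Suc n) (apply_bcontfun f)}" for n
  have "comeager_in (top_of_set UNIV) {f :: 'a \<Rightarrow>\<^sub>C 'a. shadowing (apply_bcontfun f)}"
  proof (rule comeager_inI[of "UNIV :: nat set" _ _ A])
    show "f \<in> {f. shadowing (apply_bcontfun f)}" if all: "\<And>k. k \<in> UNIV \<Longrightarrow> f \<in> A k" for f
    proof -
      have "sh \<epsilon> (apply_bcontfun f)" if \<epsilon>: "0 < \<epsilon>" for \<epsilon>
      proof -
        obtain n where "1 / Suc n < \<epsilon>"
          using \<epsilon> nat_approx_posE by blast
        moreover have "sh (1 / Suc n) (apply_bcontfun f)"
          using all[of n] by (simp add: A_def)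
        ultimately show ?thesis
          using sh_mono by (meson less_imp_le)
      qed
      then show ?thesis
        by (simp add: shadowing_def sh_def)
    qed
    show "\<exists>g\<in>UNIV. dist f g < e \<and> (\<exists>\<eta>>0. \<forall>f'\<in>UNIV. dist g f' < \<eta> \<longrightarrow> f' \<in> A n)"
      if e: "0 < e" for n f e
    proof -
      \<comment> \<open>One number serves both as the distance from \<open>f\<close> and as the
        precision of shadowing.\<close>
      define \<epsilon> where "\<epsilon> = min (e / 2) (1 / Suc n)"
      have \<epsilon>: "0 < \<epsilon>" "\<epsilon> \<le> e / 2" "\<epsilon> \<le> 1 / Suc n"
        using e by (auto simp: \<epsilon>_def)
      from robust_shadowing[OF continuous_on_apply_bcontfun \<epsilon>(1), of f, folded sh_def]
      obtain g \<eta> where g: "continuous_on UNIV g" "\<forall>x. dist (apply_bcontfun f x) (g x) < \<epsilon>"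
        and \<eta>: "0 < \<eta>" "\<forall>f. continuous_on UNIV f \<longrightarrow> (\<forall>x. dist (g x) (f x) < \<eta>) \<longrightarrow> sh \<epsilon> f"
        by (elim exE conjE) (rule that)
      have "dist (apply_bcontfun f x) (apply_bcontfun (Bcontfun g) x) < e / 2" for x
        using g(2)[rule_format, of x] \<epsilon>(2) by (simp add: bcontfun_apply[OF g(1)])
      then have "dist f (Bcontfun g) < e"
        using e by (rule dist_bcontfun_less)
      moreover have "f' \<in> A n" if "dist (Bcontfun g) f' < \<eta>" for f'
      proof -
        have "dist (g x) (apply_bcontfun f' x) < \<eta>" for x
          using dist_bounded[of "Bcontfun g" x f'] that by (simp add: bcontfun_apply[OF g(1)])
        then have "sh \<epsilon> (apply_bcontfun f')"
          using \<eta>(2) by (simp add: continuous_on_apply_bcontfun)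
        then show ?thesis
          unfolding A_def using sh_mono \<epsilon>(3) by blast
      qed
      ultimately show ?thesis
        using \<eta>(1) by blast
    qed
  qed simp_all
  then show ?thesis
    by simp
qed

end

section \<open>The theorem, with the one-point space apart\<close>

lemma meager_in_empty: "meager_in T {}"
  unfolding meager_in_def by (intro exI[of _ "{}"]) simp

theorem theorem2:
  assumes "peano_continuum (UNIV :: 'a::metric_space set)"
    and "covering_dim (euclidean :: 'a topology) = 1 \<or>
         compact_ANR (UNIV :: 'a set) \<or>
         dense_in euclidean (LC_maps :: ('a \<Rightarrow>\<^sub>C 'a) set)"
  shows "dense_in (top_of_set CT_maps)
           {f :: 'a \<Rightarrow>\<^sub>C 'a. exact_devaney_chaotic (apply_bcontfun f)}
    \<and> comeager_in (top_of_set CT_maps)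
           {f :: 'a \<Rightarrow>\<^sub>C 'a. mixing_map (apply_bcontfun f)}
    \<and> comeager_in euclidean
           {f :: 'a \<Rightarrow>\<^sub>C 'a. shadowing (apply_bcontfun f)}"
proof (cases "\<exists>a b :: 'a. a \<noteq> b")
  case True
  interpret peano_space "TYPE('a)"
    using assms(1) True by unfold_locales (auto simp: peano_continuum_def)
  interpret lc_dense_space "TYPE('a)"
  proof
    show "\<exists>h. continuous_on UNIV h \<and> lc_on UNIV h \<and> (\<forall>x. dist (f x) (h x) < e)"
      if "continuous_on UNIV f" "0 < e" for f :: "'a \<Rightarrow> 'a" and e
      using assms(2) lc_dense_if_dim_1[OF covering_dim_eq_1D that] lc_dense_if_ANR[OF _ that]
        lc_dense_if_LC_maps_dense[OF _ that] by blast
  qed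
  show ?thesis
    using exact_devaney_dense mixing_comeager shadowing_comeager by blast
next
  \<comment> \<open>On a one-point space every map is the identity and has all the properties, and
    \<open>CT_maps\<close> is the whole space.\<close>
  case False
  then have eq: "x = y" for x y :: 'a
    by blast
  have sets: "U = UNIV" if "U \<noteq> {}" for U :: "'a set"
    using that eq by (metis UNIV_eq_I all_not_in_conv)
  have exact: "exact_devaney_chaotic g" for g :: "'a \<Rightarrow> 'a"
  proof -
    have "(g ^^ 1) ` U = UNIV" if "U \<noteq> {}" for U
      using that by (intro sets) simp
    then have "exact_map g"
      unfolding exact_map_def by (metis order_refl)
    moreover have "transitive_map g"
      unfolding transitive_map_def using sets by (metis Int_UNIV_right image_is_empty order_refl)
    moreover have "(g ^^ 1) x = x" for x
      by (rule eq)
    then have "periodic_points g = UNIV"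
      unfolding periodic_points_def by blast
    ultimately show ?thesis
      by (simp add: exact_devaney_chaotic_def devaney_chaotic_def)
  qed
  have mixing: "mixing_map g" for g :: "'a \<Rightarrow> 'a"
    unfolding mixing_map_def using sets by (metis Int_UNIV_right image_is_empty)
  have shadow: "shadowing g" for g :: "'a \<Rightarrow> 'a"
    unfolding shadowing_def using eq by (metis dist_self)
  have "CT_maps = (UNIV :: ('a \<Rightarrow>\<^sub>C 'a) set)"
    using exact by (auto simp: CT_maps_def exact_devaney_chaotic_def exact_map_chain_transitive)
  then show ?thesis
    using exact mixing shadow by (simp add: dense_in_def comeager_in_def meager_in_empty)
qed

end
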